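(* Let $\psi\in C([0,\infty);\mathbb{R})\cap C^\infty((0,\infty);\mathbb{R})$ be a non-trivial solution, with $\psi(0)=0$, of $$\psi^{(4)} = 6(\psi')^2\psi'' + \frac{8}{r}\left((\psi')^3-\psi^{(3)}\right) - \frac{4}{r^2}\left((1-\cos(2\psi))\psi'' + \sin(2\psi)(\psi')^2\right) + \frac{8}{r^3}(\cos(2\psi)+2)\psi' - \frac{12}{r^4}\sin(2\psi)$$ on $(0,\infty)$. Set $\phi(s)=\psi(e^s)$ for $s\in\mathbb{R}$, which solves $$\phi^{(4)} = (4\cos(2\phi)+9)\phi'' - 12\sin(2\phi) + (6\phi''-4\sin(2\phi))(\phi')^2 + (4\cos(2\phi)+10)\phi' + 2(\phi')^3 - 2\phi^{(3)}.$$ Then $\phi$ is a heteroclinic orbit of this autonomous equation connecting the origin and either $(-\pi/2,0,0,0)$ or $(\pi/2,0,0,0)$. Moreover, such a $\psi$ exists.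
   Context: Non-trivial means not identically zero. The autonomous equation is viewed as a first-order system for $(\phi,\phi',\phi'',\phi^{(3)})\in\mathbb{R}^4$. A heteroclinic orbit connecting the origin and a point $p \in \mathbb{R}^4$ is a solution defined for all $s\in\mathbb{R}$ with $(\phi,\phi',\phi'',\phi^{(3)})(s)\to 0$ as $s\to-\infty$ and $(\phi,\phi',\phi'',\phi^{(3)})(s)\to p$ as $s\to\infty$. *)

theory Defs
  imports "HOL-Analysis.Analysis"
begin

text \<open>For open \<open>S\<close> this is membership in \<open>C\<^sup>\<infinity>(S)\<close>: differentiability of
  \<open>(deriv ^^ Suc k) f\<close> on \<open>S\<close> makes it continuous there.  On an open set \<open>deriv\<close> depends only
  on the values of \<open>f\<close> in \<open>S\<close>.\<close>

definition smooth_on :: "real set \<Rightarrow> (real \<Rightarrow> real) \<Rightarrow> bool" where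
  "smooth_on S f \<longleftrightarrow> (\<forall>k. \<forall>x\<in>S. (deriv ^^ k) f differentiable (at x))"

definition solves_radial_equation :: "(real \<Rightarrow> real) \<Rightarrow> bool" where
  "solves_radial_equation \<psi> \<longleftrightarrow>
    (\<forall>r>0. (deriv ^^ 4) \<psi> r =
        6 * (deriv \<psi> r)^2 * (deriv ^^ 2) \<psi> r
      + 8 / r * ((deriv \<psi> r)^3 - (deriv ^^ 3) \<psi> r)
      - 4 / r^2 * ((1 - cos (2 * \<psi> r)) * (deriv ^^ 2) \<psi> r
                   + sin (2 * \<psi> r) * (deriv \<psi> r)^2)
      + 8 / r^3 * (cos (2 * \<psi> r) + 2) * deriv \<psi> r
      - 12 / r^4 * sin (2 * \<psi> r))"

text \<open>Functions on \<open>[0,\<infinity>)\<close> are represented by total functions, whose values at negative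
  arguments play no role; hence non-triviality is required on \<open>[0,\<infinity>)\<close>.\<close>

definition nontrivial_radial_solution :: "(real \<Rightarrow> real) \<Rightarrow> bool" where
  "nontrivial_radial_solution \<psi> \<longleftrightarrow>
    continuous_on {0..} \<psi> \<and> smooth_on {0<..} \<psi> \<and> \<psi> 0 = 0 \<and>
    (\<exists>r\<ge>0. \<psi> r \<noteq> 0) \<and> solves_radial_equation \<psi>"

definition autonomous_rhs :: "real \<Rightarrow> real \<Rightarrow> real \<Rightarrow> real \<Rightarrow> real" where
  "autonomous_rhs y\<^sub>0 y\<^sub>1 y\<^sub>2 y\<^sub>3 =
      (4 * cos (2 * y\<^sub>0) + 9) * y\<^sub>2 - 12 * sin (2 * y\<^sub>0)
    + (6 * y\<^sub>2 - 4 * sin (2 * y\<^sub>0)) * y\<^sub>1^2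
    + (4 * cos (2 * y\<^sub>0) + 10) * y\<^sub>1 + 2 * y\<^sub>1^3 - 2 * y\<^sub>3"

definition solves_autonomous_equation :: "(real \<Rightarrow> real) \<Rightarrow> bool" where
  "solves_autonomous_equation \<phi> \<longleftrightarrow>
    (\<forall>s. (\<forall>k<4. (deriv ^^ k) \<phi> differentiable (at s)) \<and>
         (deriv ^^ 4) \<phi> s =
           autonomous_rhs (\<phi> s) (deriv \<phi> s) ((deriv ^^ 2) \<phi> s) ((deriv ^^ 3) \<phi> s))"

lemma vector_4 [simp]:
  fixes a b c d :: "'a::zero"
  shows "(vector [a, b, c, d] :: 'a^4) $ 1 = a" "(vector [a, b, c, d] :: 'a^4) $ 2 = b"
    "(vector [a, b, c, d] :: 'a^4) $ 3 = c" "(vector [a, b, c, d] :: 'a^4) $ 4 = d"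
  unfolding vector_def by simp_all

definition autonomous_field :: "real^4 \<Rightarrow> real^4" where
  "autonomous_field y = vector [y $ 2, y $ 3, y $ 4, autonomous_rhs (y $ 1) (y $ 2) (y $ 3) (y $ 4)]"

definition phase_curve :: "(real \<Rightarrow> real) \<Rightarrow> real \<Rightarrow> real^4" where
  "phase_curve \<phi> s = vector [\<phi> s, deriv \<phi> s, (deriv ^^ 2) \<phi> s, (deriv ^^ 3) \<phi> s]"

definition heteroclinic_orbit ::
    "('a::real_normed_vector \<Rightarrow> 'a) \<Rightarrow> (real \<Rightarrow> 'a) \<Rightarrow> 'a \<Rightarrow> 'a \<Rightarrow> bool" where
  "heteroclinic_orbit F x p q \<longleftrightarrow>
    (\<forall>s. (x has_vector_derivative F (x s)) (at s)) \<and>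
    (x \<longlongrightarrow> p) at_bot \<and> (x \<longlongrightarrow> q) at_top"

end

theory Submission
  imports Defs
begin

text \<open>Write \<open>v, y, z\<close> for the first three derivatives of \<open>\<phi>\<close>. Multiplying the autonomous equation by \<open>v\<close>
  gives an energy that never decreases; it equals \<open>-6\<close> at the rest points \<open>k \<pi>\<close> and \<open>6\<close> at the rest
  points \<open>\<pi>/2 + k \<pi>\<close>. Energy above 6 forces \<open>v\<close> to keep its sign, and then \<open>sqrt \<bar>v\<bar>\<close> satisfies a
  superlinear inequality and blows up. So on a global solution the energy is bounded, its rate of change
  tends to 0, and the solution converges to a rest point; since the energy starts at \<open>-6\<close> and increases
  strictly, the limit of \<open>\<phi>\<close> is an odd multiple of \<open>\<pi>/2\<close>. A solution that passes through a multiple of \<open>\<pi>\<close>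
  with energy above \<open>-6\<close> must blow up, which leaves only \<open>\<pi>/2\<close> and \<open>-\<pi>/2\<close>.

  For existence, small initial data of energy above \<open>-6\<close> on a half circle joining a point to its
  antipode are shot forward. By odd symmetry and connectedness one of them never exceeds energy 6, so it
  is global and must leave the strip \<open>\<bar>\<phi>\<bar> < \<pi>/4\<close>. Translating the exit time to 0 and letting the data tend to the
  origin, the exit point converges along a subsequence to a point whose orbit emanates from the origin.\<close>

text \<open>Because of the product \<open>v z\<close> the energy is indefinite: bounded energy does
  not bound the state. Instead \<open>v^2 - energy / 2\<close> is nonincreasing, which bounds
  \<open>v\<close>; a maximum principle for \<open>y'' + 2 y' = force\<close> then bounds
  \<open>y\<close>, and the damping bounds \<open>z\<close>. The angle \<phi> enters only through
  \<open>sin (2 \<phi>)\<close> and \<open>cos (2 \<phi>)\<close>. The delicate step is the crossing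
  of a multiple of \<pi>. The potential is lowest there, so the kinetic part is positive, but the
  climb to the next odd multiple of \<pi>/2 might consume it. Excluding this takes a bound on
  \<open>sin \<phi> / v\<close>, although \<open>y / v\<close> is arbitrary at the crossing. The
  linearization at the origin has roots 1, 3, -2, -4, but no invariant manifold is used: the
  quadratic part of the energy has signature (2,2), the data lie in a plane where it is positive
  definite, and compactness turns forward solutions into one that emanates from the origin. The
  field is not globally Lipschitz, so the flows are those of a field truncated in \<open>v\<close>,
  \<open>y\<close>, \<open>z\<close>; a priori bounds show where the truncation is inactive.\<close>

section \<open>Calculus on the line\<close>

text \<open>Invariance of a region cut out by finitely many inequalities. The derivative condition
  concerns only times at which the whole family is nonnegative, so each face may use the
  inequalities of the others. At the infimum of the violating times all members are still
  nonnegative, and just after it each is positive by continuity or increases from 0.\<close>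

lemma barrier:
  fixes F :: "(real \<Rightarrow> real) set"
  assumes fin: "finite F"
    and cont: "\<And>f t. f \<in> F \<Longrightarrow> t \<in> {a..b} \<Longrightarrow> isCont f t"
    and init: "\<And>f. f \<in> F \<Longrightarrow> 0 \<le> f a"
    and step: "\<And>t f. t \<in> {a..b} \<Longrightarrow> (\<And>g. g \<in> F \<Longrightarrow> 0 \<le> g t) \<Longrightarrow> f \<in> F \<Longrightarrow> f t = 0 \<Longrightarrow>
       \<exists>D>0. (f has_real_derivative D) (at t)"
    and "f \<in> F" "t \<in> {a..b}"
  shows "0 \<le> f t"
proof (rule ccontr)
  define B where "B = {t \<in> {a..b}. \<exists>g\<in>F. g t < 0}"
  assume "\<not> 0 \<le> f t"
  then have tB: "t \<in> B" using assms(5,6) by (force simp: B_def not_le)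
  have bdd: "bdd_below B" by (rule bdd_belowI[of _ a]) (auto simp: B_def)
  define c where "c = Inf B"
  have ca: "a \<le> c" unfolding c_def by (rule cInf_greatest) (use tB in \<open>auto simp: B_def\<close>)
  have ct: "c \<le> t" unfolding c_def by (rule cInf_lower[OF tB bdd])
  have cab: "c \<in> {a..b}" using ca ct assms(6) by auto
  have below: "0 \<le> g s" if "g \<in> F" "a \<le> s" "s < c" for g s
  proof (rule ccontr)
    assume "\<not> 0 \<le> g s"
    then have "s \<in> B" using that cab by (force simp: B_def not_le)
    then have "c \<le> s" unfolding c_def by (rule cInf_lower[OF _ bdd])
    then show False using that by auto
  qed
  have atc: "0 \<le> g c" if g: "g \<in> F" for g
  proof (cases "c = a")
    case True then show ?thesis using init[OF g] by simp
  next
    case False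
    then have "a < c" using ca by simp
    have "(g \<longlongrightarrow> g c) (at_left c)"
      using cont[OF g cab] by (simp add: isCont_def filterlim_at_split)
    moreover have "eventually (\<lambda>s. 0 \<le> g s) (at_left c)"
      using eventually_at_left[OF \<open>a < c\<close>] below[OF g] \<open>a < c\<close> by (metis order_less_imp_le)
    ultimately show ?thesis by (intro tendsto_lowerbound[of g _ "at_left c"]) auto
  qed
  have ev: "eventually (\<lambda>s. 0 \<le> g s) (at_right c)" if g: "g \<in> F" for g
  proof (cases "g c = 0")
    case True
    obtain D where D: "D > 0" "(g has_real_derivative D) (at c)"
      using step[of c g] cab atc g True by blast
    from DERIV_pos_inc_right[OF D(2,1)] obtain d where d: "d > 0" "\<And>h. 0 < h \<Longrightarrow> h < d \<Longrightarrow> g c < g (c + h)"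
      by auto
    show ?thesis unfolding eventually_at_right_field
    proof (intro exI[of _ "c + d"] conjI allI impI)
      fix y assume "c < y" "y < c + d"
      then show "0 \<le> g y" using d(2)[of "y - c"] True by auto
    qed (use d in auto)
  next
    case False
    then have "0 < g c" using atc[OF g] by auto
    moreover have "(g \<longlongrightarrow> g c) (at_right c)"
      using cont[OF g cab] by (simp add: isCont_def filterlim_at_split)
    ultimately have "eventually (\<lambda>s. 0 < g s) (at_right c)" by (simp add: order_tendstoD(1))
    then show ?thesis by eventually_elim simp
  qed
  have "eventually (\<lambda>s. \<forall>g\<in>F. 0 \<le> g s) (at_right c)"
    using fin ev by (intro eventually_ball_finite) auto
  then obtain d where d: "d > c" "\<And>s g. c < s \<Longrightarrow> s < d \<Longrightarrow> g \<in> F \<Longrightarrow> 0 \<le> g s"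
    unfolding eventually_at_right_field by blast
  have "d \<le> c" unfolding c_def
  proof (rule cInf_greatest)
    show "B \<noteq> {}" using tB by auto
    fix s assume s: "s \<in> B"
    then have "c \<le> s" unfolding c_def by (rule cInf_lower[OF _ bdd])
    show "d \<le> s"
    proof (rule ccontr)
      assume "\<not> d \<le> s"
      then have "0 \<le> g s" if "g \<in> F" for g
        using d(2)[of s g] atc[OF that] that \<open>c \<le> s\<close> by (cases "s = c") auto
      then show False using s by (force simp: B_def)
    qed
  qed
  then show False using d by simp
qed

lemma deriv_nonneg_imp_le:
  fixes f f' :: "real \<Rightarrow> real"
  assumes "a \<le> b" "\<And>t. a \<le> t \<Longrightarrow> t \<le> b \<Longrightarrow> (f has_real_derivative f' t) (at t)"
    and "\<And>t. a \<le> t \<Longrightarrow> t \<le> b \<Longrightarrow> 0 \<le> f' t"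
  shows "f a \<le> f b"
  by (rule DERIV_nonneg_imp_nondecreasing[OF assms(1)]) (use assms(2,3) in force)

text \<open>\<open>1 / w + c t\<close> is nonincreasing, so \<open>1 / w\<close> would reach 0 in
  finite time.\<close>

lemma quadratic_growth_blowup:
  fixes w w1 :: "real \<Rightarrow> real"
  assumes w: "\<And>t. t \<ge> s \<Longrightarrow> (w has_real_derivative w1 t) (at t)"
    and pos: "\<And>t. t \<ge> s \<Longrightarrow> 0 < w t"
    and c: "0 < c" and ineq: "\<And>t. t \<ge> s \<Longrightarrow> c * (w t)^2 \<le> w1 t"
  shows False
proof -
  \<comment> \<open>The time at which the upper bound \<open>1 / w s - c (t - s)\<close> for
    \<open>1 / w t\<close> vanishes.\<close>
  define b where "b = s + 1 / (c * w s)"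
  have bs: "b \<ge> s" unfolding b_def using c pos[of s] by simp
  have "inverse (w b) + c * b \<le> inverse (w s) + c * s"
  proof (rule DERIV_nonpos_imp_nonincreasing[OF bs, of "\<lambda>t. inverse (w t) + c * t"])
    fix t assume t: "s \<le> t" "t \<le> b"
    have "((\<lambda>t. inverse (w t) + c * t) has_real_derivative (c - w1 t / (w t)^2)) (at t)"
      using pos[OF t(1)] by (auto intro!: derivative_eq_intros w[OF t(1)] simp: power2_eq_square divide_inverse algebra_simps)
    moreover have "c - w1 t / (w t)^2 \<le> 0"
      using ineq[OF t(1)] pos[OF t(1)] by (simp add: pos_le_divide_eq)
    ultimately show "\<exists>y. ((\<lambda>t. inverse (w t) + c * t) has_real_derivative y) (at t) \<and> y \<le> 0" by blast
  qed
  moreover have "c * b = c * s + inverse (w s)" unfolding b_def using c pos[of s] by (simp add: field_simps)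
  ultimately have "inverse (w b) \<le> 0" by simp
  then show False using pos[OF bs] by simp
qed

text \<open>On the face \<open>w1 = c w^2\<close> of the region used in
  \<open>convex_superlinear_blowup\<close> the left side is \<open>2 w1\<close> plus the derivative
  of \<open>c w^2\<close>. The squares \<open>w (w - 1)^2\<close> and \<open>w (w^2 - 1)^2\<close>
  compare its powers with \<open>w\<close> and \<open>w^5\<close>.\<close>

lemma quintic_ge_quadratic_cubic:
  fixes w c :: real
  assumes w: "0 < w" and c: "0 < c" "c \<le> 1/4"
  shows "2 * c * w^2 + 2 * c * w * (c * w^2) \<le> 5/4 * w + 3/4 * w ^ 5"
proof -
  have a1: "2 * c * w^2 \<le> 1/2 * w^2" using c by (intro mult_right_mono) auto
  have "c * c \<le> 1/4 * (1/4)" using c by (intro mult_mono) auto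
  then have "2 * (c * c) * w^3 \<le> 1/8 * w^3" using w by (intro mult_right_mono) auto
  then have a2: "2 * c * w * (c * w^2) \<le> 1/8 * w^3" by (simp add: power2_eq_square power3_eq_cube mult_ac)
  have "0 \<le> w * (w - 1)^2" "0 \<le> w * (w^2 - 1)^2" using w by simp_all
  moreover have "w * (w - 1)^2 = w + w^3 - 2 * w^2" "w * (w^2 - 1)^2 = w + w^5 - 2 * w^3"
    by (simp_all add: eval_nat_numeral algebra_simps)
  ultimately have a3: "w^2 \<le> (w + w^3) / 2" and a4: "w^3 \<le> (w + w^5) / 2"
    by (simp_all only: field_simps)
  have "1/2 * w^2 + 1/8 * w^3 \<le> 5/4 * w + 3/4 * w ^ 5"
    using a3 a4 w zero_less_power[OF w, of 5] by argo
  then show ?thesis using add_mono[OF a1 a2] by (rule order_trans[rotated])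
qed

text \<open>Two stages. \<open>exp (2 t) w1\<close> is nondecreasing; if it never became positive,
  \<open>w\<close> would stay below \<open>w a\<close>, and the term \<open>d / w^3\<close> would
  keep the slope above a positive constant, a contradiction. Once \<open>w1 > 0\<close>, the quintic
  growth preserves \<open>w1 >= c w^2\<close>, and \<open>quadratic_growth_blowup\<close>
  applies.\<close>

lemma convex_superlinear_blowup:
  fixes w w1 w2 :: "real \<Rightarrow> real"
  assumes w: "\<And>t. t \<ge> a \<Longrightarrow> (w has_real_derivative w1 t) (at t)"
    and w1: "\<And>t. t \<ge> a \<Longrightarrow> (w1 has_real_derivative w2 t) (at t)"
    and pos: "\<And>t. t \<ge> a \<Longrightarrow> 0 < w t"
    and d: "0 < d"
    and ineq: "\<And>t. t \<ge> a \<Longrightarrow> w2 t + 2 * w1 t \<ge> d / w t ^ 3 + 5/4 * w t + 3/4 * w t ^ 5"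
  shows False
proof -
  define g where "g t = exp (2 * t) * w1 t" for t
  have g: "(g has_real_derivative exp (2 * t) * (w2 t + 2 * w1 t)) (at t)" if "t \<ge> a" for t
    unfolding g_def by (auto intro!: derivative_eq_intros w1[OF that] simp: algebra_simps)
  have R: "w2 t + 2 * w1 t \<ge> d / w t ^ 3" if "t \<ge> a" for t
  proof -
    have "0 < w t ^ 5" using pos[OF that] by simp
    then show ?thesis using ineq[OF that] pos[OF that] by linarith
  qed
  have R0: "0 \<le> exp (2 * t) * (w2 t + 2 * w1 t)" if "t \<ge> a" for t
  proof -
    have "0 < d / w t ^ 3" using pos[OF that] d by simp
    then have "0 \<le> w2 t + 2 * w1 t" using R[OF that] by linarith
    then show ?thesis by simp
  qed
  have gmono: "g s \<le> g t" if st: "a \<le> s" "s \<le> t" for s t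
  proof (rule deriv_nonneg_imp_le[OF st(2)])
    fix u assume "s \<le> u" "u \<le> t"
    then have "a \<le> u" using st by simp
    then show "(g has_real_derivative exp (2 * u) * (w2 u + 2 * w1 u)) (at u)"
      and "0 \<le> exp (2 * u) * (w2 u + 2 * w1 u)" by (rule g, rule R0)
  qed
  have "\<exists>s\<ge>a. g s > 0"
  proof (rule ccontr)
    assume "\<not> ?thesis"
    then have neg: "g s \<le> 0" if "s \<ge> a" for s using that not_le by blast
    have w1neg: "w1 s \<le> 0" if "s \<ge> a" for s
      using neg[OF that] by (simp add: g_def mult_le_0_iff)
    have wdec: "w t \<le> w a" if t: "t \<ge> a" for t
    proof -
      have "- w a \<le> - w t"
        by (rule deriv_nonneg_imp_le[OF t, of "\<lambda>t. - w t" "\<lambda>t. - w1 t"])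
           (use w w1neg in \<open>auto intro: DERIV_minus\<close>)
      then show ?thesis by simp
    qed
    define k where "k = exp (2 * a) * (d / w a ^ 3)"
    have k: "k > 0" unfolding k_def using d pos[of a] by simp
    have slope: "k \<le> exp (2 * t) * (w2 t + 2 * w1 t)" if t: "t \<ge> a" for t
    proof -
      have "d / w a ^ 3 \<le> d / w t ^ 3"
        using wdec[OF t] pos[OF t] pos[of a] d by (intro divide_left_mono power_mono mult_pos_pos zero_less_power) auto
      also have "\<dots> \<le> w2 t + 2 * w1 t" by (rule R[OF t])
      finally have "d / w a ^ 3 \<le> w2 t + 2 * w1 t" .
      moreover have "0 \<le> d / w a ^ 3" using d pos[of a] by simp
      ultimately show ?thesis unfolding k_def using t by (intro mult_mono) auto
    qed
    \<comment> \<open>Here the linear lower bound of slope \<open>k\<close> for \<open>g\<close>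
      reaches 1.\<close>
    define b where "b = a + (1 - g a) / k"
    have ba: "a \<le> b" unfolding b_def using k neg[of a] by simp
    have "(g a - k * a) \<le> (g b - k * b)"
    proof (rule deriv_nonneg_imp_le[OF ba, of "\<lambda>t. g t - k * t"])
      fix t assume t: "a \<le> t" "t \<le> b"
      show "((\<lambda>t. g t - k * t) has_real_derivative exp (2 * t) * (w2 t + 2 * w1 t) - k) (at t)"
        by (auto intro!: derivative_eq_intros g t)
      show "0 \<le> exp (2 * t) * (w2 t + 2 * w1 t) - k" using slope[OF t(1)] by simp
    qed
    then have "g b \<ge> 1" unfolding b_def using k by (simp add: field_simps)
    then show False using neg[OF ba] by simp
  qed
  then obtain s where s: "s \<ge> a" "g s > 0" by blast
  have w1pos: "w1 t > 0" if "t \<ge> s" for t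
  proof -
    have "g t > 0" using gmono[OF s(1) that] s(2) by simp
    then show ?thesis by (simp add: g_def zero_less_mult_iff)
  qed
  \<comment> \<open>The first entry is required by \<open>quintic_ge_quadratic_cubic\<close>; the
    second makes \<open>w1 >= c w^2\<close> true at \<open>s\<close>.\<close>
  define c where "c = min (1/4) (w1 s / (w s)^2)"
  have c: "0 < c" "c \<le> 1/4" "c * (w s)^2 \<le> w1 s"
  proof -
    have p: "(w s)^2 > 0" "w1 s > 0" using pos[OF s(1)] w1pos[of s] by auto
    show "0 < c" using p by (auto simp: c_def)
    show "c \<le> 1/4" unfolding c_def by (rule min.cobounded1)
    have "c * (w s)^2 \<le> w1 s / (w s)^2 * (w s)^2" using p by (intro mult_right_mono) (auto simp: c_def)
    also have "\<dots> = w1 s" using p by simp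
    finally show "c * (w s)^2 \<le> w1 s" .
  qed
  define p where "p t = w1 t - c * (w t)^2" for t
  have pd: "(p has_real_derivative w2 t - 2 * c * w t * w1 t) (at t)" if "t \<ge> a" for t
    unfolding p_def by (auto intro!: derivative_eq_intros w1[OF that] w[OF that] simp: power2_eq_square)
  have pnn: "p t \<ge> 0" if t: "t \<ge> s" for t
  proof (rule barrier[of "{p}" s t p t])
    fix f u assume u: "u \<in> {s..t}" "f \<in> {p}" "f u = 0"
    have ua: "u \<ge> a" using u s by auto
    have eq: "w1 u = c * (w u)^2" using u by (simp add: p_def)
    have wp: "w u > 0" using pos[OF ua] .
    have "w2 u \<ge> 5/4 * w u + 3/4 * w u ^ 5 - 2 * (c * (w u)^2) + d / w u ^ 3" using ineq[OF ua] eq by linarith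
    moreover have "d / w u ^ 3 > 0" using d wp by simp
    ultimately have "w2 u - 2 * c * w u * w1 u > 0"
      using quintic_ge_quadratic_cubic[OF wp c(1,2)] unfolding eq by linarith
    then show "\<exists>D>0. (f has_real_derivative D) (at u)" using pd[OF ua] u(2) by blast
  next
    fix f u assume "f \<in> {p}" "u \<in> {s..t}"
    then show "isCont f u" using pd[of u] s by (auto intro: DERIV_isCont)
  next
    fix f assume "f \<in> {p}"
    then show "0 \<le> f s" using c by (simp add: p_def)
  qed (use t in auto)
  show False
  proof (rule quadratic_growth_blowup[of s w w1 c])
    fix t assume t: "t \<ge> s"
    then have "t \<ge> a" using s by simp
    then show "(w has_real_derivative w1 t) (at t)" "0 < w t" by (rule w, rule pos)
    show "c * (w t)^2 \<le> w1 t" using pnn[OF t] by (simp add: p_def)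
  qed (rule c)
qed

section \<open>Damped comparison principles and limits of derivatives\<close>

lemma damped_second_order_max_principle:
  fixes y z g :: "real \<Rightarrow> real"
  assumes pq: "p \<le> q"
    and y: "\<And>t. t \<in> {p..q} \<Longrightarrow> (y has_real_derivative z t) (at t)"
    and z: "\<And>t. t \<in> {p..q} \<Longrightarrow> (z has_real_derivative g t - 2 * z t) (at t)"
    and g: "\<And>t. t \<in> {p..q} \<Longrightarrow> y t > M \<Longrightarrow> g t > 0"
    and bd: "y p \<le> M" "y q \<le> M"
    and t: "t \<in> {p..q}"
  shows "y t \<le> M"
proof (rule ccontr)
  assume "\<not> y t \<le> M"
  have "continuous_on {p..q} y" using y by (meson DERIV_isCont continuous_at_imp_continuous_on)
  then obtain m where m: "m \<in> {p..q}" "\<And>s. s \<in> {p..q} \<Longrightarrow> y s \<le> y m"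
    using continuous_attains_sup[of "{p..q}" y] pq by auto
  have ym: "y m > M" using m(2)[OF t] \<open>\<not> y t \<le> M\<close> by simp
  then have mpq: "p < m" "m < q" using bd m(1) by (metis atLeastAtMost_iff le_less not_le)+
  \<comment> \<open>At an interior maximum \<open>z = 0\<close>, so \<open>z' = g > 0\<close> there
    and \<open>y\<close> would increase just to the right of it.\<close>
  have z0: "z m = 0"
    by (rule DERIV_local_max[OF y[OF m(1)], of "min (m - p) (q - m)"])
       (use mpq m(2) in \<open>auto simp: abs_if split: if_splits\<close>)
  have "(z has_real_derivative g m) (at m)" using z[OF m(1)] z0 by simp
  from DERIV_pos_inc_right[OF this g[OF m(1) ym]]
  obtain d where d: "d > 0" "\<And>h. 0 < h \<Longrightarrow> h < d \<Longrightarrow> z m < z (m + h)" by auto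
  define e where "e = min (d/2) (q - m)"
  have e: "e > 0" "e < d" "m + e \<le> q" using d mpq by (auto simp: e_def)
  have "\<exists>\<xi>. m < \<xi> \<and> \<xi> < m + e \<and> y (m + e) - y m = (m + e - m) * z \<xi>"
    by (rule MVT2) (use e m y in auto)
  then obtain \<xi> where \<xi>: "m < \<xi>" "\<xi> < m + e" "y (m + e) - y m = e * z \<xi>" by auto
  have "z \<xi> > 0" using d(2)[of "\<xi> - m"] \<xi> e z0 by auto
  then have "y (m + e) > y m" using \<xi>(3) e by (smt (verit) mult_pos_pos)
  then show False using m(2)[of "m + e"] e m(1) by auto
qed

lemma damped_first_order_bound:
  fixes z g :: "real \<Rightarrow> real"
  assumes ps: "p \<le> s"
    and z: "\<And>t. t \<in> {p..s} \<Longrightarrow> (z has_real_derivative g t - 2 * z t) (at t)"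
    and g: "\<And>t. t \<in> {p..s} \<Longrightarrow> g t \<le> K" and K: "0 \<le> K"
  shows "z s \<le> \<bar>z p\<bar> + K / 2"
proof -
  have "exp (2 * s) * (z s - K/2) \<le> exp (2 * p) * (z p - K/2)"
  proof (rule DERIV_nonpos_imp_nonincreasing[OF ps, of "\<lambda>t. exp (2 * t) * (z t - K/2)"])
    fix t assume t: "p \<le> t" "t \<le> s"
    have "((\<lambda>t. exp (2 * t) * (z t - K/2)) has_real_derivative exp (2 * t) * (g t - K)) (at t)"
      using t by (auto intro!: derivative_eq_intros z simp: algebra_simps)
    moreover have "exp (2 * t) * (g t - K) \<le> 0" using g[of t] t by (simp add: mult_nonneg_nonpos)
    ultimately show "\<exists>y. ((\<lambda>t. exp (2 * t) * (z t - K/2)) has_real_derivative y) (at t) \<and> y \<le> 0" by blast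
  qed
  also have "\<dots> \<le> exp (2 * p) * \<bar>z p\<bar>" using K by simp
  also have "\<dots> \<le> exp (2 * s) * \<bar>z p\<bar>" using ps by (intro mult_right_mono) auto
  finally show ?thesis by simp
qed

text \<open>Landau-type argument: a convergent function with bounded second derivative has
  derivative tending to 0. The abstract filter serves both ends of the line.\<close>

lemma tendsto_deriv_zero:
  fixes f g h :: "real \<Rightarrow> real"
  assumes F: "\<And>d. d > 0 \<Longrightarrow> filterlim (\<lambda>s. s + d) F F"
    and f: "(f \<longlongrightarrow> l) F"
    and ev: "eventually (\<lambda>s. \<forall>t\<in>{s..s+1}. (f has_real_derivative g t) (at t) \<and>
          (g has_real_derivative h t) (at t) \<and> \<bar>h t\<bar> \<le> K) F"
  shows "(g \<longlongrightarrow> 0) F"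
proof (rule tendstoI)
  fix e :: real assume e: "e > 0"
  define k where "k = max K 1"
  \<comment> \<open>Over a step of length \<open>d\<close> the function \<open>g\<close> varies by
    at most \<open>e / 4\<close>, while \<open>f\<close> eventually changes by less than
    \<open>e d / 2\<close>, so some value of \<open>g\<close> on the step is below
    \<open>e / 2\<close>.\<close>
  define d where "d = min 1 (e / (4 * k))"
  have k: "k \<ge> 1" "K \<le> k" by (auto simp: k_def)
  have d: "d > 0" "d \<le> 1" "k * d \<le> e / 4"
  proof -
    show "d > 0" "d \<le> 1" using e k by (auto simp: d_def)
    have "k * d \<le> k * (e / (4 * k))" using k by (intro mult_left_mono) (auto simp: d_def)
    then show "k * d \<le> e / 4" using k by (simp add: field_simps)
  qed
  have e1: "eventually (\<lambda>s. dist (f s) l < e * d / 4) F"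
    using f e d by (intro tendstoD) auto
  have e2: "eventually (\<lambda>s. dist (f (s + d)) l < e * d / 4) F"
    by (rule filterlim_iff[THEN iffD1, rule_format, OF F[OF d(1)] e1])
  show "eventually (\<lambda>s. dist (g s) 0 < e) F"
    using ev e1 e2
  proof eventually_elim
    case (elim s)
    have "\<exists>\<xi>. s < \<xi> \<and> \<xi> < s + d \<and> f (s + d) - f s = (s + d - s) * g \<xi>"
      by (rule MVT2) (use elim d in auto)
    then obtain \<xi> where \<xi>: "s < \<xi>" "\<xi> < s + d" "f (s + d) - f s = d * g \<xi>" by auto
    have "\<exists>\<eta>. s < \<eta> \<and> \<eta> < \<xi> \<and> g \<xi> - g s = (\<xi> - s) * h \<eta>"
      by (rule MVT2) (use elim d \<xi> in auto)
    then obtain \<eta> where \<eta>: "s < \<eta>" "\<eta> < \<xi>" "g \<xi> - g s = (\<xi> - s) * h \<eta>" by auto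
    have "\<eta> \<in> {s..s+1}" using \<eta> \<xi> d by auto
    then have "\<bar>h \<eta>\<bar> \<le> k" using elim(1) k by force
    then have "\<bar>g \<xi> - g s\<bar> \<le> d * k" unfolding \<eta>(3) abs_mult using \<xi> by (intro mult_mono) auto
    moreover have "\<bar>f (s + d) - f s\<bar> < e * d / 2"
      using elim(2,3) unfolding dist_real_def by linarith
    then have "d * \<bar>g \<xi>\<bar> < d * (e / 2)"
      using \<xi>(3) d(1) by (simp add: abs_mult mult.commute)
    then have "\<bar>g \<xi>\<bar> < e / 2" using d(1) by (simp only: mult_less_cancel_left_pos)
    moreover have "d * k \<le> e / 4" using d(3) by (simp add: mult.commute)
    ultimately show ?case using e unfolding dist_real_def by linarith
  qed
qed

lemma incseq_tendsto_at_top: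
  fixes f :: "real \<Rightarrow> real"
  assumes mono: "\<And>s t. a \<le> s \<Longrightarrow> s \<le> t \<Longrightarrow> f s \<le> f t" and bd: "\<And>s. a \<le> s \<Longrightarrow> f s \<le> B"
  shows "\<exists>l. (f \<longlongrightarrow> l) at_top"
proof -
  define l where "l = Sup (f ` {a..})"
  have bdd: "bdd_above (f ` {a..})" using bd by (auto intro!: bdd_aboveI[of _ B])
  have up: "f s \<le> l" if "a \<le> s" for s unfolding l_def using bdd that by (intro cSup_upper) auto
  have "(f \<longlongrightarrow> l) at_top"
  proof (rule order_tendstoI)
    fix y assume "y < l"
    then obtain s where s: "a \<le> s" "y < f s" unfolding l_def
      using less_cSup_iff[OF _ bdd] by auto
    show "eventually (\<lambda>x. y < f x) at_top"
      using eventually_ge_at_top[of s] by eventually_elim (use s mono in \<open>force intro: less_le_trans\<close>)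
  next
    fix y assume "l < y"
    show "eventually (\<lambda>x. f x < y) at_top"
      using eventually_ge_at_top[of a] by eventually_elim (use \<open>l < y\<close> up in \<open>force intro: le_less_trans\<close>)
  qed
  then show ?thesis by blast
qed

lemma filterlim_add_const_at_top: "filterlim (\<lambda>s::real. s + d) at_top at_top"
  by (rule filterlim_at_top_mono[OF filterlim_tendsto_add_at_top[OF tendsto_const filterlim_ident, of d]])
     (auto simp: add.commute)

lemma filterlim_add_const_at_bot: "filterlim (\<lambda>s::real. s + d) at_bot at_bot"
  unfolding filterlim_at_bot
proof
  fix Z :: real
  show "eventually (\<lambda>s. s + d \<le> Z) at_bot"
    using eventually_le_at_bot[of "Z - d"] by eventually_elim simp
qed

lemma mono_tendsto_at_bot:
  fixes f :: "real \<Rightarrow> real"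
  assumes mono: "\<And>s t. s \<le> t \<Longrightarrow> f s \<le> f t" and bd: "\<And>s. B \<le> f s"
  shows "\<exists>l. (f \<longlongrightarrow> l) at_bot"
proof -
  have "\<exists>l. ((\<lambda>s. - f (- s)) \<longlongrightarrow> l) at_top"
    by (rule incseq_tendsto_at_top[of 0 _ "-B"]) (use mono bd in auto)
  then obtain l where "((\<lambda>s. - f (- s)) \<longlongrightarrow> l) at_top" by blast
  then have "((\<lambda>s. f (- s)) \<longlongrightarrow> - l) at_top" using tendsto_minus by fastforce
  then show ?thesis by (auto simp: filterlim_at_bot_mirror)
qed

section \<open>Barriers for the logarithmic derivative\<close>

text \<open>Supplies the cutting time for arguments in stages: the least element of the closed set
  where \<open>L <= f\<close>, with equality there by the intermediate value theorem.\<close>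

lemma first_hit:
  fixes f :: "real \<Rightarrow> real"
  assumes cont: "continuous_on {a..b} f" and "f a \<le> L"
  shows "(\<forall>t\<in>{a..b}. f t \<le> L) \<or> (\<exists>c\<in>{a..b}. f c = L \<and> (\<forall>t\<in>{a..c}. f t \<le> L))"
proof (cases "\<exists>t\<in>{a..b}. L \<le> f t")
  case True
  define S where "S = {t\<in>{a..b}. L \<le> f t}"
  have "closed S" unfolding S_def by (intro continuous_on_closed_Collect_le assms continuous_on_const) auto
  moreover have bdd: "bdd_below S" by (auto simp: S_def intro!: bdd_belowI[of _ a])
  moreover have "S \<noteq> {}" using True by (auto simp: S_def)
  ultimately have c: "Inf S \<in> S" by (intro closed_contains_Inf)
  define c where "c = Inf S"
  have cS: "c \<in> {a..b}" "L \<le> f c" using c by (auto simp: S_def c_def)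
  have lt: "f t < L" if "a \<le> t" "t < c" for t
  proof (rule ccontr)
    assume "\<not> f t < L"
    then have "t \<in> S" using that cS by (auto simp: S_def)
    then have "c \<le> t" unfolding c_def using bdd by (rule cInf_lower)
    then show False using that by simp
  qed
  have "continuous_on {a..c} f" using cont by (rule continuous_on_subset) (use cS in auto)
  then obtain t where t: "a \<le> t" "t \<le> c" "f t = L"
    using IVT'[of f a L c] assms(2) cS by auto
  then have "t = c" using lt[of t] by force
  then show ?thesis using t cS lt by (intro disjI2 bexI[of _ c]) (auto simp: le_less)
next
  case False
  then show ?thesis by force
qed

text \<open>After \<open>\<phi>\<close> passes through 0 with \<open>v > 0\<close>, the functions below are \<open>r = y/v\<close>, \<open>h = sin \<phi> / v\<close> and
  \<open>n = kinetic/v\<^sup>2\<close>. The aim is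
  \<open>12 h \<le> 7 + r\<^sup>2\<close>, which makes the kinetic part of the energy nondecreasing. As \<open>r\<close> may be arbitrarily
  negative at the start, three barriers are needed: for \<open>r \<le> 0\<close> the region
  \<open>n (2/5 - h) \<ge> h (r\<^sup>2/2 - 5 r/2)\<close>, which forces \<open>h \<le> 2/5\<close>, then a parabola \<open>h \<le> 2/5 + 3 r/20 - r\<^sup>2/50\<close> up to
  \<open>r = 17/10\<close>, and \<open>h \<le> 3/5\<close> from there on.\<close>

context
  fixes r h n r' h' n' :: "real \<Rightarrow> real" and a b :: real
  assumes rd: "\<And>t. t \<in> {a..b} \<Longrightarrow> (r has_real_derivative r' t) (at t)"
    and hd: "\<And>t. t \<in> {a..b} \<Longrightarrow> (h has_real_derivative h' t) (at t)"
    and nd: "\<And>t. t \<in> {a..b} \<Longrightarrow> (n has_real_derivative n' t) (at t)"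
    and h0: "\<And>t. t \<in> {a..b} \<Longrightarrow> 0 \<le> h t"
    and r'_ge: "\<And>t. t \<in> {a..b} \<Longrightarrow> h t \<le> 3/5 \<Longrightarrow> n t - (r t)^2 / 2 - 2 * r t + 13/2 \<le> r' t"
    and h'_le: "\<And>t. t \<in> {a..b} \<Longrightarrow> h t \<le> 3/5 \<Longrightarrow> h' t \<le> 1 - r t * h t"
    and n'_ge: "\<And>t. t \<in> {a..b} \<Longrightarrow> h t \<le> 3/5 \<Longrightarrow> 2 * (r t)^2 + 14 - 24 * h t - 2 * r t * n t \<le> n' t"
begin

text \<open>\<open>17/10\<close> lies just above \<open>5/3\<close>, where \<open>1 - r h\<close>
  changes sign for \<open>h = 3/5\<close>, so \<open>h\<close> decreases on that face; with
  \<open>0 <= n\<close> the lower bound for \<open>r'\<close> is still positive at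
  \<open>r = 17/10\<close>.\<close>

lemma late_stage:
  assumes c: "c \<in> {a..b}" and init: "17/10 \<le> r c" "h c \<le> 3/5" "0 \<le> n c" and t: "t \<in> {c..b}"
  shows "17/10 \<le> r t \<and> h t \<le> 3/5 \<and> 0 \<le> n t"
proof -
  define F where "F = {\<lambda>t. r t - 17/10, \<lambda>t. 3/5 - h t, n}"
  have *: "0 \<le> f t" if f: "f \<in> F" for f
  proof (rule barrier[of F c b f t])
    fix g u assume "g \<in> F" "u \<in> {c..b}"
    moreover from this have "u \<in> {a..b}" using c by auto
    then have "isCont r u" "isCont h u" "isCont n u" using rd hd nd DERIV_isCont by blast+
    ultimately show "isCont g u" by (auto simp: F_def intro!: continuous_intros)
  next
    fix u g assume u: "u \<in> {c..b}" and nn: "\<And>g. g \<in> F \<Longrightarrow> 0 \<le> g u" and g: "g \<in> F" "g u = 0"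
    have uab: "u \<in> {a..b}" using u c by auto
    have le: "17/10 \<le> r u" "h u \<le> 3/5" "0 \<le> n u"
      using nn[of "\<lambda>t. r t - 17/10"] nn[of "\<lambda>t. 3/5 - h t"] nn[of n] by (auto simp: F_def)
    note ineq = r'_ge[OF uab le(2)] h'_le[OF uab le(2)] n'_ge[OF uab le(2)]
    from g consider "g = (\<lambda>t. r t - 17/10)" "r u = 17/10" | "g = (\<lambda>t. 3/5 - h t)" "h u = 3/5" | "g = n" "n u = 0"
      by (auto simp: F_def)
    then show "\<exists>D>0. (g has_real_derivative D) (at u)"
    proof cases
      case 1
      have "(r u)^2 = 289/100" unfolding 1(2) by (simp add: power2_eq_square)
      then have "0 < r' u" using ineq(1) le 1(2) by linarith
      then show ?thesis using 1 rd[OF uab] by (auto intro!: exI[of _ "r' u"] derivative_eq_intros)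
    next
      case 2
      have "17/10 * (3/5) \<le> r u * h u" unfolding 2(2) using le by (intro mult_right_mono) auto
      then have "0 < - h' u" using ineq(2) by linarith
      then show ?thesis using 2 hd[OF uab] by (auto intro!: exI[of _ "- h' u"] derivative_eq_intros)
    next
      case 3
      have "(17/10)^2 \<le> (r u)^2" using le by (intro power_mono) auto
      then have "0 < n' u" using ineq(3) 3 le by (simp add: power2_eq_square)
      then show ?thesis using 3 nd[OF uab] by blast
    qed
  qed (use f t init c in \<open>auto simp: F_def\<close>)
  show ?thesis using *[of "\<lambda>t. r t - 17/10"] *[of "\<lambda>t. 3/5 - h t"] *[of n] by (auto simp: F_def)
qed

text \<open>The parabola rises from \<open>2/5\<close> at \<open>r = 0\<close>, where the early
  stage ends, to just below \<open>3/5\<close> at \<open>r = 17/10\<close>, where the late stage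
  begins. On the faces of \<open>h\<close> and of \<open>n - 2 h\<close> the sign reduces to a cubic
  in \<open>x = r\<close> that is positive for \<open>x >= 0\<close>.\<close>

lemma middle_stage:
  assumes c: "c \<in> {a..b}" and init: "0 \<le> r c" "h c \<le> 2/5" "2 * h c \<le> n c"
    and d: "d \<in> {c..b}" and rle: "\<And>t. t \<in> {c..d} \<Longrightarrow> r t \<le> 17/10" and t: "t \<in> {c..d}"
  shows "0 \<le> r t \<and> h t \<le> 2/5 + 3/20 * r t - (r t)^2 / 50 \<and> 2 * h t \<le> n t"
proof -
  define F where "F = {r, \<lambda>t. 2/5 + 3/20 * r t - (r t)^2 / 50 - h t, \<lambda>t. n t - 2 * h t}"
  have *: "0 \<le> f t" if f: "f \<in> F" for f
  proof (rule barrier[of F c d f t])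
    fix g u assume "g \<in> F" "u \<in> {c..d}"
    moreover from this have "u \<in> {a..b}" using c d by auto
    then have "isCont r u" "isCont h u" "isCont n u" using rd hd nd DERIV_isCont by blast+
    ultimately show "isCont g u" by (auto simp: F_def intro!: continuous_intros)
  next
    fix g assume "g \<in> F"
    moreover have "(r c)^2 / 50 \<le> 3/20 * r c"
      using mult_right_mono[OF rle[of c] init(1)] d init by (simp add: power2_eq_square)
    ultimately show "0 \<le> g c" using init by (auto simp: F_def)
  next
    fix u g assume u: "u \<in> {c..d}" and nn: "\<And>g. g \<in> F \<Longrightarrow> 0 \<le> g u" and g: "g \<in> F" "g u = 0"
    have uab: "u \<in> {a..b}" using u c d by auto
    define x where "x = r u"
    have x: "0 \<le> x" "x \<le> 17/10" using nn[of r] rle[OF u] by (auto simp: F_def x_def)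
    have le: "h u \<le> 2/5 + 3/20 * x - x^2 / 50" "2 * h u \<le> n u"
      using nn[of "\<lambda>t. 2/5 + 3/20 * r t - (r t)^2 / 50 - h t"] nn[of "\<lambda>t. n t - 2 * h t"]
      by (auto simp: F_def x_def)
    \<comment> \<open>After division by 50: the parabola stays below \<open>2/5 + 493/2500\<close>,
      hence below \<open>3/5\<close>.\<close>
    have "0 \<le> (17/10 - x) * (29/5 - x)" using x by (intro mult_nonneg_nonneg) auto
    then have h35: "h u \<le> 3/5" using le(1) by (simp add: power2_eq_square algebra_simps)
    note ineq = r'_ge[OF uab h35, folded x_def] h'_le[OF uab h35, folded x_def] n'_ge[OF uab h35, folded x_def]
    from g consider "g = r" "x = 0" | "g = (\<lambda>t. 2/5 + 3/20 * r t - (r t)^2 / 50 - h t)" "h u = 2/5 + 3/20 * x - x^2 / 50"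
      | "g = (\<lambda>t. n t - 2 * h t)" "n u = 2 * h u"
      by (auto simp: F_def x_def)
    then show "\<exists>D>0. (g has_real_derivative D) (at u)"
    proof cases
      case 1
      then have "0 < r' u" using ineq(1) le h0[OF uab] by simp
      then show ?thesis using 1 rd[OF uab] by blast
    next
      case 2
      \<comment> \<open>This is the slope of the parabola; its sign lets the lower bound for
        \<open>r'\<close> be used.\<close>
      have "0 \<le> 3/20 - x / 25" using x by simp
      moreover have "2 * (2/5 + 3/20 * x - x^2 / 50) - x^2 / 2 - 2 * x + 13/2 \<le> r' u" using ineq(1) le 2 by simp
      ultimately have "(3/20 - x / 25) * (2 * (2/5 + 3/20 * x - x^2 / 50) - x^2 / 2 - 2 * x + 13/2) \<le> (3/20 - x / 25) * r' u"
        by (rule mult_left_mono[rotated])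
      moreover have "h' u \<le> 1 - x * (2/5 + 3/20 * x - x^2 / 50)" using ineq(2) 2 by simp
      moreover have "0 < 95/1000 - 147/1000 * x + 137/1000 * x^2 + 16/10000 * x^3"
      proof -
        have "0 \<le> (x - 147/274)^2 * (137/1000)" "0 \<le> x^3" using x by simp_all
        moreover have "(x - 147/274)^2 * (137/1000) = 137/1000 * x^2 - 147/1000 * x + 21609/548000"
          by (simp add: power2_eq_square algebra_simps)
        ultimately show ?thesis by linarith
      qed
      moreover have "(3/20 - x / 25) * (2 * (2/5 + 3/20 * x - x^2 / 50) - x^2 / 2 - 2 * x + 13/2) - (1 - x * (2/5 + 3/20 * x - x^2 / 50))
         = 95/1000 - 147/1000 * x + 137/1000 * x^2 + 16/10000 * x^3"
        by (simp add: power2_eq_square power3_eq_cube algebra_simps)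
      ultimately have "0 < (3/20 - x / 25) * r' u - h' u" by linarith
      moreover have "(g has_real_derivative (3/20 - x / 25) * r' u - h' u) (at u)"
        unfolding 2(1) by (auto intro!: derivative_eq_intros rd[OF uab] hd[OF uab] simp: x_def algebra_simps)
      ultimately show ?thesis by blast
    next
      case 3
      have "0 < 2 * x^2 + 12 - 24 * h u - 2 * x * h u"
      proof -
        have "(24 + 2 * x) * h u \<le> (24 + 2 * x) * (2/5 + 3/20 * x - x^2 / 50)" using le x by (intro mult_left_mono) auto
        moreover have "2 * x^2 + 12 - (24 + 2 * x) * (2/5 + 3/20 * x - x^2 / 50) = 24/10 - 44/10 * x + 218/100 * x^2 + 4/100 * x^3"
          by (simp add: power2_eq_square power3_eq_cube field_simps)
        moreover have "0 < 24/10 - 44/10 * x + 218/100 * x^2 + 4/100 * x^3"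
        proof -
          have "0 \<le> (x - 220/218)^2 * (218/100)" "0 \<le> x^3" using x by simp_all
          moreover have "(x - 220/218)^2 * (218/100) = 218/100 * x^2 - 44/10 * x + 242/109"
            by (simp add: power2_eq_square algebra_simps)
          ultimately show ?thesis by linarith
        qed
        ultimately show ?thesis by (simp add: algebra_simps)
      qed
      then have "0 < n' u - 2 * h' u" using ineq(2,3) 3 by (simp add: algebra_simps)
      moreover have "(g has_real_derivative n' u - 2 * h' u) (at u)"
        unfolding 3(1) by (auto intro!: derivative_eq_intros nd[OF uab] hd[OF uab])
      ultimately show ?thesis by blast
    qed
  qed (use f t in \<open>auto simp: F_def\<close>)
  show ?thesis using *[of r] *[of "\<lambda>t. 2/5 + 3/20 * r t - (r t)^2 / 50 - h t"] *[of "\<lambda>t. n t - 2 * h t"]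
    by (auto simp: F_def)
qed

lemma early_stage:
  assumes init: "h a = 0" "0 \<le> n a"
    and d: "d \<in> {a..b}" and rle: "\<And>t. t \<in> {a..d} \<Longrightarrow> r t \<le> 0" and t: "t \<in> {a..d}"
  shows "h t \<le> 2/5 \<and> 2 * h t \<le> n t"
proof -
  define k where "k x = x^2 / 2 - 5/2 * x" for x :: real
  define F where "F = {\<lambda>t. n t * (2/5 - h t) - h t * k (r t), \<lambda>t. n t - 2 * h t}"
  have kpos: "0 \<le> k x" if "x \<le> 0" for x 
    using that zero_le_power2[of x] unfolding k_def by linarith
  have le25: "h u \<le> 2/5" if "0 \<le> n u * (2/5 - h u) - h u * k (r u)" "2 * h u \<le> n u" "u \<in> {a..d}" for u
  proof (rule ccontr)
    assume c: "\<not> h u \<le> 2/5"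
    then have "n u * (2/5 - h u) < 0" using that(2) by (intro mult_pos_neg) auto
    moreover have "0 \<le> h u * k (r u)" using kpos[OF rle[OF that(3)]] c by simp
    ultimately show False using that by linarith
  qed
  have *: "0 \<le> f t" if f: "f \<in> F" for f
  proof (rule barrier[of F a d f t])
    fix g u assume "g \<in> F" "u \<in> {a..d}"
    moreover from this have "u \<in> {a..b}" using d by auto
    then have "isCont r u" "isCont h u" "isCont n u" using rd hd nd DERIV_isCont by blast+
    ultimately show "isCont g u" by (auto simp: F_def k_def intro!: continuous_intros)
  next
    fix u g assume u: "u \<in> {a..d}" and nn: "\<And>g. g \<in> F \<Longrightarrow> 0 \<le> g u" and g: "g \<in> F" "g u = 0"
    have uab: "u \<in> {a..b}" using u d by auto
    define x where "x = - r u"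
    define H where "H = h u"
    define N where "N = n u"
    have ru: "r u = - x" by (simp add: x_def)
    have x: "0 \<le> x" using rle[OF u] by (simp add: x_def)
    have nn': "0 \<le> n u * (2/5 - h u) - h u * k (r u)" "2 * h u \<le> n u"
      using nn[of "\<lambda>t. n t * (2/5 - h t) - h t * k (r t)"] nn[of "\<lambda>t. n t - 2 * h t"]
      by (auto simp: F_def)
    have le: "H \<le> 2/5" "2 * H \<le> N" "0 \<le> H" using le25[OF nn' u] nn' h0[OF uab] by (auto simp: H_def N_def)
    have h35: "h u \<le> 3/5" using le by (simp add: H_def)
    have ineq: "N - x^2 / 2 + 2 * x + 13/2 \<le> r' u" "h' u \<le> 1 + x * H" "2 * x^2 + 14 - 24 * H + 2 * x * N \<le> n' u"
      using r'_ge[OF uab h35] h'_le[OF uab h35] n'_ge[OF uab h35] by (simp_all add: ru H_def N_def)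
    have kx: "k (r u) = x^2 / 2 + 5/2 * x" by (simp add: k_def ru)
    from g consider "g = (\<lambda>t. n t * (2/5 - h t) - h t * k (r t))" "N * (2/5 - H) = H * (x^2 / 2 + 5/2 * x)"
      | "g = (\<lambda>t. n t - 2 * h t)" "N = 2 * H"
      by (auto simp: F_def kx H_def N_def)
    then show "\<exists>D>0. (g has_real_derivative D) (at u)"
    proof cases
      case 1
      have dg: "(g has_real_derivative n' u * (2/5 - H) - h' u * (N + (x^2 / 2 + 5/2 * x)) + H * (5/2 + x) * r' u) (at u)"
        unfolding 1(1) k_def
        by (auto intro!: derivative_eq_intros rd[OF uab] hd[OF uab] nd[OF uab]
            simp: ru H_def[symmetric] N_def[symmetric] field_simps power2_eq_square)
      have "(2 * x^2 + 14 - 24 * H + 2 * x * N) * (2/5 - H) \<le> n' u * (2/5 - H)"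
        using ineq(3) le by (intro mult_right_mono) auto
      moreover have "h' u * (N + (x^2 / 2 + 5/2 * x)) \<le> (1 + x * H) * (N + (x^2 / 2 + 5/2 * x))"
        using ineq(2) le x by (intro mult_right_mono) auto
      moreover have "H * (5/2 + x) * (N - x^2 / 2 + 2 * x + 13/2) \<le> H * (5/2 + x) * r' u"
        using ineq(1) le x by (intro mult_left_mono) auto
      \<comment> \<open>The terms of highest order form a multiple of the barrier function itself,
        which vanishes on this face. The remaining quadratic in \<open>x\<close> is positive for
        every \<open>H >= 0\<close>, by completing the square.\<close>
      moreover have "(2 * x^2 + 14 - 24 * H + 2 * x * N) * (2/5 - H) - (1 + x * H) * (N + (x^2 / 2 + 5/2 * x))
          + H * (5/2 + x) * (N - x^2 / 2 + 2 * x + 13/2)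
          = (2 * x - 5/2) * (N * (2/5 - H) - H * (x^2 / 2 + 5/2 * x))
            + (3/10 * x^2 + x * (21/4 * H - 5/2) + 28/5 - 147/20 * H + 24 * H^2)"
        by (simp add: power2_eq_square field_simps)
      moreover have "0 < 3/10 * x^2 + x * (21/4 * H - 5/2) + 28/5 - 147/20 * H + 24 * H^2"
      proof -
        have "0 \<le> 3/10 * (x + 5/3 * (21/4 * H - 5/2))^2" by simp
        moreover have "3/10 * (x + 5/3 * (21/4 * H - 5/2))^2
            = 3/10 * x^2 + x * (21/4 * H - 5/2) + 735/32 * H^2 - 175/8 * H + 125/24"
          by (simp add: power2_eq_square algebra_simps)
        moreover have "0 \<le> H^2" by simp
        ultimately show ?thesis using le(3) by linarith
      qed
      moreover have "(2 * x - 5/2) * (N * (2/5 - H) - H * (x^2 / 2 + 5/2 * x)) = 0" using 1(2) by simp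
      ultimately have "0 < n' u * (2/5 - H) - h' u * (N + (x^2 / 2 + 5/2 * x)) + H * (5/2 + x) * r' u"
        by linarith
      then show ?thesis using dg by blast
    next
      case 2
      have "0 \<le> x * H" using x le by simp
      moreover have "2 * x * N = 4 * (x * H)" using 2 by simp
      ultimately have "0 < n' u - 2 * h' u" using ineq(2,3) le zero_le_power2[of x] by linarith
      moreover have "(g has_real_derivative n' u - 2 * h' u) (at u)"
        unfolding 2(1) by (auto intro!: derivative_eq_intros nd[OF uab] hd[OF uab])
      ultimately show ?thesis by blast
    qed
  next
    fix g assume "g \<in> F"
    then show "0 \<le> g a" using init by (auto simp: F_def)
  qed (use f t in \<open>auto simp: F_def\<close>)
  show ?thesis using *[of "\<lambda>t. n t * (2/5 - h t) - h t * k (r t)"] *[of "\<lambda>t. n t - 2 * h t"] le25[of t] t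
    by (auto simp: F_def)
qed

text \<open>The stages fit together: where \<open>r\<close> first vanishes the early stage leaves
  \<open>h <= 2/5\<close> and \<open>2 h <= n\<close>; where \<open>r\<close> first reaches
  \<open>17/10\<close> the middle stage leaves \<open>h <= 3/5\<close> and \<open>0 <= n\<close>. If
  \<open>r\<close> is already larger at \<open>a\<close>, earlier stages are skipped, since
  \<open>h a = 0\<close> satisfies any entry condition on \<open>h\<close>.\<close>

lemma ratio_bound:
  assumes init: "h a = 0" "0 \<le> n a" and t: "t \<in> {a..b}"
  shows "h t \<le> 3/5 \<and> 12 * h t \<le> 7 + (r t)^2"
proof -
  have contr: "continuous_on S r" if "S \<subseteq> {a..b}" for S
    using rd that by (meson DERIV_isCont continuous_at_imp_continuous_on subsetD)
  have late: ?thesis if "c \<in> {a..b}" "17/10 \<le> r c" "h c \<le> 3/5" "0 \<le> n c" "c \<le> t" for c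
  proof -
    have "17/10 \<le> r t \<and> h t \<le> 3/5 \<and> 0 \<le> n t" using late_stage[OF that(1-4)] that(5) t by auto
    moreover from this have "(17/10)^2 \<le> (r t)^2" by (intro power_mono) auto
    ultimately show ?thesis by (simp add: power2_eq_square)
  qed
  have middle: ?thesis if c: "c \<in> {a..b}" "0 \<le> r c" "h c \<le> 2/5" "2 * h c \<le> n c" "c \<le> t" for c
  proof (cases "r c \<le> 17/10")
    case False
    then show ?thesis using late[of c] c h0[of c] by auto
  next
    case True
    have m: "h u \<le> 3/5 \<and> 12 * h u \<le> 7 + (r u)^2 \<and> 0 \<le> n u"
      if "d \<in> {c..b}" "\<And>t. t \<in> {c..d} \<Longrightarrow> r t \<le> 17/10" "u \<in> {c..d}" for d u
    proof -
      have uab: "u \<in> {a..b}" using that(1,3) c(1) by auto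
      have m: "0 \<le> r u" "h u \<le> 2/5 + 3/20 * r u - (r u)^2 / 50" "2 * h u \<le> n u"
        using middle_stage[OF c(1-4) that(1,2,3)] by auto
      have "0 \<le> (17/10 - r u) * (29/5 - r u)" using that(2)[OF that(3)] by (intro mult_nonneg_nonneg) auto
      moreover have "0 \<le> (r u - 1)^2" by simp
      ultimately show ?thesis using m h0[OF uab]
        by (simp add: power2_eq_square algebra_simps)
    qed
    have "continuous_on {c..b} r" using c by (intro contr) auto
    from first_hit[OF this True]
    consider "\<forall>t\<in>{c..b}. r t \<le> 17/10" | d where "d \<in> {c..b}" "r d = 17/10" "\<forall>t\<in>{c..d}. r t \<le> 17/10" by blast
    then show ?thesis
    proof cases
      case 1
      then show ?thesis using m[of b t] c t by auto
    next
      case (2 d)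
      show ?thesis
      proof (cases "t \<le> d")
        case True then show ?thesis using m[of d t] 2 c by auto
      next
        case False then show ?thesis using m[of d d] late[of d] 2 c by auto
      qed
    qed
  qed
  show ?thesis
  proof (cases "r a \<le> 0")
    case False
    then show ?thesis using middle[of a] init t by auto
  next
    case True
    have e: "h u \<le> 2/5 \<and> 2 * h u \<le> n u" if "d \<in> {a..b}" "\<And>t. t \<in> {a..d} \<Longrightarrow> r t \<le> 0" "u \<in> {a..d}" for d u
      by (rule early_stage[OF init that])
    have sq: "0 \<le> (r t)^2" by simp
    from first_hit[OF contr[OF order_refl] True]
    consider "\<forall>t\<in>{a..b}. r t \<le> 0" | d where "d \<in> {a..b}" "r d = 0" "\<forall>t\<in>{a..d}. r t \<le> 0" by blast
    then show ?thesis
    proof cases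
      case 1
      then have "h t \<le> 2/5" using e[of b t] t by auto
      then show ?thesis using sq by linarith
    next
      case (2 d)
      show ?thesis
      proof (cases "t \<le> d")
        case True
        then have "h t \<le> 2/5" using e[of d t] 2 t by auto
        then show ?thesis using sq by linarith
      next
        case False then show ?thesis using e[of d d] middle[of d] 2 by auto
      qed
    qed
  qed
qed

end

section \<open>The energy, blow-up and crossings\<close>

text \<open>The derivatives are explicit functions rather than iterates of \<open>deriv\<close>, and
  they are taken at \<open>s\<close>, not within \<open>S\<close>: they are two-sided even at an end
  point of \<open>S\<close>.\<close>

definition solution_on ::
    "real set \<Rightarrow> (real \<Rightarrow> real) \<Rightarrow> (real \<Rightarrow> real) \<Rightarrow> (real \<Rightarrow> real) \<Rightarrow> (real \<Rightarrow> real) \<Rightarrow> bool" where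
  "solution_on S \<phi> v y z \<longleftrightarrow> (\<forall>s\<in>S.
     (\<phi> has_real_derivative v s) (at s) \<and> (v has_real_derivative y s) (at s) \<and>
     (y has_real_derivative z s) (at s) \<and>
     (z has_real_derivative autonomous_rhs (\<phi> s) (v s) (y s) (z s)) (at s))"

text \<open>\<open>v z - y^2 / 2 + 2 v y\<close> has derivative \<open>v (z' + 2 z) + 2 y^2\<close>.
  The other terms integrate the exact parts of \<open>v (z' + 2 z)\<close>, except
  \<open>- 12 sin (2 p) v\<close>, the derivative of \<open>6 cos (2 p)\<close>, which is left to
  \<open>energy\<close>.\<close>

definition kinetic :: "real \<Rightarrow> real \<Rightarrow> real \<Rightarrow> real \<Rightarrow> real" where
  "kinetic p v y z = v * z - y^2 / 2 + 2 * v * y - (9/2 + 2 * cos (2 * p)) * v^2 - 3/2 * v^4"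

definition energy :: "real \<Rightarrow> real \<Rightarrow> real \<Rightarrow> real \<Rightarrow> real" where
  "energy p v y z = kinetic p v y z - 6 * cos (2 * p)"

definition energy_rate :: "real \<Rightarrow> real \<Rightarrow> real \<Rightarrow> real" where
  "energy_rate p v y = 2 * y^2 + (10 + 4 * cos (2 * p)) * v^2 + 2 * v^4"

section \<open>Symmetries and the energy identity\<close>

lemma solution_onD:
  assumes "solution_on S \<phi> v y z" "s \<in> S"
  shows "(\<phi> has_real_derivative v s) (at s)" "(v has_real_derivative y s) (at s)"
    "(y has_real_derivative z s) (at s)"
    "(z has_real_derivative autonomous_rhs (\<phi> s) (v s) (y s) (z s)) (at s)"
  using assms by (auto simp: solution_on_def)

lemma solution_on_subset: "solution_on S \<phi> v y z \<Longrightarrow> T \<subseteq> S \<Longrightarrow> solution_on T \<phi> v y z"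
  by (auto simp: solution_on_def)

lemma solution_on_isCont:
  assumes "solution_on S \<phi> v y z" "s \<in> S"
  shows "isCont \<phi> s" "isCont v s" "isCont y s" "isCont z s"
  using solution_onD[OF assms] by (auto intro: DERIV_isCont)

lemma autonomous_rhs_minus: "autonomous_rhs (- p) (- v) (- y) (- z) = - autonomous_rhs p v y z"
  by (simp add: autonomous_rhs_def algebra_simps power2_eq_square power3_eq_cube)

lemma solution_on_minus:
  assumes "solution_on S \<phi> v y z"
  shows "solution_on S (\<lambda>s. - \<phi> s) (\<lambda>s. - v s) (\<lambda>s. - y s) (\<lambda>s. - z s)"
  using assms unfolding solution_on_def autonomous_rhs_minus by (auto intro!: derivative_eq_intros)

lemma solution_on_shift_pi:
  assumes "solution_on S \<phi> v y z"
  shows "solution_on S (\<lambda>s. \<phi> s - pi) v y z"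
proof -
  have "autonomous_rhs (p - pi) v y z = autonomous_rhs p v y z" for p v y z
    by (simp add: autonomous_rhs_def right_diff_distrib cos_diff sin_diff)
  then show ?thesis using assms unfolding solution_on_def by (auto intro!: derivative_eq_intros)
qed

lemma energy_minus: "energy (- p) (- v) (- y) (- z) = energy p v y z"
  by (simp add: energy_def kinetic_def)

lemma energy_shift_pi: "energy (p - pi) v y z = energy p v y z"
  by (simp add: energy_def kinetic_def right_diff_distrib cos_diff)

lemma has_real_derivative_kinetic:
  assumes "solution_on S \<phi> v y z" "s \<in> S"
  shows "((\<lambda>s. kinetic (\<phi> s) (v s) (y s) (z s)) has_real_derivative
     energy_rate (\<phi> s) (v s) (y s) - 12 * sin (2 * \<phi> s) * v s) (at s)"
  unfolding kinetic_def
  by (auto intro!: derivative_eq_intros solution_onD[OF assms]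
    simp: autonomous_rhs_def energy_rate_def power2_eq_square power3_eq_cube eval_nat_numeral field_simps)

lemma has_real_derivative_energy:
  assumes "solution_on S \<phi> v y z" "s \<in> S"
  shows "((\<lambda>s. energy (\<phi> s) (v s) (y s) (z s)) has_real_derivative
     energy_rate (\<phi> s) (v s) (y s)) (at s)"
  unfolding energy_def
  by (auto intro!: derivative_eq_intros has_real_derivative_kinetic[OF assms] solution_onD[OF assms])

lemma energy_rate_ge: "2 * y^2 + 6 * v^2 \<le> energy_rate p v y"
proof -
  have "6 * v^2 \<le> (10 + 4 * cos (2 * p)) * v^2"
    by (rule mult_right_mono) (use cos_ge_minus_one[of "2 * p"] in linarith, simp)
  moreover have "0 \<le> v^4" by simp
  ultimately show ?thesis unfolding energy_rate_def by linarith
qed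

lemma energy_rate_nonneg: "0 \<le> energy_rate p v y"
  using energy_rate_ge[of y v p] by (smt (verit) zero_le_power2)

lemma energy_mono:
  assumes "solution_on S \<phi> v y z" "{s..t} \<subseteq> S" "s \<le> t"
  shows "energy (\<phi> s) (v s) (y s) (z s) \<le> energy (\<phi> t) (v t) (y t) (z t)"
  by (rule deriv_nonneg_imp_le[OF assms(3), of "\<lambda>s. energy (\<phi> s) (v s) (y s) (z s)" "\<lambda>s. energy_rate (\<phi> s) (v s) (y s)"])
     (use assms in \<open>auto intro!: has_real_derivative_energy energy_rate_nonneg\<close>)

lemma energy_at_rest: "energy p 0 y z = - (y^2 / 2) - 6 * cos (2 * p)"
  by (simp add: energy_def kinetic_def)

lemma energy_at_rest_le: "energy p 0 y z \<le> 6"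
  using cos_ge_minus_one[of "2 * p"] zero_le_power2[of y] unfolding energy_at_rest by linarith

text \<open>With \<open>v = w\<^sup>2\<close> the quantity \<open>v z - y\<^sup>2/2\<close> becomes \<open>2 w\<^sup>3 w''\<close>, so the energy identity turns
  into a scalar second-order inequality for \<open>w\<close>.\<close>

lemma energy_gt_6_blowup_pos:
  assumes sol: "solution_on {a..} \<phi> v y z"
    and e: "6 < energy (\<phi> a) (v a) (y a) (z a)"
    and pos: "\<And>t. a \<le> t \<Longrightarrow> 0 < v t"
  shows False
proof -
  define d where "d = (energy (\<phi> a) (v a) (y a) (z a) - 6) / 2"
  define w where "w t = sqrt (v t)" for t
  define w1 where "w1 t = y t / (2 * w t)" for t
  define w2 where "w2 t = z t / (2 * w t) - (y t)^2 / (4 * w t ^ 3)" for t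
  have wpos: "0 < w t" if "a \<le> t" for t using pos[OF that] by (simp add: w_def)
  have wv: "(w t)^2 = v t" if "a \<le> t" for t using pos[OF that] by (simp add: w_def)
  note D = solution_onD[OF sol, unfolded atLeast_iff]
  have dw: "(w has_real_derivative w1 t) (at t)" if "a \<le> t" for t
    unfolding w_def w1_def using pos[OF that] D[OF that]
    by (auto intro!: derivative_eq_intros simp: field_simps)
  show False
  proof (rule convex_superlinear_blowup[of a w w1 w2 d])
    fix t assume t: "a \<le> t"
    show "(w has_real_derivative w1 t) (at t)" "0 < w t" using dw wpos t by auto
    show "(w1 has_real_derivative w2 t) (at t)"
      unfolding w1_def[abs_def] w2_def using wpos[OF t]
      by (auto intro!: derivative_eq_intros D[OF t] dw[OF t] simp: w1_def field_simps power2_eq_square power3_eq_cube)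
    define C where "C = cos (2 * \<phi> t)"
    have C: "-1 \<le> C" using cos_ge_minus_one by (simp add: C_def)
    have "2 * d + 6 \<le> energy (\<phi> t) (v t) (y t) (z t)"
      using energy_mono[OF sol, of a t] t by (auto simp: d_def field_simps)
    then have k: "2 * d \<le> kinetic (\<phi> t) (v t) (y t) (z t)"
      using C unfolding energy_def C_def[symmetric] by linarith
    have "2 * w t ^ 3 * (w2 t + 2 * w1 t) = v t * z t - (y t)^2 / 2 + 2 * v t * y t"
      unfolding w1_def w2_def wv[OF t, symmetric] using wpos[OF t]
      by (simp add: field_simps power2_eq_square power3_eq_cube)
    also have "\<dots> = kinetic (\<phi> t) (v t) (y t) (z t) + (9/2 + 2 * C) * (v t)^2 + 3/2 * (v t)^4"
      by (simp add: kinetic_def C_def)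
    \<comment> \<open>\<open>5/2\<close> is the least value of \<open>9/2 + 2 C\<close>;
      \<open>2 d\<close> is what remains of the energy after the potential has taken its largest
      value 6.\<close>
    also have "\<dots> \<ge> 2 * d + 5/2 * (v t)^2 + 3/2 * (v t)^4"
    proof -
      have "5/2 * (v t)^2 \<le> (9/2 + 2 * C) * (v t)^2" using C by (intro mult_right_mono) auto
      then show ?thesis using k by linarith
    qed
    also have "2 * d + 5/2 * (v t)^2 + 3/2 * (v t)^4 = 2 * w t ^ 3 * (d / w t ^ 3 + 5/4 * w t + 3/4 * w t ^ 5)"
      unfolding wv[OF t, symmetric] using wpos[OF t] by (simp add: field_simps eval_nat_numeral)
    finally show "d / w t ^ 3 + 5/4 * w t + 3/4 * w t ^ 5 \<le> w2 t + 2 * w1 t"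
      using wpos[OF t] by simp
  qed (use e in \<open>auto simp: d_def\<close>)
qed

lemma isCont_nonzero_same_sign:
  fixes v :: "real \<Rightarrow> real"
  assumes "\<And>t. t \<in> {a..b} \<Longrightarrow> isCont v t" "\<And>t. t \<in> {a..b} \<Longrightarrow> v t \<noteq> 0" "a \<le> b" "0 < v a"
  shows "0 < v b"
  using IVT2[of v b 0 a] assms by (force simp: not_le[symmetric])

lemma energy_le_6:
  assumes sol: "solution_on {a..} \<phi> v y z" and "a \<le> t"
  shows "energy (\<phi> t) (v t) (y t) (z t) \<le> 6"
proof (rule ccontr)
  assume "\<not> ?thesis"
  then have e: "6 < energy (\<phi> t) (v t) (y t) (z t)" by simp
  have sol': "solution_on {t..} \<phi> v y z" using solution_on_subset[OF sol] assms(2) by auto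
  have nz: "v s \<noteq> 0" if "t \<le> s" for s
  proof
    assume "v s = 0"
    moreover have "6 < energy (\<phi> s) (v s) (y s) (z s)" using energy_mono[OF sol', of t s] that e by auto
    ultimately show False using energy_at_rest_le[of "\<phi> s" "y s" "z s"] by simp
  qed
  show False
  proof (cases "0 < v t")
    case True
    then have "0 < v s" if "t \<le> s" for s
      using that nz by (intro isCont_nonzero_same_sign[of t s v] solution_on_isCont[OF sol']) auto
    then show False using energy_gt_6_blowup_pos[OF sol' e] by blast
  next
    case False
    then have "0 < - v t" using nz[of t] by auto
    then have "0 < - v s" if "t \<le> s" for s
      using that nz by (intro isCont_nonzero_same_sign[of t s "\<lambda>s. - v s"] continuous_intros solution_on_isCont[OF sol']) auto
    then show False using energy_gt_6_blowup_pos[OF solution_on_minus[OF sol']] e by (simp add: energy_minus)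
  qed
qed

section \<open>Passing through a multiple of \<pi>\<close>

lemma cos_le_sin_squared: "cos x \<le> 1 - (sin x)^2 / 2" for x :: real
proof -
  have "0 \<le> (1 - cos x)^2" by simp
  then show ?thesis unfolding sin_squared_eq by (simp add: power2_eq_square field_simps)
qed

text \<open>In the ratios \<open>r\<close>, \<open>h\<close>, \<open>n\<close> the rate divided by
  \<open>v^2\<close> is at least \<open>2 r^2 + 14 - 24 h\<close>, so the claim follows from
  \<open>ratio_bound\<close>. The work is to verify its differential inequalities.\<close>

lemma kinetic_rate_nonneg:
  assumes sol: "solution_on {a..b} \<phi> v y z"
    and init: "\<phi> a = 0" "0 \<le> kinetic (\<phi> a) (v a) (y a) (z a)"
    and pos: "\<And>t. t \<in> {a..b} \<Longrightarrow> 0 < v t"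
    and le: "\<And>t. t \<in> {a..b} \<Longrightarrow> \<phi> t \<le> pi / 2"
    and t: "t \<in> {a..b}"
  shows "0 \<le> energy_rate (\<phi> t) (v t) (y t) - 12 * sin (2 * \<phi> t) * v t"
proof -
  define r where "r t = y t / v t" for t
  define h where "h t = sin (\<phi> t) / v t" for t
  define k where "k t = kinetic (\<phi> t) (v t) (y t) (z t)" for t
  define k' where "k' t = energy_rate (\<phi> t) (v t) (y t) - 12 * sin (2 * \<phi> t) * v t" for t
  define n where "n t = k t / (v t)^2" for t
  note D = solution_onD[OF sol]
  have dk: "(k has_real_derivative k' s) (at s)" if "s \<in> {a..b}" for s
    unfolding k_def k'_def by (rule has_real_derivative_kinetic[OF sol that])
  have dr: "(r has_real_derivative z s / v s - (r s)^2) (at s)" if "s \<in> {a..b}" for s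
    unfolding r_def using pos[OF that]
    by (auto intro!: derivative_eq_intros D[OF that] simp: field_simps power2_eq_square)
  have dh: "(h has_real_derivative cos (\<phi> s) - r s * h s) (at s)" if "s \<in> {a..b}" for s
    unfolding h_def r_def using pos[OF that]
    by (auto intro!: derivative_eq_intros D[OF that] simp: field_simps power2_eq_square)
  have dn: "(n has_real_derivative k' s / (v s)^2 - 2 * r s * n s) (at s)" if "s \<in> {a..b}" for s
    unfolding n_def r_def using pos[OF that]
    by (auto intro!: derivative_eq_intros D[OF that] dk[OF that] simp: field_simps power2_eq_square)
  have phi0: "0 \<le> \<phi> s" if s: "s \<in> {a..b}" for s
  proof -
    have "\<phi> a \<le> \<phi> s"
    proof (rule deriv_nonneg_imp_le[of a s \<phi> v])
      fix u assume "a \<le> u" "u \<le> s"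
      then have "u \<in> {a..b}" using s by auto
      then show "(\<phi> has_real_derivative v u) (at u)" "0 \<le> v u" using D(1) pos by (auto intro: less_imp_le)
    qed (use s in auto)
    then show ?thesis using init by simp
  qed
  have h0: "0 \<le> h s" if s: "s \<in> {a..b}" for s
    unfolding h_def using phi0[OF s] le[OF s] pos[OF s] by (intro divide_nonneg_pos sin_ge_zero) auto
  have hv: "sin (\<phi> s) = h s * v s" if "s \<in> {a..b}" for s using pos[OF that] by (simp add: h_def)
  have C: "cos (2 * \<phi> s) = 1 - 2 * ((h s)^2 * (v s)^2)" if "s \<in> {a..b}" for s
    unfolding cos_double_sin hv[OF that] by (simp add: power_mult_distrib)
  \<comment> \<open>The definition of \<open>kinetic\<close>, solved for \<open>z\<close>.\<close>
  have zv: "z s / v s = n s + (r s)^2 / 2 - 2 * r s + 13/2 + (3/2 - 4 * (h s)^2) * (v s)^2" if s: "s \<in> {a..b}" for s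
  proof -
    have "n s = z s / v s - (r s)^2 / 2 + 2 * r s - (9/2 + 2 * cos (2 * \<phi> s)) - 3/2 * (v s)^2"
      unfolding n_def k_def kinetic_def r_def using pos[OF s] by (simp add: field_simps eval_nat_numeral)
    moreover define X where "X = (h s)^2 * (v s)^2"
    moreover have "(3/2 - 4 * (h s)^2) * (v s)^2 = 3/2 * (v s)^2 - 4 * X"
      unfolding X_def by (simp add: algebra_simps)
    ultimately show ?thesis unfolding C[OF s] by simp
  qed
  have k'v: "2 * (r s)^2 + 14 - 24 * h s \<le> k' s / (v s)^2" if s: "s \<in> {a..b}" for s
  proof -
    have "k' s / (v s)^2 = 2 * (r s)^2 + (10 + 4 * cos (2 * \<phi> s)) + 2 * (v s)^2 - 24 * h s * cos (\<phi> s)"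
      unfolding k'_def energy_rate_def sin_double hv[OF s] r_def using pos[OF s]
      by (simp add: field_simps eval_nat_numeral)
    also have "\<dots> = 2 * (r s)^2 + 14 + (2 - 8 * (h s)^2) * (v s)^2 - 24 * (h s * cos (\<phi> s))"
      unfolding C[OF s] by (simp add: algebra_simps)
    finally have eq: "k' s / (v s)^2 = \<dots>" .
    have "cos (\<phi> s) \<le> 1 - (h s)^2 * (v s)^2 / 2"
      using cos_le_sin_squared[of "\<phi> s"] unfolding hv[OF s] by (simp add: power_mult_distrib)
    then have "h s * cos (\<phi> s) \<le> h s * (1 - (h s)^2 * (v s)^2 / 2)" using h0[OF s] by (rule mult_left_mono)
    then have "h s * cos (\<phi> s) \<le> h s - h s ^ 3 * (v s)^2 / 2"
      by (simp add: algebra_simps power2_eq_square power3_eq_cube)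
    moreover have "0 \<le> (2 - 8 * (h s)^2 + 12 * h s ^ 3) * (v s)^2"
    proof -
      \<comment> \<open>\<open>4/9\<close> minimizes \<open>12 h^3 - 8 h^2\<close> over
        \<open>h >= 0\<close>, and the product equals \<open>12 h^3 - 8 h^2 + 128/243\<close>; so
        the coefficient of \<open>v^2\<close> is nonnegative whatever the size of
        \<open>h\<close>.\<close>
      have "0 \<le> (h s - 4/9)^2 * (12 * h s + 8/3)" using h0[OF s] by simp
      then have "0 \<le> 2 - 8 * (h s)^2 + 12 * h s ^ 3"
        by (simp add: power2_eq_square power3_eq_cube field_simps)
      then show ?thesis by simp
    qed
    ultimately show ?thesis unfolding eq by (simp add: algebra_simps)
  qed
  have "h t \<le> 3/5 \<and> 12 * h t \<le> 7 + (r t)^2"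
  proof (rule ratio_bound[of a b r _ h _ n, OF dr dh dn h0])
    fix s assume s: "s \<in> {a..b}" and h: "h s \<le> 3/5"
    \<comment> \<open>\<open>3/5\<close> is just below \<open>sqrt (3/8)\<close>, so the term with
      \<open>v^2\<close> in \<open>zv\<close> is nonnegative and may be dropped.\<close>
    have "h s * h s \<le> 3/5 * (3/5)" using h h0[OF s] by (intro mult_mono) auto
    then have "0 \<le> (3/2 - 4 * (h s)^2) * (v s)^2" by (intro mult_nonneg_nonneg) (auto simp: power2_eq_square)
    then show "n s - (r s)^2 / 2 - 2 * r s + 13/2 \<le> z s / v s - (r s)^2" unfolding zv[OF s] by simp
    show "cos (\<phi> s) - r s * h s \<le> 1 - r s * h s" by simp
    show "2 * (r s)^2 + 14 - 24 * h s - 2 * r s * n s \<le> k' s / (v s)^2 - 2 * r s * n s" using k'v[OF s] by simp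
  next
    show "h a = 0" using init by (simp add: h_def)
    show "0 \<le> n a" using init by (simp add: n_def k_def)
  qed (use t in auto)
  then have "0 \<le> k' t / (v t)^2" using k'v[OF t] by linarith
  then show ?thesis using pos[OF t] by (simp add: zero_le_divide_iff k'_def)
qed

text \<open>At the crossing the potential has its minimum -6, so the kinetic part starts
  nonnegative; it then becomes positive and does not decrease while \<open>v > 0\<close> and
  \<open>\<phi> <= pi / 2\<close>. The solution cannot meet \<open>v = 0\<close>, where the kinetic
  part is at most 0, nor \<open>\<phi> = pi / 2\<close>, where the energy would exceed 6. So it
  stays in this region forever, against the limit 0 of the kinetic part.\<close>

lemma no_crossing_pos:
  assumes sol: "solution_on {a..} \<phi> v y z"
    and init: "\<phi> a = 0" "0 < v a" "- 6 \<le> energy (\<phi> a) (v a) (y a) (z a)"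
    and lim: "((\<lambda>t. kinetic (\<phi> t) (v t) (y t) (z t)) \<longlongrightarrow> 0) at_top"
  shows False
proof -
  define k where "k t = kinetic (\<phi> t) (v t) (y t) (z t)" for t
  have k0: "0 \<le> k a" using init by (simp add: k_def energy_def)
  note ct = solution_on_isCont[OF sol, unfolded atLeast_iff]
  note dk = has_real_derivative_kinetic[OF sol, unfolded atLeast_iff, folded k_def]
  have kmono: "k s \<le> k t"
    if "a \<le> s" "s \<le> t" "\<And>u. u \<in> {a..t} \<Longrightarrow> 0 < v u" "\<And>u. u \<in> {a..t} \<Longrightarrow> \<phi> u \<le> pi / 2" for s t
  proof (rule deriv_nonneg_imp_le[OF that(2)])
    fix u assume u: "s \<le> u" "u \<le> t"
    show "(k has_real_derivative energy_rate (\<phi> u) (v u) (y u) - 12 * sin (2 * \<phi> u) * v u) (at u)"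
      using dk[of u] u that(1) by simp
    show "0 \<le> energy_rate (\<phi> u) (v u) (y u) - 12 * sin (2 * \<phi> u) * v u"
      by (rule kinetic_rate_nonneg[of a t \<phi> v y z])
         (use sol init k0 that u in \<open>auto simp: k_def intro: solution_on_subset\<close>)
  qed
  \<comment> \<open>Strict increase at \<open>a\<close> turns \<open>0 <= k a\<close> into
    \<open>0 < k\<close> right afterwards.\<close>
  have "0 < energy_rate (\<phi> a) (v a) (y a) - 12 * sin (2 * \<phi> a) * v a"
  proof -
    have "0 < (v a)^2" using init by simp
    then have "0 < 2 * (y a)^2 + 6 * (v a)^2" by (intro add_nonneg_pos) auto
    also have "\<dots> \<le> energy_rate (\<phi> a) (v a) (y a)" by (rule energy_rate_ge)
    finally show ?thesis using init by simp
  qed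
  from DERIV_pos_inc_right[OF dk[OF order_refl] this]
  obtain d where d: "0 < d" "\<And>x. 0 < x \<Longrightarrow> x < d \<Longrightarrow> k a < k (a + x)" by auto
  have kpos: "0 < k t"
    if t: "a < t" and h: "\<And>u. u \<in> {a..t} \<Longrightarrow> 0 < v u" "\<And>u. u \<in> {a..t} \<Longrightarrow> \<phi> u \<le> pi / 2" for t
  proof -
    define x where "x = min (d/2) (t - a)"
    have x: "0 < x" "x < d" "a + x \<le> t" using d t by (auto simp: x_def)
    have "0 < k (a + x)" using d(2)[OF x(1,2)] k0 by simp
    also have "\<dots> \<le> k t" using x h by (intro kmono) auto
    finally show ?thesis .
  qed
  have good: "0 < v t \<and> \<phi> t < pi / 2" if "a \<le> t" for t
  proof (rule ccontr)
    assume bad: "\<not> ?thesis"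
    define S where "S = {u\<in>{a..t}. v u \<le> 0} \<union> {u\<in>{a..t}. pi / 2 \<le> \<phi> u}"
    have cv: "continuous_on {a..t} v" and cp: "continuous_on {a..t} \<phi>"
      using ct by (auto intro!: continuous_at_imp_continuous_on)
    have clS: "closed S" unfolding S_def
      by (intro closed_Un continuous_on_closed_Collect_le cv cp continuous_on_const) auto
    have bdd: "bdd_below S" by (auto simp: S_def intro!: bdd_belowI[of _ a])
    have "S \<noteq> {}" using bad that by (auto simp: S_def not_less)
    then have cS: "Inf S \<in> S" using clS bdd by (intro closed_contains_Inf)
    define c where "c = Inf S"
    have c: "a \<le> c" "c \<le> t" "v c \<le> 0 \<or> pi / 2 \<le> \<phi> c" using cS by (auto simp: S_def c_def)
    have ac: "a < c" using c init pi_gt_zero by (cases "c = a") auto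
    have below: "0 < v u" "\<phi> u < pi / 2" if "a \<le> u" "u < c" for u
    proof -
      have "u \<notin> S" using that cInf_lower[OF _ bdd, of u] by (auto simp: c_def)
      then show "0 < v u" "\<phi> u < pi / 2" using that c by (auto simp: S_def)
    qed
    define m where "m = (a + c) / 2"
    have m: "a < m" "m < c" using ac by (auto simp: m_def)
    have km: "0 < k m" using m below by (intro kpos) (auto intro: less_imp_le)
    have left: "(f \<longlongrightarrow> f c) (at_left c)" if "isCont f c" for f :: "real \<Rightarrow> real"
      using that by (simp add: isCont_def filterlim_at_split)
    have ev: "eventually (\<lambda>u. m < u \<and> u < c) (at_left c)"
      using eventually_at_left[OF m(2)] m(2) by blast
    have ev1: "eventually (\<lambda>u. 0 \<le> v u) (at_left c)" and ev2: "eventually (\<lambda>u. \<phi> u \<le> pi / 2) (at_left c)"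
      using ev by (eventually_elim, use m below in \<open>auto intro: less_imp_le\<close>)+
    have vc: "0 \<le> v c" by (rule tendsto_lowerbound[OF left[OF ct(2)[OF c(1)]] ev1]) simp
    have pc: "\<phi> c \<le> pi / 2" by (rule tendsto_upperbound[OF left[OF ct(1)[OF c(1)]] ev2]) simp
    have "isCont k c" using dk[OF c(1)] by (rule DERIV_isCont)
    then have kc: "k m \<le> k c"
    proof (intro tendsto_lowerbound[OF left])
      show "eventually (\<lambda>u. k m \<le> k u) (at_left c)"
        using ev by eventually_elim (use m below in \<open>auto intro!: kmono intro: less_imp_le\<close>)
    qed auto
    show False
    proof (cases "v c = 0")
      case True
      then have "k c = - ((y c)^2 / 2)" by (simp add: k_def kinetic_def)
      then show False using kc km zero_le_power2[of "y c"] by linarith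
    next
      case False
      then have "\<phi> c = pi / 2" using c(3) vc pc by auto
      then have e: "2 * \<phi> c = pi" by simp
      have "cos (2 * \<phi> c) = - 1" unfolding e by simp
      then have "energy (\<phi> c) (v c) (y c) (z c) = k c + 6" by (simp add: energy_def k_def)
      then show False using energy_le_6[OF sol c(1)] kc km by simp
    qed
  qed
  have "eventually (\<lambda>t. k (a + 1) \<le> k t) at_top"
    using eventually_ge_at_top[of "a + 1"] by eventually_elim (use good in \<open>auto intro!: kmono intro: less_imp_le\<close>)
  then have "k (a + 1) \<le> 0" using lim by (intro tendsto_lowerbound[of k 0 at_top]) (auto simp: k_def[abs_def])
  moreover have "0 < k (a + 1)" using good by (intro kpos) (auto intro: less_imp_le)
  ultimately show False by simp
qed

lemma kinetic_shift_pi: "kinetic (p - pi) v y z = kinetic p v y z"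
  by (simp add: kinetic_def right_diff_distrib cos_diff)

lemma kinetic_minus: "kinetic (- p) (- v) (- y) (- z) = kinetic p v y z"
  by (simp add: kinetic_def)

lemma no_crossing:
  assumes sol: "solution_on {a..} \<phi> v y z"
    and init: "\<phi> a = 0" "- 6 < energy (\<phi> a) (v a) (y a) (z a)"
    and lim: "((\<lambda>t. kinetic (\<phi> t) (v t) (y t) (z t)) \<longlongrightarrow> 0) at_top"
  shows False
proof -
  have "v a \<noteq> 0" using init energy_at_rest[of 0 "y a" "z a"] zero_le_power2[of "y a"] by auto
  then consider "0 < v a" | "0 < - v a" by linarith
  then show False
  proof cases
    case 1
    then show ?thesis using no_crossing_pos[OF sol] init lim by auto
  next
    case 2
    then show ?thesis
      using no_crossing_pos[OF solution_on_minus[OF sol]] init lim energy_minus[of "\<phi> a" "v a" "y a" "z a"]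
      by (auto simp: kinetic_minus)
  qed
qed

section \<open>Asymptotics at infinity\<close>

text \<open>The part of \<open>autonomous_rhs\<close> free of \<open>z\<close>: the equation reads
  \<open>y'' + 2 y' = force\<close>, to which the damped comparison lemmas apply.\<close>

definition force :: "real \<Rightarrow> real \<Rightarrow> real \<Rightarrow> real" where
  "force p v y = (9 + 4 * cos (2 * p) + 6 * v^2) * y - 12 * sin (2 * p) - 4 * sin (2 * p) * v^2
     + (10 + 4 * cos (2 * p)) * v + 2 * v^3"

lemma autonomous_rhs_force: "autonomous_rhs p v y z = force p v y - 2 * z"
  by (simp add: autonomous_rhs_def force_def algebra_simps)

lemma force_minus: "force (- p) (- v) (- y) = - force p v y"
  by (simp add: force_def algebra_simps)

text \<open>The worst case is \<open>cos (2 p) = - 1\<close>: the coefficient of \<open>y\<close> is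
  then at least 5, against 12 for \<open>sin (2 p)\<close> and 6 for \<open>v\<close>, whence
  \<open>12/5\<close> and \<open>6/5\<close>. A larger cosine and the terms with \<open>v^2\<close>
  only help.\<close>

lemma force_pos:
  assumes y: "12/5 * \<bar>sin (2 * p)\<bar> + 6/5 * \<bar>v\<bar> < y"
  shows "0 < force p v y"
proof -
  define C S a where "C = cos (2 * p)" and "S = \<bar>sin (2 * p)\<bar>" and "a = \<bar>v\<bar>"
  have C: "-1 \<le> C" using cos_ge_minus_one by (simp add: C_def)
  have pos: "0 \<le> S" "0 \<le> a" by (auto simp: S_def a_def)
  have a2: "v^2 = a^2" by (simp add: a_def)
  have A: "0 < 9 + 4 * C + 6 * a^2" using C zero_le_power2[of a] by linarith
  have C1: "0 \<le> C + 1" using C by simp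
  have "0 \<le> S * (C + 1)" "0 \<le> a * (C + 1)" using C1 pos by simp_all
  then have "0 \<le> 48/5 * (S * (C + 1)) + 52/5 * (S * a^2)" "0 \<le> 4/5 * (a * (C + 1)) + 26/5 * a^3"
    using pos by simp_all
  moreover have "(9 + 4 * C + 6 * a^2) * (12/5 * S + 6/5 * a)
      = (12 * S + 4 * S * a^2 + (10 + 4 * C) * a + 2 * a^3)
        + (48/5 * (S * (C + 1)) + 52/5 * (S * a^2)) + (4/5 * (a * (C + 1)) + 26/5 * a^3)"
    by (simp add: field_simps power2_eq_square power3_eq_cube)
  ultimately have "12 * S + 4 * S * a^2 + (10 + 4 * C) * a + 2 * a^3 \<le> (9 + 4 * C + 6 * a^2) * (12/5 * S + 6/5 * a)"
    by linarith
  also have "\<dots> < (9 + 4 * C + 6 * a^2) * y"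
    using y A by (intro mult_strict_left_mono) (auto simp: S_def a_def)
  finally have main: "12 * S + 4 * S * a^2 + (10 + 4 * C) * a + 2 * a^3 < (9 + 4 * C + 6 * a^2) * y" .
  have "12 * sin (2 * p) \<le> 12 * S" by (simp add: S_def)
  moreover have "4 * sin (2 * p) * v^2 \<le> 4 * S * a^2" unfolding a2 by (intro mult_right_mono) (auto simp: S_def)
  moreover have "(10 + 4 * C) * (- v) \<le> (10 + 4 * C) * a" using C by (intro mult_left_mono) (auto simp: a_def)
  moreover have "- (v^3) \<le> a^3" unfolding a_def power_abs[symmetric] by simp
  ultimately show ?thesis using main unfolding force_def C_def[symmetric] a2 by (simp only: mult_minus_right)
qed

lemma abs_le_mult: "\<bar>a\<bar> \<le> A \<Longrightarrow> \<bar>b\<bar> \<le> B \<Longrightarrow> \<bar>a * b\<bar> \<le> A * (B::real)"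
  unfolding abs_mult by (intro mult_mono) auto

lemma abs_force_le:
  assumes v: "\<bar>v\<bar> \<le> V" and y: "\<bar>y\<bar> \<le> M"
  shows "\<bar>force p v y\<bar> \<le> (13 + 6 * V^2) * M + 12 + 4 * V^2 + 14 * V + 2 * V^3"
proof -
  have V: "0 \<le> V" "0 \<le> M" using v y by auto
  have v2: "v^2 \<le> V^2" using v V by (simp add: abs_le_square_iff[symmetric])
  have C: "-1 \<le> cos (2 * p)" "cos (2 * p) \<le> 1" by auto
  have "\<bar>(9 + 4 * cos (2 * p) + 6 * v^2) * y\<bar> \<le> (13 + 6 * V^2) * M"
    using C v2 zero_le_power2[of v] by (intro abs_le_mult y) linarith
  moreover have "\<bar>sin (2 * p) * v^2\<bar> \<le> 1 * V^2" using v2 by (intro abs_le_mult) auto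
  moreover have "\<bar>(10 + 4 * cos (2 * p)) * v\<bar> \<le> 14 * V" using C by (intro abs_le_mult v) linarith
  moreover have "\<bar>v^3\<bar> \<le> V^3" unfolding power_abs using v by (intro power_mono) auto
  moreover have "\<bar>sin (2 * p)\<bar> \<le> 1" by simp
  ultimately show ?thesis unfolding force_def mult.assoc by linarith
qed

lemma solution_y_bound:
  assumes sol: "solution_on {p..q} \<phi> v y z" and pq: "p \<le> q"
    and bd: "\<bar>y p\<bar> \<le> M" "\<bar>y q\<bar> \<le> M"
    and small: "\<And>t. t \<in> {p..q} \<Longrightarrow> 12/5 * \<bar>sin (2 * \<phi> t)\<bar> + 6/5 * \<bar>v t\<bar> \<le> M"
    and t: "t \<in> {p..q}"
  shows "\<bar>y t\<bar> \<le> M"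
proof -
  have *: "y t \<le> M"
    if sol: "solution_on {p..q} \<phi> v y z" and bd: "y p \<le> M" "y q \<le> M"
    and small: "\<And>t. t \<in> {p..q} \<Longrightarrow> 12/5 * \<bar>sin (2 * \<phi> t)\<bar> + 6/5 * \<bar>v t\<bar> \<le> M" for \<phi> v y z
  proof (rule damped_second_order_max_principle[OF pq _ _ _ bd t])
    fix s assume s: "s \<in> {p..q}"
    show "(y has_real_derivative z s) (at s)" "(z has_real_derivative force (\<phi> s) (v s) (y s) - 2 * z s) (at s)"
      using solution_onD[OF sol s] by (auto simp: autonomous_rhs_force)
    show "0 < force (\<phi> s) (v s) (y s)" if "M < y s" using small[OF s] that by (intro force_pos) simp
  qed
  have "y t \<le> M" by (rule *[OF sol]) (use bd small in auto)
  moreover have "- y t \<le> M" by (rule *[OF solution_on_minus[OF sol]]) (use bd small in auto)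
  ultimately show ?thesis by simp
qed

lemma solution_z_bound:
  assumes sol: "solution_on {p..s} \<phi> v y z" and ps: "p \<le> s"
    and K: "\<And>t. t \<in> {p..s} \<Longrightarrow> \<bar>force (\<phi> t) (v t) (y t)\<bar> \<le> K"
  shows "\<bar>z s\<bar> \<le> \<bar>z p\<bar> + K / 2"
proof -
  have K0: "0 \<le> K" using K[of p] ps by auto
  have *: "z s \<le> \<bar>z p\<bar> + K / 2"
    if sol: "solution_on {p..s} \<phi> v y z" and K: "\<And>t. t \<in> {p..s} \<Longrightarrow> force (\<phi> t) (v t) (y t) \<le> K" for \<phi> v y z
    by (rule damped_first_order_bound[OF ps _ _ K0, of z "\<lambda>t. force (\<phi> t) (v t) (y t)"])
       (use solution_onD[OF sol] K in \<open>auto simp: autonomous_rhs_force\<close>)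
  have "z s \<le> \<bar>z p\<bar> + K / 2" by (rule *[OF sol]) (use K abs_le_D1 in blast)
  moreover have "- z s \<le> \<bar>- z p\<bar> + K / 2"
    by (rule *[OF solution_on_minus[OF sol]]) (use K abs_le_D2 in \<open>force simp: force_minus\<close>)
  ultimately show ?thesis by simp
qed

text \<open>The derivative \<open>2 v y\<close> of \<open>v^2\<close> is at most
  \<open>v^2 + y^2\<close>, hence at most half of \<open>energy_rate\<close>.\<close>

lemma solution_v_bound:
  assumes sol: "solution_on {a..b} \<phi> v y z" and ab: "a \<le> b"
  shows "(v b)^2 \<le> (v a)^2 + (energy (\<phi> b) (v b) (y b) (z b) - energy (\<phi> a) (v a) (y a) (z a)) / 2"
proof -
  let ?e = "\<lambda>t. energy (\<phi> t) (v t) (y t) (z t)"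
  have "?e a / 2 - (v a)^2 \<le> ?e b / 2 - (v b)^2"
  proof (rule deriv_nonneg_imp_le[OF ab, of "\<lambda>t. ?e t / 2 - (v t)^2"])
    fix t assume "a \<le> t" "t \<le> b"
    then have t: "t \<in> {a..b}" by simp
    show "((\<lambda>t. ?e t / 2 - (v t)^2) has_real_derivative energy_rate (\<phi> t) (v t) (y t) / 2 - 2 * (v t * y t)) (at t)"
      by (auto intro!: derivative_eq_intros has_real_derivative_energy[OF sol t] solution_onD[OF sol t])
    have "4 * (v t * y t) \<le> 2 * (y t)^2 + 2 * (v t)^2"
      using zero_le_power2[of "y t - v t"] unfolding power2_diff by (simp add: mult_ac)
    then show "0 \<le> energy_rate (\<phi> t) (v t) (y t) / 2 - 2 * (v t * y t)"
      using energy_rate_ge[of "y t" "v t" "\<phi> t"] zero_le_power2[of "v t"] by linarith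
  qed
  then show ?thesis by (simp add: field_simps)
qed

text \<open>The maximum principle needs \<open>y\<close> at both ends, but nothing is known about
  later values of \<open>y\<close>. The mean value theorem supplies a point \<open>q\<close> within
  one unit of time where \<open>|y q| <= 2 V\<close>; hence the margin in
  \<open>t <= b - 1\<close>.\<close>

lemma solution_yz_bound:
  assumes sol: "solution_on {a..b} \<phi> v y z"
    and V: "\<And>t. t \<in> {a..b} \<Longrightarrow> \<bar>v t\<bar> \<le> V"
    and M: "\<bar>y a\<bar> \<le> M" "2 * V \<le> M" "12/5 + 6/5 * V \<le> M"
    and t: "a \<le> t" "t \<le> b - 1"
  shows "\<bar>y t\<bar> \<le> M" "\<bar>z t\<bar> \<le> \<bar>z a\<bar> + ((13 + 6 * V^2) * M + 12 + 4 * V^2 + 14 * V + 2 * V^3) / 2"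
proof -
  have y: "\<bar>y s\<bar> \<le> M" if s: "a \<le> s" "s \<le> b - 1" for s
  proof -
    have "\<exists>q. s < q \<and> q < s + 1 \<and> v (s + 1) - v s = (s + 1 - s) * y q"
      by (rule MVT2) (use s solution_onD(2)[OF sol] in auto)
    then obtain q where q: "s < q" "q < s + 1" "y q = v (s + 1) - v s" by auto
    have "\<bar>y q\<bar> \<le> \<bar>v (s + 1)\<bar> + \<bar>v s\<bar>" unfolding q(3) by simp
    also have "\<dots> \<le> M" using V[of s] V[of "s + 1"] s M(2) by auto
    finally have yq: "\<bar>y q\<bar> \<le> M" .
    show ?thesis
    proof (rule solution_y_bound[of a q \<phi> v y z, OF _ _ M(1) yq])
      fix u assume "u \<in> {a..q}"
      then have "\<bar>v u\<bar> \<le> V" using q s by (intro V) auto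
      moreover have "\<bar>sin (2 * \<phi> u)\<bar> \<le> 1" by simp
      ultimately show "12/5 * \<bar>sin (2 * \<phi> u)\<bar> + 6/5 * \<bar>v u\<bar> \<le> M" using M(3) by linarith
    qed (use q s in \<open>auto intro: solution_on_subset[OF sol]\<close>)
  qed
  then show "\<bar>y t\<bar> \<le> M" using t by blast
  show "\<bar>z t\<bar> \<le> \<bar>z a\<bar> + ((13 + 6 * V^2) * M + 12 + 4 * V^2 + 14 * V + 2 * V^3) / 2"
    by (rule solution_z_bound[of a t \<phi> v y z]) (use t y V in \<open>auto intro!: abs_force_le solution_on_subset[OF sol]\<close>)
qed

section \<open>Convergence to a rest point\<close>

lemma bounded_on_box:
  fixes f :: "real \<times> real \<times> real \<times> real \<times> real \<Rightarrow> real"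
  assumes "continuous_on UNIV f"
  shows "\<exists>K. \<forall>v y z S C. \<bar>v\<bar> \<le> B \<longrightarrow> \<bar>y\<bar> \<le> B \<longrightarrow> \<bar>z\<bar> \<le> B \<longrightarrow> \<bar>S\<bar> \<le> 1 \<longrightarrow> \<bar>C\<bar> \<le> 1 \<longrightarrow> \<bar>f (v, y, z, S, C)\<bar> \<le> K"
proof -
  let ?X = "{-B..B} \<times> {-B..B} \<times> {-B..B} \<times> {-1..1::real} \<times> {-1..1::real}"
  have "compact (f ` ?X)"
    using assms by (intro compact_continuous_image compact_Times compact_Icc) (auto intro: continuous_on_subset)
  then obtain K where "\<forall>x\<in>f ` ?X. \<bar>x\<bar> \<le> K" using compact_imp_bounded bounded_real by metis
  then show ?thesis by (intro exI[of _ K]) (auto simp: abs_le_iff)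
qed

lemma solution_limits:
  assumes sol: "solution_on S \<phi> v y z"
    and shift: "\<And>d. d > 0 \<Longrightarrow> filterlim (\<lambda>s. s + d) F F"
    and S: "eventually (\<lambda>s. {s..s+1} \<subseteq> S) F"
    and bd: "\<And>t. t \<in> S \<Longrightarrow> \<bar>v t\<bar> \<le> B \<and> \<bar>y t\<bar> \<le> B \<and> \<bar>z t\<bar> \<le> B"
    and lim: "((\<lambda>t. energy (\<phi> t) (v t) (y t) (z t)) \<longlongrightarrow> e) F"
  shows "(v \<longlongrightarrow> 0) F" "(y \<longlongrightarrow> 0) F" "(z \<longlongrightarrow> 0) F" "((\<lambda>t. sin (2 * \<phi> t)) \<longlongrightarrow> 0) F"
proof -
  note D = solution_onD[OF sol]
  \<comment> \<open>The angle is not known to be bounded, but its sine and cosine are; the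
    derivatives \<open>h1\<close>, \<open>h2\<close>, \<open>h3\<close> below are polynomials in
    these five quantities.\<close>
  define w where "w t = (v t, y t, z t, sin (2 * \<phi> t), cos (2 * \<phi> t))" for t
  have box: "\<exists>K. \<forall>t\<in>S. \<bar>h (w t)\<bar> \<le> K" if "continuous_on UNIV h"
    for h :: "real \<times> real \<times> real \<times> real \<times> real \<Rightarrow> real"
    using bounded_on_box[OF that, of B] bd unfolding w_def by (metis abs_sin_le_one abs_cos_le_one)
  define h1 where "h1 = (\<lambda>(v, y, z, S, C). 4 * y * z - 8 * S * v^3 + (10 + 4 * C) * (2 * v * y) + 8 * v^3 * y :: real)"
  have "continuous_on UNIV h1" unfolding h1_def case_prod_beta by (intro continuous_intros)
  from box[OF this] obtain K1 where K1: "\<And>t. t \<in> S \<Longrightarrow> \<bar>h1 (w t)\<bar> \<le> K1" by blast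
  have d1: "((\<lambda>t. energy_rate (\<phi> t) (v t) (y t)) has_real_derivative h1 (w t)) (at t)"
    if "t \<in> S" for t
    unfolding energy_rate_def h1_def w_def
    by (auto intro!: derivative_eq_intros D[OF that] simp: power2_eq_square power3_eq_cube algebra_simps)
  have rate: "((\<lambda>t. energy_rate (\<phi> t) (v t) (y t)) \<longlongrightarrow> 0) F"
    by (rule tendsto_deriv_zero[OF shift lim, of _ _ K1], assumption, rule eventually_mono[OF S])
       (use d1 has_real_derivative_energy[OF sol] K1 in auto)
  have sq: "((\<lambda>t. (f t)^2) \<longlongrightarrow> 0) F" if "f = v \<or> f = y" for f
  proof (rule tendsto_sandwich[OF _ _ tendsto_const rate])
    show "eventually (\<lambda>t. (f t)^2 \<le> energy_rate (\<phi> t) (v t) (y t)) F"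
      using energy_rate_ge that by (intro always_eventually allI) (smt (verit) zero_le_power2)
  qed simp
  then have v2: "((\<lambda>t. (v t)^2) \<longlongrightarrow> 0) F" by blast
  then show v: "(v \<longlongrightarrow> 0) F" by (simp add: tendsto_null_power)
  show y: "(y \<longlongrightarrow> 0) F" using sq[of y] by (simp add: tendsto_null_power)
  define h2 where "h2 = (\<lambda>(v, y, z, S, C). (4 * C + 9) * y - 12 * S + (6 * y - 4 * S) * v^2 + (4 * C + 10) * v + 2 * v^3 - 2 * z :: real)"
  have "continuous_on UNIV h2" unfolding h2_def case_prod_beta by (intro continuous_intros)
  from box[OF this] obtain K2 where K2: "\<And>t. t \<in> S \<Longrightarrow> \<bar>h2 (w t)\<bar> \<le> K2" by blast
  have d2: "(z has_real_derivative h2 (w t)) (at t)" if "t \<in> S" for t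
    using D(4)[OF that] by (simp add: autonomous_rhs_def h2_def w_def)
  show z: "(z \<longlongrightarrow> 0) F"
    by (rule tendsto_deriv_zero[OF shift y, of _ _ K2], assumption, rule eventually_mono[OF S])
       (use d2 D(3) K2 in auto)
  \<comment> \<open>\<open>f3\<close> gathers terms of the equation that are total derivatives, so
    that its derivative \<open>g3\<close> equals \<open>- 12 sin (2 \<phi>)\<close> up to terms with
    a factor \<open>v\<close>.\<close>
  define f3 where "f3 t = z t + 2 * y t - 9 * v t - 4 * (cos (2 * \<phi> t) * v t) - 2 * (v t)^3" for t
  define g3 where "g3 t = (10 + 4 * cos (2 * \<phi> t)) * v t + 2 * (v t)^3 - 12 * sin (2 * \<phi> t) + 4 * (sin (2 * \<phi> t) * (v t)^2)" for t
  define h3 where "h3 = (\<lambda>(v, y, z::real, S, C). (10 + 4 * C) * y - 8 * S * v^2 + 6 * v^2 * y - 24 * C * v + 8 * C * v^3 + 8 * S * v * y :: real)"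
  have "continuous_on UNIV h3" unfolding h3_def case_prod_beta by (intro continuous_intros)
  from box[OF this] obtain K3 where K3: "\<And>t. t \<in> S \<Longrightarrow> \<bar>h3 (w t)\<bar> \<le> K3" by blast
  have d3: "(f3 has_real_derivative g3 t) (at t)" if "t \<in> S" for t
    unfolding f3_def[abs_def] g3_def
    by (auto intro!: derivative_eq_intros D[OF that] simp: autonomous_rhs_def power2_eq_square power3_eq_cube algebra_simps)
  have d4: "(g3 has_real_derivative h3 (w t)) (at t)" if "t \<in> S" for t
    unfolding g3_def[abs_def] h3_def w_def
    by (auto intro!: derivative_eq_intros D[OF that] simp: power2_eq_square power3_eq_cube algebra_simps)
  have bm: "((\<lambda>t. f t * g t) \<longlongrightarrow> 0) F" if "\<And>t. \<bar>f t\<bar> \<le> 14" "(g \<longlongrightarrow> 0) F" for f g :: "real \<Rightarrow> real"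
  proof (rule tendsto_0_le[OF that(2), of _ 14])
    show "eventually (\<lambda>t. norm (f t * g t) \<le> norm (g t) * 14) F"
    proof (intro always_eventually allI)
      fix t
      have "\<bar>f t\<bar> * \<bar>g t\<bar> \<le> 14 * \<bar>g t\<bar>" by (rule mult_right_mono[OF that(1) abs_ge_zero])
      then show "norm (f t * g t) \<le> norm (g t) * 14" by (simp add: abs_mult)
    qed
  qed
  have c14: "\<bar>10 + 4 * cos x\<bar> \<le> 14" "\<bar>cos x\<bar> \<le> 14" "\<bar>sin x\<bar> \<le> 14" for x :: real
    using cos_ge_minus_one[of x] cos_le_one[of x] sin_ge_minus_one[of x] sin_le_one[of x] by linarith+
  have v3: "((\<lambda>t. (v t)^3) \<longlongrightarrow> 0) F" using tendsto_power[OF v, of 3] by simp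
  have "(f3 \<longlongrightarrow> 0 + 2 * 0 - 9 * 0 - 4 * 0 - 2 * 0) F"
    unfolding f3_def[abs_def] by (intro tendsto_intros z y v v3 bm c14)
  then have f3: "(f3 \<longlongrightarrow> 0) F" by simp
  have g3: "(g3 \<longlongrightarrow> 0) F"
    by (rule tendsto_deriv_zero[OF shift f3, of _ _ K3], assumption, rule eventually_mono[OF S])
       (use d3 d4 K3 in auto)
  have "((\<lambda>t. ((10 + 4 * cos (2 * \<phi> t)) * v t + 2 * (v t)^3 + 4 * (sin (2 * \<phi> t) * (v t)^2) - g3 t) / 12)
      \<longlongrightarrow> (0 + 2 * 0 + 4 * 0 - 0) / 12) F"
    by (intro tendsto_intros v v3 v2 g3 bm c14) auto
  then show "((\<lambda>t. sin (2 * \<phi> t)) \<longlongrightarrow> 0) F" by (simp add: g3_def)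
qed

text \<open>Once \<open>|sin (2 f)| < 1\<close>, continuity confines \<open>2 f\<close> to a single
  interval of length \<pi> centred at a multiple of \<pi>; after translation to 0 the sine is
  inverted there by \<open>arcsin\<close>.\<close>

lemma sin_double_tendsto_zero_imp_limit:
  fixes f :: "real \<Rightarrow> real"
  assumes cont: "\<And>t. a \<le> t \<Longrightarrow> isCont f t" and lim: "((\<lambda>t. sin (2 * f t)) \<longlongrightarrow> 0) at_top"
  shows "\<exists>k::int. (f \<longlongrightarrow> of_int k * pi / 2) at_top"
proof -
  have "eventually (\<lambda>t. \<bar>sin (2 * f t)\<bar> < 1) at_top"
    using tendstoD[OF lim, of 1] by (simp add: dist_real_def)
  then obtain T0 where T0: "\<bar>sin (2 * f t)\<bar> < 1" if "T0 \<le> t" for t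
    unfolding eventually_at_top_linorder by blast
  define T where "T = max a T0"
  define k where "k = round (2 * f T / pi)"
  define x where "x t = 2 * f t - of_int k * pi" for t
  have sx: "sin (x t) = sin (2 * f t) * cos (of_int k * pi)" for t
    by (simp add: x_def sin_diff sin_times_pi_eq_0)
  have ck: "\<bar>cos (of_int k * pi)\<bar> = 1"
  proof -
    have "sin (of_int k * pi) = 0" by (simp add: sin_times_pi_eq_0)
    then have "(cos (of_int k * pi))^2 = 1" using sin_cos_squared_add[of "of_int k * pi"] by simp
    then show ?thesis by (simp add: abs_square_eq_1)
  qed
  have lt: "\<bar>sin (x t)\<bar> < 1" if "T \<le> t" for t using T0[of t] that by (simp add: sx abs_mult ck T_def)
  have ne: "\<bar>x t\<bar> \<noteq> pi / 2" if "T \<le> t" for t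
  proof
    assume "\<bar>x t\<bar> = pi / 2"
    then have "x t = pi / 2 \<or> x t = - (pi / 2)" by linarith
    then have "\<bar>sin (x t)\<bar> = 1" by (elim disjE) (simp_all only: sin_minus sin_pi_half abs_minus_cancel abs_one)
    then show False using lt[OF that] by simp
  qed
  have "\<bar>2 * f T / pi - of_int k\<bar> \<le> 1/2" unfolding k_def using of_int_round_abs_le[of "2 * f T / pi"] by (simp add: abs_minus_commute)
  then have "pi * \<bar>2 * f T / pi - of_int k\<bar> \<le> pi * (1/2)" by (intro mult_left_mono) auto
  moreover have "pi * \<bar>2 * f T / pi - of_int k\<bar> = \<bar>x T\<bar>"
  proof -
    have "x T = pi * (2 * f T / pi - of_int k)" by (simp add: x_def algebra_simps)
    then show ?thesis by (simp add: abs_mult)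
  qed
  ultimately have xT: "\<bar>x T\<bar> \<le> pi / 2" by simp
  have small: "\<bar>x t\<bar> \<le> pi / 2" if t: "T \<le> t" for t
  proof (rule ccontr)
    assume "\<not> ?thesis"
    then have gt: "pi / 2 \<le> \<bar>x t\<bar>" by simp
    have "\<exists>s. T \<le> s \<and> s \<le> t \<and> \<bar>x s\<bar> = pi / 2"
    proof (rule IVT[OF xT gt t], intro allI impI)
      fix s assume "T \<le> s \<and> s \<le> t"
      then have "isCont f s" by (intro cont) (simp add: T_def)
      then show "isCont (\<lambda>t. \<bar>x t\<bar>) s" unfolding x_def by (intro continuous_intros)
    qed
    then show False using ne by blast
  qed
  have "((\<lambda>t. arcsin (sin (x t))) \<longlongrightarrow> arcsin 0) at_top"
  proof (rule isCont_tendsto_compose[of 0 arcsin])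
    show "isCont arcsin (0::real)" by (intro isCont_arcsin) auto
    have "((\<lambda>t. sin (2 * f t) * cos (of_int k * pi)) \<longlongrightarrow> 0 * cos (of_int k * pi)) at_top"
      by (intro tendsto_intros lim)
    then show "((\<lambda>t. sin (x t)) \<longlongrightarrow> 0) at_top" by (simp add: sx)
  qed
  moreover have "eventually (\<lambda>t. arcsin (sin (x t)) = x t) at_top"
    using eventually_ge_at_top[of T]
  proof eventually_elim
    case (elim t)
    then show ?case using small[OF elim] by (intro arcsin_sin) linarith+
  qed
  ultimately have "(x \<longlongrightarrow> 0) at_top" using tendsto_cong[of "\<lambda>t. arcsin (sin (x t))" x] by simp
  then have "((\<lambda>t. (x t + of_int k * pi) / 2) \<longlongrightarrow> (0 + of_int k * pi) / 2) at_top" by (intro tendsto_intros) auto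
  then show ?thesis by (auto simp: x_def)
qed

lemma solution_limits_at_top:
  assumes sol: "solution_on {a..} \<phi> v y z"
  shows "(v \<longlongrightarrow> 0) at_top" "(y \<longlongrightarrow> 0) at_top" "(z \<longlongrightarrow> 0) at_top"
    "\<exists>k::int. (\<phi> \<longlongrightarrow> of_int k * pi / 2) at_top"
proof -
  let ?e = "\<lambda>t. energy (\<phi> t) (v t) (y t) (z t)"
  have le6: "?e t \<le> 6" if "a \<le> t" for t by (rule energy_le_6[OF sol that])
  define V where "V = sqrt ((v a)^2 + (6 - ?e a) / 2)"
  have V: "\<bar>v t\<bar> \<le> V" if "a \<le> t" for t
  proof -
    have "(v t)^2 \<le> (v a)^2 + (?e t - ?e a) / 2"
      by (rule solution_v_bound[OF _ that]) (rule solution_on_subset[OF sol], auto)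
    also have "\<dots> \<le> (v a)^2 + (6 - ?e a) / 2" using le6[OF that] by simp
    finally show ?thesis unfolding V_def by (rule real_le_rsqrt[of "\<bar>v t\<bar>", simplified])
  qed
  define M where "M = max \<bar>y a\<bar> (max (2 * V) (12/5 + 6/5 * V))"
  define K where "K = \<bar>z a\<bar> + ((13 + 6 * V^2) * M + 12 + 4 * V^2 + 14 * V + 2 * V^3) / 2"
  define B where "B = max V (max M K)"
  have yz: "\<bar>y t\<bar> \<le> M \<and> \<bar>z t\<bar> \<le> K" if t: "a \<le> t" for t
  proof -
    have s: "solution_on {a..t+1} \<phi> v y z" by (rule solution_on_subset[OF sol]) auto
    have M: "\<bar>y a\<bar> \<le> M" "2 * V \<le> M" "12/5 + 6/5 * V \<le> M" by (auto simp: M_def)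
    have V': "\<bar>v u\<bar> \<le> V" if "u \<in> {a..t+1}" for u using V that by simp
    show ?thesis using solution_yz_bound[OF s V' M t] unfolding K_def by simp
  qed
  have bd: "\<bar>v t\<bar> \<le> B \<and> \<bar>y t\<bar> \<le> B \<and> \<bar>z t\<bar> \<le> B" if "t \<in> {a..}" for t
    using V[of t] yz[of t] that by (auto simp: B_def le_max_iff_disj)
  have "\<exists>l. (?e \<longlongrightarrow> l) at_top"
    by (rule incseq_tendsto_at_top[of a _ 6]) (use le6 energy_mono[OF sol] in auto)
  then obtain l where l: "(?e \<longlongrightarrow> l) at_top" by blast
  have S: "eventually (\<lambda>s. {s..s+1} \<subseteq> {a..}) at_top"
    using eventually_ge_at_top[of a] by eventually_elim auto
  note lims = solution_limits[OF sol filterlim_add_const_at_top S bd l]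
  show "(v \<longlongrightarrow> 0) at_top" "(y \<longlongrightarrow> 0) at_top" "(z \<longlongrightarrow> 0) at_top" by (rule lims; assumption)+
  show "\<exists>k::int. (\<phi> \<longlongrightarrow> of_int k * pi / 2) at_top"
    by (rule sin_double_tendsto_zero_imp_limit[of a]) (use lims solution_on_isCont[OF sol] in auto)
qed

section \<open>Flows of Lipschitz vector fields\<close>

lemma norm_le_of_exp_derivative_bound:
  fixes f f' :: "real \<Rightarrow> 'a::real_normed_vector"
  assumes f: "\<And>t. (f has_vector_derivative f' t) (at t)" and "f 0 = 0" and k: "0 < k"
    and bound: "\<And>t. norm (f' t) \<le> A + B * exp (k * \<bar>t\<bar>)" and B: "0 \<le> B"
  shows "norm (f t) \<le> A * \<bar>t\<bar> + B * exp (k * \<bar>t\<bar>) / k"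
proof -
  have *: "norm (f t) \<le> A * t + B * exp (k * t) / k"
    if f: "\<And>t. (f has_vector_derivative f' t) (at t)" "f 0 = 0"
      and bound: "\<And>t. norm (f' t) \<le> A + B * exp (k * \<bar>t\<bar>)" and t: "0 \<le> t"
    for f f' :: "real \<Rightarrow> 'a" and t
  proof (cases "t = 0")
    case True then show ?thesis using f(2) B k by simp
  next
    case False
    then have t0: "0 < t" using t by simp
    define g where "g s = A * s + B * exp (k * s) / k" for s
    have "norm (f t - f 0) \<le> g t - g 0"
    proof (rule differentiable_bound_general[OF t0, of f g f' "\<lambda>s. A + B * exp (k * s)"])
      show "continuous_on {0..t} f"
        using f(1) by (meson continuous_at_imp_continuous_on has_vector_derivative_continuous)
      show "continuous_on {0..t} g" unfolding g_def using k by (intro continuous_intros) auto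
      fix s assume s: "0 < s" "s < t"
      show "(f has_vector_derivative f' s) (at s)" by (rule f)
      show "(g has_vector_derivative A + B * exp (k * s)) (at s)"
        unfolding g_def has_real_derivative_iff_has_vector_derivative[symmetric]
        using k by (auto intro!: derivative_eq_intros)
      show "norm (f' s) \<le> A + B * exp (k * s)" using bound[of s] s by simp
    qed
    moreover have "0 \<le> g 0" using B k by (simp add: g_def)
    ultimately show ?thesis using f(2) by (simp add: g_def)
  qed
  show ?thesis
  proof (cases "0 \<le> t")
    case True
    then show ?thesis using *[OF f assms(2) bound] by simp
  next
    case False
    have "norm (f (- (- t))) \<le> A * (- t) + B * exp (k * (- t)) / k"
    proof (rule *[of "\<lambda>t. f (- t)" "\<lambda>t. - f' (- t)"])
      fix s
      have "((f \<circ> uminus) has_vector_derivative - 1 *\<^sub>R f' (- s)) (at s)"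
        by (rule vector_diff_chain_at) (auto intro!: derivative_eq_intros f)
      then show "((\<lambda>t. f (- t)) has_vector_derivative - f' (- s)) (at s)" by (simp add: o_def)
      show "norm (- f' (- s)) \<le> A + B * exp (k * \<bar>s\<bar>)" using bound[of "- s"] by simp
    qed (use assms(2) False in auto)
    then show ?thesis using False by simp
  qed
qed

text \<open>The difference is the signed integral from 0 to \<open>t\<close>: one of the two
  intervals is empty or a point and contributes 0, so negative \<open>t\<close> are covered
  too.\<close>

lemma has_antiderivative_of_continuous:
  fixes g :: "real \<Rightarrow> 'a::banach"
  assumes "continuous_on UNIV g"
  shows "((\<lambda>t. integral {0..t} g - integral {t..0} g) has_vector_derivative g t) (at t)"
proof -
  define a where "a = - \<bar>t\<bar> - 1"
  define b where "b = \<bar>t\<bar> + 1"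
  have cont: "continuous_on S g" for S using assms continuous_on_subset by blast
  have int: "g integrable_on {u..w}" for u w by (intro integrable_continuous_interval cont)
  have "((\<lambda>u. integral {a..u} g) has_vector_derivative g t) (at t within {a..b})"
    by (rule integral_has_vector_derivative[OF cont]) (auto simp: a_def b_def)
  then have "((\<lambda>u. integral {a..u} g - integral {a..0} g) has_vector_derivative g t) (at t within {a..b})"
    by (auto intro!: derivative_eq_intros)
  moreover have "at t within {a..b} = at t" by (rule at_within_interior) (auto simp: a_def b_def)
  ultimately have "((\<lambda>u. integral {a..u} g - integral {a..0} g) has_vector_derivative g t) (at t)" by simp
  then show ?thesis
  proof (rule has_vector_derivative_transform_within_open[of _ _ _ "{a<..}"])
    fix u assume "u \<in> {a<..}"
    then have u: "a < u" by simp
    have a0: "a \<le> 0" by (simp add: a_def)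
    show "integral {a..u} g - integral {a..0} g = integral {0..u} g - integral {u..0} g"
    proof (cases "0 \<le> u")
      case True
      then have "integral {a..0} g + integral {0..u} g = integral {a..u} g"
        using a0 by (intro Henstock_Kurzweil_Integration.integral_combine int) auto
      moreover have "integral {u..0} g = 0" using True by (cases "u = 0") auto
      ultimately show ?thesis by (simp add: algebra_simps)
    next
      case False
      then have "integral {a..u} g + integral {u..0} g = integral {a..0} g"
        using u by (intro Henstock_Kurzweil_Integration.integral_combine int) auto
      then show ?thesis using False by (simp add: algebra_simps)
    qed
  qed (auto simp: a_def)
qed

text \<open>The Picard operator is a contraction in the norm weighted by \<open>exp (- 2 L \<bar>t\<bar>)\<close>; this gives the
  solution on the whole line in one step.\<close>

lemma lipschitz_ode_global_solution:
  fixes F :: "'a::banach \<Rightarrow> 'a"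
  assumes lip: "L-lipschitz_on UNIV F" and L: "0 < L"
  shows "\<exists>x. x 0 = x0 \<and> (\<forall>t. (x has_vector_derivative F (x t)) (at t))"
proof -
  \<comment> \<open>The contraction factor will be \<open>L / k = 1/2\<close>.\<close>
  define k where "k = 2 * L"
  have k: "0 < k" using L by (simp add: k_def)
  have lipD: "norm (F p - F q) \<le> L * norm (p - q)" for p q
    using lipschitz_onD[OF lip, of p q] by (simp add: dist_norm)
  have contF: "continuous_on UNIV F" using lip by (rule lipschitz_on_continuous_on)
  \<comment> \<open>The unknown is \<open>g t = exp (- k |t|) (x t - x0)\<close>, bounded although
    \<open>x\<close> need not be; \<open>E g\<close> is then \<open>F\<close> along the curve
    \<open>x\<close>.\<close>
  define E where "E g s = F (x0 + exp (k * \<bar>s\<bar>) *\<^sub>R apply_bcontfun g s)" for g s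
  define J where "J g t = integral {0..t} (E g) - integral {t..0} (E g)" for g t
  have contE: "continuous_on UNIV (E g)" for g
    unfolding E_def by (intro continuous_on_compose2[OF contF] continuous_intros) auto
  have dJ: "(J g has_vector_derivative E g t) (at t)" for g t
    unfolding J_def[abs_def] by (rule has_antiderivative_of_continuous[OF contE])
  have J0: "J g 0 = 0" for g by (simp add: J_def)
  have contJ: "continuous_on UNIV (J g)" for g
    using dJ by (meson continuous_at_imp_continuous_on has_vector_derivative_continuous)
  have boundE: "norm (E g s) \<le> norm (F x0) + L * norm g * exp (k * \<bar>s\<bar>)" for g s
  proof -
    have "norm (E g s) \<le> norm (F x0) + norm (E g s - F x0)" by (metis norm_triangle_sub)
    also have "norm (E g s - F x0) \<le> L * (exp (k * \<bar>s\<bar>) * norm (apply_bcontfun g s))"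
      unfolding E_def using lipD[of _ x0] by (rule order_trans) simp
    also have "\<dots> \<le> L * (exp (k * \<bar>s\<bar>) * norm g)"
      using L by (intro mult_left_mono norm_bounded) auto
    finally show ?thesis by (simp add: mult_ac)
  qed
  have boundJ: "norm (J g t) \<le> norm (F x0) * \<bar>t\<bar> + L * norm g * exp (k * \<bar>t\<bar>) / k" for g t
    using L by (intro norm_le_of_exp_derivative_bound[OF dJ J0 k boundE]) auto
  define T where "T g t = exp (- (k * \<bar>t\<bar>)) *\<^sub>R J g t" for g t
  have Tbc: "T g \<in> bcontfun" for g
  proof (rule bcontfun_normI)
    show "continuous_on UNIV (T g)" unfolding T_def[abs_def] by (intro continuous_intros contJ)
    fix t
    have "norm (T g t) \<le> exp (- (k * \<bar>t\<bar>)) * (norm (F x0) * \<bar>t\<bar> + L * norm g * exp (k * \<bar>t\<bar>) / k)"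
      unfolding T_def by (simp add: boundJ)
    also have "\<dots> = norm (F x0) * (\<bar>t\<bar> * exp (- (k * \<bar>t\<bar>))) + L * norm g / k"
      by (simp add: algebra_simps exp_minus divide_simps)
    also have "\<bar>t\<bar> * exp (- (k * \<bar>t\<bar>)) \<le> 1 / k"
    proof -
      have "k * \<bar>t\<bar> \<le> exp (k * \<bar>t\<bar>)" using exp_ge_add_one_self[of "k * \<bar>t\<bar>"] by linarith
      then show ?thesis using k by (simp add: exp_minus field_simps)
    qed
    finally show "norm (T g t) \<le> norm (F x0) * (1 / k) + L * norm g / k"
      by (simp add: mult_left_mono)
  qed
  have contr: "dist (Bcontfun (T g)) (Bcontfun (T h)) \<le> 1/2 * dist g h" for g h
  proof (rule dist_bound)
    fix t
    have d: "((\<lambda>t. J g t - J h t) has_vector_derivative E g t - E h t) (at t)" for t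
      by (intro derivative_intros dJ)
    have "norm (J g t - J h t) \<le> 0 * \<bar>t\<bar> + L * dist g h * exp (k * \<bar>t\<bar>) / k"
    proof (rule norm_le_of_exp_derivative_bound[OF d _ k])
      fix s
      have "norm (E g s - E h s) \<le> L * (exp (k * \<bar>s\<bar>) * norm (apply_bcontfun g s - apply_bcontfun h s))"
        unfolding E_def by (rule order_trans[OF lipD]) (simp add: scaleR_diff_right[symmetric])
      also have "\<dots> \<le> L * (exp (k * \<bar>s\<bar>) * dist g h)"
        using L dist_bounded[of g s h] by (intro mult_left_mono) (auto simp: dist_norm)
      finally show "norm (E g s - E h s) \<le> 0 + L * dist g h * exp (k * \<bar>s\<bar>)" by (simp add: mult_ac)
    qed (use L in \<open>auto simp: J0\<close>)
    then have "exp (- (k * \<bar>t\<bar>)) * norm (J g t - J h t) \<le> exp (- (k * \<bar>t\<bar>)) * (L * dist g h * exp (k * \<bar>t\<bar>) / k)"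
      by (intro mult_left_mono) auto
    also have "\<dots> = 1/2 * dist g h" using L by (simp add: exp_minus k_def field_simps)
    finally show "dist (apply_bcontfun (Bcontfun (T g)) t) (apply_bcontfun (Bcontfun (T h)) t) \<le> 1/2 * dist g h"
      unfolding Bcontfun_inverse[OF Tbc] T_def dist_norm by (simp add: scaleR_diff_right[symmetric])
  qed
  have "\<exists>!g. Bcontfun (T g) = g" by (rule banach_fix_type[of "1/2"]) (use contr in auto)
  then obtain g where "Bcontfun (T g) = g" by blast
  then have g: "apply_bcontfun g t = T g t" for t using Bcontfun_inverse[OF Tbc, of g] by simp
  define x where "x t = x0 + J g t" for t
  have "E g t = F (x t)" for t
    unfolding E_def x_def g T_def by (simp add: exp_minus)
  then have "(x has_vector_derivative F (x t)) (at t)" for t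
    unfolding x_def[abs_def] using dJ[of g t] by (auto intro!: derivative_eq_intros)
  moreover have "x 0 = x0" by (simp add: x_def J0)
  ultimately show ?thesis by blast
qed

text \<open>Gronwall: \<open>exp (- 2 L t)\<close> times the squared distance is nonincreasing. The
  square, an inner product, avoids differentiating the norm at 0.\<close>

lemma lipschitz_ode_dist:
  fixes F :: "'a::real_inner \<Rightarrow> 'a"
  assumes lip: "L-lipschitz_on UNIV F" and ab: "a \<le> b"
    and x: "\<And>t. t \<in> {a..b} \<Longrightarrow> (x has_vector_derivative F (x t)) (at t)"
    and y: "\<And>t. t \<in> {a..b} \<Longrightarrow> (y has_vector_derivative F (y t)) (at t)"
  shows "norm (x b - y b) \<le> exp (L * (b - a)) * norm (x a - y a)"
proof -
  have L: "0 \<le> L" by (rule lipschitz_on_nonneg[OF lip])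
  define u where "u t = (x t - y t) \<bullet> (x t - y t)" for t
  have "- (exp (- (2 * L * a)) * u a) \<le> - (exp (- (2 * L * b)) * u b)"
  proof (rule deriv_nonneg_imp_le[OF ab, of "\<lambda>t. - (exp (- (2 * L * t)) * u t)"])
    fix t assume "a \<le> t" "t \<le> b"
    then have t: "t \<in> {a..b}" by simp
    have d: "((\<lambda>t. x t - y t) has_vector_derivative F (x t) - F (y t)) (at t)"
      by (intro has_vector_derivative_diff x y t)
    have du: "(u has_real_derivative 2 * ((x t - y t) \<bullet> (F (x t) - F (y t)))) (at t)"
      unfolding u_def[abs_def] has_real_derivative_iff_has_vector_derivative
      using bounded_bilinear.has_vector_derivative[OF bounded_bilinear_inner d d]
      by (simp add: inner_commute)
    show "((\<lambda>t. - (exp (- (2 * L * t)) * u t)) has_real_derivative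
        exp (- (2 * L * t)) * (2 * L * u t - 2 * ((x t - y t) \<bullet> (F (x t) - F (y t))))) (at t)"
      by (auto intro!: derivative_eq_intros du simp: algebra_simps)
    have "(x t - y t) \<bullet> (F (x t) - F (y t)) \<le> norm (x t - y t) * norm (F (x t) - F (y t))"
      by (rule norm_cauchy_schwarz)
    also have "\<dots> \<le> norm (x t - y t) * (L * norm (x t - y t))"
      using lipschitz_onD[OF lip, of "x t" "y t"] by (intro mult_left_mono) (auto simp: dist_norm)
    also have "\<dots> = L * u t" by (simp add: u_def dot_square_norm power2_eq_square)
    finally show "0 \<le> exp (- (2 * L * t)) * (2 * L * u t - 2 * ((x t - y t) \<bullet> (F (x t) - F (y t))))" by simp
  qed
  then have "exp (2 * L * b) * (exp (- (2 * L * b)) * u b) \<le> exp (2 * L * b) * (exp (- (2 * L * a)) * u a)"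
    by (intro mult_left_mono) auto
  then have "u b \<le> exp (2 * L * b) * exp (- (2 * L * a)) * u a"
    by (simp add: mult.assoc[symmetric] exp_add[symmetric])
  also have "\<dots> = (exp (L * (b - a)))^2 * u a"
    by (simp add: exp_add[symmetric] power2_eq_square algebra_simps)
  finally have "(norm (x b - y b))^2 \<le> (exp (L * (b - a)) * norm (x a - y a))^2"
    by (simp add: u_def dot_square_norm power_mult_distrib)
  then show ?thesis by (rule power2_le_imp_le) simp
qed

text \<open>Meaningful for globally Lipschitz fields, where existence gives
  \<open>flow_props\<close> and uniqueness gives \<open>flow_eq\<close>.\<close>

definition flow :: "('a::real_normed_vector \<Rightarrow> 'a) \<Rightarrow> 'a \<Rightarrow> real \<Rightarrow> 'a" where
  "flow F x0 = (SOME x. x 0 = x0 \<and> (\<forall>t. (x has_vector_derivative F (x t)) (at t)))"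

lemma flow_props:
  fixes F :: "'a::banach \<Rightarrow> 'a"
  assumes "L-lipschitz_on UNIV F" "0 < L"
  shows "flow F x0 0 = x0" "(flow F x0 has_vector_derivative F (flow F x0 t)) (at t)"
  using someI_ex[OF lipschitz_ode_global_solution[OF assms, of x0]] by (auto simp: flow_def)

lemma flow_eq:
  fixes F :: "'a::euclidean_space \<Rightarrow> 'a"
  assumes lip: "L-lipschitz_on UNIV F" "0 < L" and "0 \<le> t"
    and x: "\<And>s. s \<in> {a..a+t} \<Longrightarrow> (x has_vector_derivative F (x s)) (at s)"
  shows "x (a + t) = flow F (x a) t"
proof -
  have "norm (x (a + t) - flow F (x a) t) \<le> exp (L * (t - 0)) * norm (x (a + 0) - flow F (x a) 0)"
  proof (rule lipschitz_ode_dist[OF lip(1) \<open>0 \<le> t\<close>, of "\<lambda>s. x (a + s)"])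
    fix s assume s: "s \<in> {0..t}"
    have "((x \<circ> (\<lambda>s. a + s)) has_vector_derivative 1 *\<^sub>R F (x (a + s))) (at s)"
      by (rule vector_diff_chain_at) (use s in \<open>auto intro!: derivative_eq_intros x\<close>)
    then show "((\<lambda>s. x (a + s)) has_vector_derivative F (x (a + s))) (at s)" by (simp add: o_def)
  qed (rule flow_props[OF lip])
  then show ?thesis by (simp add: flow_props[OF lip])
qed

lemma lipschitz_ode_dist_abs:
  fixes F :: "'a::real_inner \<Rightarrow> 'a"
  assumes lip: "L-lipschitz_on UNIV F"
    and x: "\<And>t. (x has_vector_derivative F (x t)) (at t)"
    and y: "\<And>t. (y has_vector_derivative F (y t)) (at t)"
  shows "norm (x t - y t) \<le> exp (L * \<bar>t\<bar>) * norm (x 0 - y 0)"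
proof (cases "0 \<le> t")
  case True
  then show ?thesis using lipschitz_ode_dist[OF lip True x y] by simp
next
  case False
  have lip': "L-lipschitz_on UNIV (\<lambda>x. - F x)" using lip by (rule lipschitz_on_minus)
  have r: "((\<lambda>s. x (- s)) has_vector_derivative - F (x (- s))) (at s)"
    if x: "\<And>t. (x has_vector_derivative F (x t)) (at t)" for x s
  proof -
    have "((x \<circ> uminus) has_vector_derivative - 1 *\<^sub>R F (x (- s))) (at s)"
      by (rule vector_diff_chain_at) (auto intro!: derivative_eq_intros x)
    then show ?thesis by (simp add: o_def)
  qed
  show ?thesis using lipschitz_ode_dist[OF lip' _ r[OF x] r[OF y], of 0 "- t"] False by simp
qed

lemma flow_lipschitz:
  fixes F :: "'a::euclidean_space \<Rightarrow> 'a"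
  assumes lip: "L-lipschitz_on UNIV F" "0 < L"
  shows "norm (flow F p t - flow F q t) \<le> exp (L * \<bar>t\<bar>) * norm (p - q)"
  using lipschitz_ode_dist_abs[OF lip(1) flow_props(2)[OF lip] flow_props(2)[OF lip], of p t q]
  by (simp add: flow_props[OF lip])

lemma flow_add:
  fixes F :: "'a::euclidean_space \<Rightarrow> 'a"
  assumes lip: "L-lipschitz_on UNIV F" "0 < L"
  shows "flow F (flow F p a) t = flow F p (a + t)"
proof -
  have "((\<lambda>s. flow F p (a + s)) has_vector_derivative F (flow F p (a + s))) (at s)" for s
  proof -
    have "((flow F p \<circ> (\<lambda>s. a + s)) has_vector_derivative 1 *\<^sub>R F (flow F p (a + s))) (at s)"
      by (rule vector_diff_chain_at) (auto intro!: derivative_eq_intros flow_props[OF lip])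
    then show ?thesis by (simp add: o_def)
  qed
  from lipschitz_ode_dist_abs[OF lip(1) flow_props(2)[OF lip] this, of "flow F p a" t]
  show ?thesis by (simp add: flow_props[OF lip])
qed

lemma flow_minus:
  fixes F :: "'a::euclidean_space \<Rightarrow> 'a"
  assumes lip: "L-lipschitz_on UNIV F" "0 < L" and odd: "\<And>x. F (- x) = - F x"
  shows "flow F (- p) t = - flow F p t"
proof -
  have "((\<lambda>s. - flow F p s) has_vector_derivative F (- flow F p s)) (at s)" for s
    unfolding odd by (intro has_vector_derivative_minus flow_props[OF lip])
  from lipschitz_ode_dist_abs[OF lip(1) flow_props(2)[OF lip] this, of "- p" t]
  show ?thesis by (simp add: flow_props[OF lip] eq_neg_iff_add_eq_0)
qed

lemma isCont_flow:
  fixes F :: "'a::banach \<Rightarrow> 'a"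
  assumes "L-lipschitz_on UNIV F" "0 < L"
  shows "isCont (flow F p) t"
  using flow_props(2)[OF assms] by (rule has_vector_derivative_continuous)

lemma tendsto_flow:
  fixes F :: "'a::euclidean_space \<Rightarrow> 'a"
  assumes lip: "L-lipschitz_on UNIV F" "0 < L" and p: "(p \<longlongrightarrow> q) G"
  shows "((\<lambda>n. flow F (p n) t) \<longlongrightarrow> flow F q t) G"
proof -
  have "((\<lambda>n. exp (L * \<bar>t\<bar>) * norm (p n - q)) \<longlongrightarrow> exp (L * \<bar>t\<bar>) * norm (q - q)) G"
    by (intro tendsto_intros p)
  then have "((\<lambda>n. exp (L * \<bar>t\<bar>) * norm (p n - q)) \<longlongrightarrow> 0) G" by simp
  then have "((\<lambda>n. flow F (p n) t - flow F q t) \<longlongrightarrow> 0) G"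
    by (rule Lim_null_comparison[rotated]) (intro always_eventually allI flow_lipschitz[OF lip])
  then show ?thesis by (rule LIM_zero_cancel)
qed

section \<open>Truncation of the vector field\<close>

definition clamp_abs :: "real \<Rightarrow> real \<Rightarrow> real" where
  "clamp_abs R x = max (- R) (min R x)"

lemma abs_clamp_abs_le: "0 \<le> R \<Longrightarrow> \<bar>clamp_abs R a\<bar> \<le> R"
  by (simp add: clamp_abs_def abs_le_iff)

lemma abs_clamp_abs_diff_le: "\<bar>clamp_abs R a - clamp_abs R b\<bar> \<le> \<bar>a - b\<bar>"
  unfolding clamp_abs_def by (smt (verit))

text \<open>Clamping \<open>v\<close>, \<open>y\<close>, \<open>z\<close> in the last component
  suffices for a global Lipschitz bound: \<phi> occurs there only through sine and cosine, and the
  other components are linear. Clamping is odd, so the symmetry under change of sign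
  survives.\<close>

definition truncated_field :: "real \<Rightarrow> real^4 \<Rightarrow> real^4" where
  "truncated_field R x = vector [x $ 2, x $ 3, x $ 4,
     autonomous_rhs (x $ 1) (clamp_abs R (x $ 2)) (clamp_abs R (x $ 3)) (clamp_abs R (x $ 4))]"

text \<open>Boundedness is included because Lipschitz functions alone are not closed under
  products.\<close>

definition bounded_lipschitz :: "('a::real_normed_vector \<Rightarrow> real) \<Rightarrow> bool" where
  "bounded_lipschitz f \<longleftrightarrow> (\<exists>B L. (\<forall>x. \<bar>f x\<bar> \<le> B) \<and> (\<forall>x y. \<bar>f x - f y\<bar> \<le> L * norm (x - y)))"

lemma bounded_lipschitz_const: "bounded_lipschitz (\<lambda>x. c)"
  unfolding bounded_lipschitz_def by (intro exI[of _ "\<bar>c\<bar>"] exI[of _ 0]) simp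

lemma bounded_lipschitz_add:
  assumes "bounded_lipschitz f" "bounded_lipschitz g"
  shows "bounded_lipschitz (\<lambda>x. f x + g x)"
proof -
  from assms obtain B1 L1 B2 L2 where
    "\<And>x. \<bar>f x\<bar> \<le> B1" "\<And>x y. \<bar>f x - f y\<bar> \<le> L1 * norm (x - y)"
    "\<And>x. \<bar>g x\<bar> \<le> B2" "\<And>x y. \<bar>g x - g y\<bar> \<le> L2 * norm (x - y)"
    unfolding bounded_lipschitz_def by blast
  note * = this
  show ?thesis unfolding bounded_lipschitz_def
  proof (rule exI[of _ "B1 + B2"], rule exI[of _ "L1 + L2"], intro conjI allI)
    fix x y
    show "\<bar>f x + g x\<bar> \<le> B1 + B2" using *(1)[of x] *(3)[of x] by linarith
    show "\<bar>f x + g x - (f y + g y)\<bar> \<le> (L1 + L2) * norm (x - y)"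
      using *(2)[of x y] *(4)[of x y] unfolding distrib_right by linarith
  qed
qed

lemma bounded_lipschitz_mult:
  assumes "bounded_lipschitz f" "bounded_lipschitz g"
  shows "bounded_lipschitz (\<lambda>x. f x * g x)"
proof -
  from assms obtain B1 L1 B2 L2 where
    "\<And>x. \<bar>f x\<bar> \<le> B1" "\<And>x y. \<bar>f x - f y\<bar> \<le> L1 * norm (x - y)"
    "\<And>x. \<bar>g x\<bar> \<le> B2" "\<And>x y. \<bar>g x - g y\<bar> \<le> L2 * norm (x - y)"
    unfolding bounded_lipschitz_def by blast
  note * = this
  show ?thesis unfolding bounded_lipschitz_def
  proof (rule exI[of _ "B1 * B2"], rule exI[of _ "B1 * L2 + L1 * B2"], intro conjI allI)
    fix x y
    show "\<bar>f x * g x\<bar> \<le> B1 * B2" by (rule abs_le_mult[OF *(1,3)])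
    show "\<bar>f x * g x - f y * g y\<bar> \<le> (B1 * L2 + L1 * B2) * norm (x - y)"
    proof -
      have "f x * g x - f y * g y = f x * (g x - g y) + (f x - f y) * g y" by (simp add: algebra_simps)
      moreover have "\<bar>f x * (g x - g y)\<bar> \<le> B1 * (L2 * norm (x - y))" by (rule abs_le_mult[OF *(1,4)])
      moreover have "\<bar>(f x - f y) * g y\<bar> \<le> L1 * norm (x - y) * B2" by (rule abs_le_mult[OF *(2,3)])
      moreover have "B1 * (L2 * norm (x - y)) + L1 * norm (x - y) * B2 = (B1 * L2 + L1 * B2) * norm (x - y)"
        by (simp add: algebra_simps)
      ultimately show ?thesis by linarith
    qed
  qed
qed

lemma bounded_lipschitz_diff:
  assumes "bounded_lipschitz f" "bounded_lipschitz g"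
  shows "bounded_lipschitz (\<lambda>x. f x - g x)"
  using bounded_lipschitz_add[OF assms(1) bounded_lipschitz_mult[OF bounded_lipschitz_const[of "-1"] assms(2)]] by simp

lemma bounded_lipschitz_power: "bounded_lipschitz f \<Longrightarrow> bounded_lipschitz (\<lambda>x. f x ^ n)"
  by (induction n) (auto intro: bounded_lipschitz_const bounded_lipschitz_mult)

lemma bounded_lipschitz_compose_component:
  fixes i :: "'n::finite"
  assumes "\<And>a. \<bar>f a\<bar> \<le> B" "\<And>a b. \<bar>f a - f b\<bar> \<le> L * \<bar>a - b\<bar>" "0 \<le> L"
  shows "bounded_lipschitz (\<lambda>x::real^'n. f (x $ i))"
  unfolding bounded_lipschitz_def
proof (rule exI[of _ B], rule exI[of _ L], intro conjI allI)
  fix x y :: "real^'n"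
  show "\<bar>f (x $ i)\<bar> \<le> B" by (rule assms)
  have "L * \<bar>x $ i - y $ i\<bar> \<le> L * norm (x - y)"
    using component_le_norm_cart[of "x - y" i] assms(3) by (intro mult_left_mono) auto
  then show "\<bar>f (x $ i) - f (y $ i)\<bar> \<le> L * norm (x - y)" using assms(2) by (rule order_trans[rotated])
qed

lemma abs_sin_diff_le: "\<bar>sin (2 * a) - sin (2 * b)\<bar> \<le> 2 * \<bar>a - b\<bar>" for a b :: real
proof -
  have "norm (sin (2 * a) - sin (2 * b)) \<le> 2 * norm (a - b)"
    by (rule field_differentiable_bound[of UNIV "\<lambda>x. sin (2 * x)" "\<lambda>x. cos (2 * x) * 2"])
       (auto intro!: derivative_eq_intros simp: abs_mult)
  then show ?thesis by simp
qed

lemma abs_cos_diff_le: "\<bar>cos (2 * a) - cos (2 * b)\<bar> \<le> 2 * \<bar>a - b\<bar>" for a b :: real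
proof -
  have "norm (cos (2 * a) - cos (2 * b)) \<le> 2 * norm (a - b)"
    by (rule field_differentiable_bound[of UNIV "\<lambda>x. cos (2 * x)" "\<lambda>x. - sin (2 * x) * 2"])
       (auto intro!: derivative_eq_intros simp: abs_mult)
  then show ?thesis by simp
qed

lemma bounded_lipschitz_truncated_rhs:
  assumes R: "0 \<le> R"
  shows "bounded_lipschitz (\<lambda>x::real^4. autonomous_rhs (x $ 1) (clamp_abs R (x $ 2)) (clamp_abs R (x $ 3)) (clamp_abs R (x $ 4)))"
proof -
  have clamp: "bounded_lipschitz (\<lambda>x::real^4. clamp_abs R (x $ i))" for i
    by (rule bounded_lipschitz_compose_component[where f = "clamp_abs R" and B = R and L = 1])
       (use abs_clamp_abs_le[OF R] abs_clamp_abs_diff_le in auto)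
  have sin: "bounded_lipschitz (\<lambda>x::real^4. sin (2 * x $ i))" for i
    by (rule bounded_lipschitz_compose_component[where f = "\<lambda>a. sin (2 * a)" and B = 1 and L = 2])
       (simp_all add: abs_sin_diff_le)
  have cos: "bounded_lipschitz (\<lambda>x::real^4. cos (2 * x $ i))" for i
    by (rule bounded_lipschitz_compose_component[where f = "\<lambda>a. cos (2 * a)" and B = 1 and L = 2])
       (simp_all add: abs_cos_diff_le)
  show ?thesis
    unfolding autonomous_rhs_def
    by (intro bounded_lipschitz_add bounded_lipschitz_diff bounded_lipschitz_mult bounded_lipschitz_power
        clamp sin cos bounded_lipschitz_const)
qed

lemma truncated_field_lipschitz:
  assumes R: "0 \<le> R"
  shows "\<exists>L>0. L-lipschitz_on UNIV (truncated_field R)"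
proof -
  define g where "g x = autonomous_rhs (x $ 1) (clamp_abs R (x $ 2)) (clamp_abs R (x $ 3)) (clamp_abs R (x $ 4))"
    for x :: "real^4"
  have "bounded_lipschitz g"
    unfolding g_def[abs_def] by (rule bounded_lipschitz_truncated_rhs[OF R])
  then obtain K where K: "\<And>x y. \<bar>g x - g y\<bar> \<le> K * norm (x - y)"
    unfolding bounded_lipschitz_def by blast
  have lip: "(3 + \<bar>K\<bar>)-lipschitz_on UNIV (truncated_field R)"
  proof (rule lipschitz_onI)
    fix x y :: "real^4"
    have c: "\<bar>x $ i - y $ i\<bar> \<le> norm (x - y)" for i using component_le_norm_cart[of "x - y" i] by simp
    have "K * norm (x - y) \<le> \<bar>K\<bar> * norm (x - y)" by (intro mult_right_mono) auto
    then have gK: "\<bar>g x - g y\<bar> \<le> \<bar>K\<bar> * norm (x - y)" using K[of x y] by linarith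
    have "norm (truncated_field R x - truncated_field R y) \<le>
        (\<Sum>i\<in>UNIV. \<bar>(truncated_field R x - truncated_field R y) $ i\<bar>)" by (rule norm_le_l1_cart)
    also have "\<dots> = \<bar>x $ 2 - y $ 2\<bar> + \<bar>x $ 3 - y $ 3\<bar> + \<bar>x $ 4 - y $ 4\<bar> + \<bar>g x - g y\<bar>"
      unfolding sum_4 by (simp add: truncated_field_def g_def[symmetric])
    also have "\<dots> \<le> 3 * norm (x - y) + \<bar>K\<bar> * norm (x - y)" using c[of 2] c[of 3] c[of 4] gK by linarith
    finally show "dist (truncated_field R x) (truncated_field R y) \<le> (3 + \<bar>K\<bar>) * dist x y"
      by (simp add: dist_norm distrib_right)
  qed simp
  have "0 < 3 + \<bar>K\<bar>" by simp
  with lip show ?thesis by (intro exI conjI)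
qed

lemma truncated_field_minus: "truncated_field R (- x) = - truncated_field R x" if "0 \<le> R"
proof -
  have "clamp_abs R (- a) = - clamp_abs R a" for a using that by (auto simp: clamp_abs_def max_def min_def)
  then show ?thesis by (simp add: vec_eq_iff forall_4 truncated_field_def autonomous_rhs_minus)
qed

lemma truncated_field_eq:
  assumes "\<bar>x $ 2\<bar> \<le> R" "\<bar>x $ 3\<bar> \<le> R" "\<bar>x $ 4\<bar> \<le> R"
  shows "truncated_field R x = autonomous_field x"
  using assms by (simp add: truncated_field_def autonomous_field_def clamp_abs_def)

abbreviation solution_curve_on :: "real set \<Rightarrow> (real \<Rightarrow> real^4) \<Rightarrow> bool" where
  "solution_curve_on S x \<equiv> solution_on S (\<lambda>s. x s $ 1) (\<lambda>s. x s $ 2) (\<lambda>s. x s $ 3) (\<lambda>s. x s $ 4)"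

lemma has_vector_derivative_vec_4:
  fixes x :: "real \<Rightarrow> real^4"
  shows "(x has_vector_derivative d) (at s) \<longleftrightarrow>
    ((\<lambda>s. x s $ 1) has_real_derivative d $ 1) (at s) \<and> ((\<lambda>s. x s $ 2) has_real_derivative d $ 2) (at s) \<and>
    ((\<lambda>s. x s $ 3) has_real_derivative d $ 3) (at s) \<and> ((\<lambda>s. x s $ 4) has_real_derivative d $ 4) (at s)"
proof -
  have "(x has_vector_derivative d) (at s) \<longleftrightarrow> (\<forall>i. ((\<lambda>s. x s $ i) has_vector_derivative d $ i) (at s))"
    unfolding has_vector_derivative_def has_derivative_componentwise_within[of x]
    by (auto simp: Basis_vec_def inner_axis)
  then show ?thesis by (simp add: forall_4 has_real_derivative_iff_has_vector_derivative)
qed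

lemma solution_curve_on_iff:
  "solution_curve_on S x \<longleftrightarrow> (\<forall>s\<in>S. (x has_vector_derivative autonomous_field (x s)) (at s))"
  by (simp add: solution_on_def has_vector_derivative_vec_4 autonomous_field_def)

section \<open>Entire solutions\<close>

lemma solution_curve_eq_flow:
  assumes lip: "L-lipschitz_on UNIV (truncated_field R)" "0 < L"
    and sol: "solution_curve_on {a..a+t} x" and t: "0 \<le> t"
    and bd: "\<And>s i. s \<in> {a..a+t} \<Longrightarrow> i \<noteq> 1 \<Longrightarrow> \<bar>x s $ i\<bar> \<le> R"
  shows "x (a + t) = flow (truncated_field R) (x a) t"
proof (rule flow_eq[OF lip t])
  fix s assume s: "s \<in> {a..a+t}"
  have "truncated_field R (x s) = autonomous_field (x s)"
    using bd[OF s, of 2] bd[OF s, of 3] bd[OF s, of 4] by (intro truncated_field_eq) auto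
  then show "(x has_vector_derivative truncated_field R (x s)) (at s)"
    using sol s by (simp add: solution_curve_on_iff)
qed

text \<open>Uniqueness is taken from a truncated flow whose radius exceeds the derivatives on the
  compact interval. By oddness the flow starting at 0 equals its own negative.\<close>

lemma solution_zero_unique:
  assumes sol: "solution_on {a..b} \<phi> v y z" and ab: "a \<le> b"
    and zero: "\<phi> a = 0" "v a = 0" "y a = 0" "z a = 0"
  shows "\<phi> b = 0"
proof -
  define x :: "real \<Rightarrow> real^4" where "x s = vector [\<phi> s, v s, y s, z s]" for s
  have solx: "solution_curve_on {a..b} x" using sol by (simp add: x_def)
  have "\<exists>B. \<forall>s\<in>{a..b}. \<bar>f s\<bar> \<le> B" if "\<And>s. s \<in> {a..b} \<Longrightarrow> isCont f s" for f :: "real \<Rightarrow> real"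
  proof -
    have "compact (f ` {a..b})"
      using that by (intro compact_continuous_image continuous_at_imp_continuous_on) auto
    then show ?thesis using compact_imp_bounded bounded_real by (metis imageI)
  qed
  note B = this[OF solution_on_isCont(2)[OF sol]] this[OF solution_on_isCont(3)[OF sol]]
    this[OF solution_on_isCont(4)[OF sol]]
  from B(1) obtain B2 where B2: "\<And>s. s \<in> {a..b} \<Longrightarrow> \<bar>v s\<bar> \<le> B2" by blast
  from B(2) obtain B3 where B3: "\<And>s. s \<in> {a..b} \<Longrightarrow> \<bar>y s\<bar> \<le> B3" by blast
  from B(3) obtain B4 where B4: "\<And>s. s \<in> {a..b} \<Longrightarrow> \<bar>z s\<bar> \<le> B4" by blast
  define R where "R = max B2 (max B3 B4)"
  have R: "\<bar>x s $ i\<bar> \<le> R" if "s \<in> {a..b}" "i \<noteq> 1" for s i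
    using B2[OF that(1)] B3[OF that(1)] B4[OF that(1)] exhaust_4[of i] that(2)
    by (auto simp: x_def R_def le_max_iff_disj)
  have R0: "0 \<le> R" using R[of a 2] ab by auto
  obtain L where L: "0 < L" "L-lipschitz_on UNIV (truncated_field R)" using truncated_field_lipschitz[OF R0] by blast
  have "x (a + (b - a)) = flow (truncated_field R) (x a) (b - a)"
    by (rule solution_curve_eq_flow[OF L(2,1)]) (use solx ab R in auto)
  moreover have "x a = 0" using zero by (simp add: x_def vec_eq_iff forall_4)
  moreover have "flow (truncated_field R) 0 (b - a) = 0"
    using flow_minus[OF L(2,1) truncated_field_minus[OF R0], of 0 "b - a"] by (simp add: vec_eq_iff)
  ultimately have "x b = 0" by simp
  then show ?thesis by (simp add: x_def vec_eq_iff forall_4)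
qed

section \<open>Decay at minus infinity\<close>

lemma small_derivative_points:
  fixes f v y :: "real \<Rightarrow> real"
  assumes f: "\<And>t. (f has_real_derivative v t) (at t)" and v: "\<And>t. (v has_real_derivative y t) (at t)"
    and d: "0 < d" and small: "\<And>t. t \<in> {a..a+3*d} \<Longrightarrow> \<bar>f t\<bar> \<le> e"
  shows "\<exists>p m. a \<le> p \<and> p \<le> m \<and> m \<le> a + 3 * d \<and> \<bar>y p\<bar> \<le> 4 * e / d^2 \<and> \<bar>v m\<bar> \<le> 2 * e / d"
proof -
  have pt: "\<exists>m. b < m \<and> m < b + d \<and> \<bar>v m\<bar> \<le> 2 * e / d" if "a \<le> b" "b + d \<le> a + 3 * d" for b
  proof -
    have "\<exists>m. b < m \<and> m < b + d \<and> f (b + d) - f b = (b + d - b) * v m"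
      by (rule MVT2) (use d f in auto)
    then obtain m where m: "b < m" "m < b + d" "f (b + d) - f b = d * v m" by auto
    have "\<bar>f (b + d)\<bar> \<le> e" "\<bar>f b\<bar> \<le> e" using that d by (auto intro!: small)
    then have "\<bar>d * v m\<bar> \<le> 2 * e" unfolding m(3)[symmetric] by linarith
    then show ?thesis using m d by (intro exI[of _ m]) (auto simp: abs_mult field_simps)
  qed
  \<comment> \<open>One point in the first third and one in the last are at least \<open>d\<close>
    apart, which bounds the quotient in the second mean value step.\<close>
  obtain m1 where m1: "a < m1" "m1 < a + d" "\<bar>v m1\<bar> \<le> 2 * e / d" using pt[of a] d by auto
  obtain m2 where m2: "a + 2 * d < m2" "m2 < a + 2 * d + d" "\<bar>v m2\<bar> \<le> 2 * e / d" using pt[of "a + 2 * d"] d by auto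
  have "\<exists>p. m1 < p \<and> p < m2 \<and> v m2 - v m1 = (m2 - m1) * y p"
    by (rule MVT2) (use d m1 m2 v in auto)
  then obtain p where p: "m1 < p" "p < m2" "v m2 - v m1 = (m2 - m1) * y p" by auto
  have "d * \<bar>y p\<bar> \<le> (m2 - m1) * \<bar>y p\<bar>" using m1 m2 by (intro mult_right_mono) auto
  also have "\<dots> = \<bar>(m2 - m1) * y p\<bar>" using m1 m2 d by (simp add: abs_mult)
  also have "\<dots> = \<bar>v m2 - v m1\<bar>" using p by simp
  also have "\<dots> \<le> 2 * e / d + 2 * e / d" using m1(3) m2(3) by linarith
  also have "\<dots> = 4 * e / d" by simp
  finally have "\<bar>y p\<bar> \<le> 4 * e / d / d" using d by (subst pos_le_divide_eq) (auto simp: mult.commute)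
  then have "\<bar>y p\<bar> \<le> 4 * e / d^2" by (simp add: power2_eq_square)
  then show ?thesis using p m1 m2 d by (intro exI[of _ p] exI[of _ m2]) auto
qed

text \<open>Towards minus infinity only the smallness of \<phi> is known. With
  \<open>d = 1/20\<close> the mean value points give \<open>40 e = 2 e / d\<close> for
  \<open>v\<close> and \<open>1600 e = 4 e / d^2\<close> for \<open>y\<close>. Between them the
  maximum \<open>Y\<close> of \<open>|y|\<close> bounds itself with factor
  \<open>6/5 * 3/10 < 1\<close>, the interval having length at most \<open>3/10\<close>. Finally
  \<open>520 = 40 + 3/10 * 1600\<close>.\<close>

lemma small_solution_small_derivatives:
  assumes sol: "solution_on UNIV \<phi> v y z"
    and small: "\<And>t. t \<in> {s-3/20..s+3/20} \<Longrightarrow> \<bar>\<phi> t\<bar> \<le> e"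
  shows "\<bar>v s\<bar> \<le> 520 * e" "\<bar>y s\<bar> \<le> 1600 * e"
proof -
  note D = solution_onD[OF sol UNIV_I]
  have e0: "0 \<le> e" using small[of s] by auto
  have s1: "\<bar>\<phi> t\<bar> \<le> e" if "t \<in> {s-3/20..s-3/20+3*(1/20)}" for t using that by (intro small) auto
  have s2: "\<bar>\<phi> t\<bar> \<le> e" if "t \<in> {s..s+3*(1/20)}" for t using that by (intro small) auto
  obtain p m where p: "s - 3/20 \<le> p" "p \<le> m" "m \<le> s" "\<bar>y p\<bar> \<le> 1600 * e" "\<bar>v m\<bar> \<le> 40 * e"
    using small_derivative_points[OF D(1,2), of "1/20" "s - 3/20" e, OF _ s1] by (auto simp: power2_eq_square)
  obtain q where q: "s \<le> q" "q \<le> s + 3/20" "\<bar>y q\<bar> \<le> 1600 * e"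
    using small_derivative_points[OF D(1,2), of "1/20" s e, OF _ s2] by (auto simp: power2_eq_square)
  have "continuous_on {p..q} (\<lambda>t. \<bar>y t\<bar>)"
    using D(3) by (intro continuous_intros continuous_at_imp_continuous_on ballI DERIV_isCont)
  then obtain t0 where t0: "t0 \<in> {p..q}" "\<And>t. t \<in> {p..q} \<Longrightarrow> \<bar>y t\<bar> \<le> \<bar>y t0\<bar>"
    using continuous_attains_sup[of "{p..q}" "\<lambda>t. \<bar>y t\<bar>"] p q by auto
  define Y where "Y = \<bar>y t0\<bar>"
  have vY: "\<bar>v u\<bar> \<le> 40 * e + 3/10 * Y" if u: "u \<in> {p..q}" for u
  proof -
    have "norm (v u - v m) \<le> Y * norm (u - m)"
      by (rule field_differentiable_bound[of "{p..q}" v y])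
         (use D(2) t0(2) u p q in \<open>auto simp: Y_def intro: has_field_derivative_at_within\<close>)
    also have "\<dots> \<le> Y * (3/10)"
    proof (rule mult_left_mono)
      have "p \<le> u" "u \<le> q" using u by auto
      then show "norm (u - m) \<le> 3/10" using p(1-3) q(1,2) unfolding real_norm_def by linarith
    qed (simp add: Y_def)
    finally have "\<bar>v u - v m\<bar> \<le> Y * (3/10)" by simp
    then show ?thesis using p(5) by linarith
  qed
  define M where "M = max (1600 * e) (24/5 * e + 6/5 * (40 * e + 3/10 * Y))"
  have "Y \<le> M" unfolding Y_def
  proof (rule solution_y_bound[of p q \<phi> v y z])
    fix t assume t: "t \<in> {p..q}"
    have "\<bar>sin (2 * \<phi> t)\<bar> \<le> \<bar>2 * \<phi> t\<bar>" by (rule abs_sin_x_le_abs_x)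
    also have "\<dots> \<le> 2 * e" using small[of t] t p q by auto
    finally have "12/5 * \<bar>sin (2 * \<phi> t)\<bar> + 6/5 * \<bar>v t\<bar> \<le> 24/5 * e + 6/5 * (40 * e + 3/10 * Y)"
      using vY[OF t] by (simp add: field_simps)
    then show "12/5 * \<bar>sin (2 * \<phi> t)\<bar> + 6/5 * \<bar>v t\<bar> \<le> M" unfolding M_def le_max_iff_disj by blast
  qed (use p q t0 in \<open>auto simp: M_def intro: solution_on_subset[OF sol]\<close>)
  then have "Y \<le> 1600 * e \<or> Y \<le> 24/5 * e + 6/5 * (40 * e + 3/10 * Y)" unfolding M_def le_max_iff_disj .
  then have Y: "Y \<le> 1600 * e" using e0 by (auto simp: field_simps)
  show "\<bar>y s\<bar> \<le> 1600 * e" using t0(2)[of s] p q Y by (auto simp: Y_def)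
  show "\<bar>v s\<bar> \<le> 520 * e" using vY[of s] p q Y by auto
qed

lemma solution_limits_at_bot:
  assumes sol: "solution_on UNIV \<phi> v y z" and lim: "(\<phi> \<longlongrightarrow> 0) at_bot"
  shows "(v \<longlongrightarrow> 0) at_bot" "(y \<longlongrightarrow> 0) at_bot" "(z \<longlongrightarrow> 0) at_bot"
proof -
  note D = solution_onD[OF sol UNIV_I]
  have ev: "eventually (\<lambda>s. \<bar>v s\<bar> \<le> 520 * e \<and> \<bar>y s\<bar> \<le> 1600 * e) at_bot" if "0 < e" for e
  proof -
    have "eventually (\<lambda>t. \<bar>\<phi> t\<bar> < e) at_bot" using tendstoD[OF lim that] by (simp add: dist_real_def)
    then obtain N where N: "\<And>t. t \<le> N \<Longrightarrow> \<bar>\<phi> t\<bar> < e" unfolding eventually_at_bot_linorder by blast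
    show ?thesis using eventually_le_at_bot[of "N - 1"]
    proof eventually_elim
      case (elim s)
      have "\<bar>\<phi> t\<bar> \<le> e" if "t \<in> {s-3/20..s+3/20}" for t
        by (rule less_imp_le, rule N) (use that elim in simp)
      from small_solution_small_derivatives[OF sol this] show ?case by (intro conjI)
    qed
  qed
  have "(f \<longlongrightarrow> 0) at_bot" if "f = v \<or> f = y" for f
  proof (rule tendstoI)
    fix e :: real assume "0 < e"
    then show "eventually (\<lambda>s. dist (f s) 0 < e) at_bot"
      using that by (intro eventually_mono[OF ev[of "e / 2000"]]) (auto simp: dist_real_def)
  qed
  then show v: "(v \<longlongrightarrow> 0) at_bot" and y: "(y \<longlongrightarrow> 0) at_bot" by blast+
  have "((\<lambda>t. force (\<phi> t) (v t) (y t)) \<longlongrightarrow> force 0 0 0) at_bot"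
    unfolding force_def by (intro tendsto_intros v y lim)
  then have f: "((\<lambda>t. force (\<phi> t) (v t) (y t)) \<longlongrightarrow> 0) at_bot" by (simp add: force_def)
  show "(z \<longlongrightarrow> 0) at_bot"
  proof (rule tendstoI)
    fix e :: real assume e: "0 < e"
    have "eventually (\<lambda>t. \<bar>force (\<phi> t) (v t) (y t)\<bar> < e / 4 \<and> \<bar>y t\<bar> < e / 4) at_bot"
      using tendstoD[OF f, of "e/4"] tendstoD[OF y, of "e/4"] e by (auto simp: dist_real_def intro: eventually_conj)
    then obtain N where N: "\<And>t. t \<le> N \<Longrightarrow> \<bar>force (\<phi> t) (v t) (y t)\<bar> < e / 4" "\<And>t. t \<le> N \<Longrightarrow> \<bar>y t\<bar> < e / 4"
      unfolding eventually_at_bot_linorder by blast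
    show "eventually (\<lambda>s. dist (z s) 0 < e) at_bot"
      using eventually_le_at_bot[of N]
    proof eventually_elim
      case (elim s)
      \<comment> \<open>A small value of \<open>z\<close> is found in the unit of time before
        \<open>s\<close>; the damping carries it forward.\<close>
      have "\<exists>p. s - 1 < p \<and> p < s \<and> y s - y (s - 1) = (s - (s - 1)) * z p"
        by (rule MVT2) (use D(3) in auto)
      then obtain p where p: "s - 1 < p" "p < s" "z p = y s - y (s - 1)" by auto
      have "\<bar>z s\<bar> \<le> \<bar>z p\<bar> + (e / 4) / 2"
      proof (rule solution_z_bound[of p s \<phi> v y z])
        fix t assume "t \<in> {p..s}"
        then show "\<bar>force (\<phi> t) (v t) (y t)\<bar> \<le> e / 4" using N(1)[of t] elim by simp
      qed (use p solution_on_subset[OF sol] in auto)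
      moreover have "\<bar>y s\<bar> < e / 4" "\<bar>y (s - 1)\<bar> < e / 4" using N(2)[of s] N(2)[of "s - 1"] elim by auto
      ultimately show ?case using p(3) unfolding dist_real_def by linarith
    qed
  qed
qed

text \<open>The energy comes from -6 and never decreases. If it were at most -6 at time
  \<open>s\<close>, its rate would vanish before \<open>s\<close>, the solution would rest at the
  origin there, and forward uniqueness would keep it there.\<close>

lemma nontrivial_energy_gt:
  assumes sol: "solution_on UNIV \<phi> v y z" and lim: "(\<phi> \<longlongrightarrow> 0) at_bot" and nz: "\<phi> s1 \<noteq> 0"
  shows "- 6 < energy (\<phi> s) (v s) (y s) (z s)"
proof (rule ccontr)
  let ?e = "\<lambda>t. energy (\<phi> t) (v t) (y t) (z t)"
  note D = solution_onD[OF sol UNIV_I]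
  assume "\<not> ?thesis"
  then have s: "?e s \<le> - 6" by simp
  have "(?e \<longlongrightarrow> energy 0 0 0 0) at_bot"
    unfolding energy_def kinetic_def by (intro tendsto_intros lim solution_limits_at_bot[OF sol lim]) simp
  then have elim: "(?e \<longlongrightarrow> - 6) at_bot" by (simp add: energy_def kinetic_def)
  have mono: "?e u \<le> ?e t" if "u \<le> t" for u t by (rule energy_mono[OF sol]) (use that in auto)
  have ge: "- 6 \<le> ?e t" for t
  proof (rule tendsto_upperbound[OF elim])
    show "eventually (\<lambda>u. ?e u \<le> ?e t) at_bot"
      using eventually_le_at_bot[of t] by eventually_elim (rule mono)
  qed simp
  have const: "?e t = - 6" if "t \<in> {..<s}" for t using ge[of t] mono[of t s] s that by auto
  have rate: "energy_rate (\<phi> t) (v t) (y t) = 0" if t: "t \<in> {..<s}" for t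
  proof (rule DERIV_unique)
    show "(?e has_real_derivative energy_rate (\<phi> t) (v t) (y t)) (at t)"
      by (rule has_real_derivative_energy[OF sol UNIV_I])
    show "(?e has_real_derivative 0) (at t)"
      by (rule has_field_derivative_transform_within_open[OF DERIV_const[of "- 6"] _ t]) (use const in auto)
  qed
  have vy: "v t = 0" "y t = 0" if "t \<in> {..<s}" for t
  proof -
    have "2 * (y t)^2 + 6 * (v t)^2 \<le> 0" using energy_rate_ge[of "y t" "v t" "\<phi> t"] rate[OF that] by simp
    then have "(y t)^2 = 0" "(v t)^2 = 0" using zero_le_power2[of "y t"] zero_le_power2[of "v t"] by linarith+
    then show "v t = 0" "y t = 0" by simp_all
  qed
  have z: "z t = 0" if t: "t \<in> {..<s}" for t
  proof (rule DERIV_unique[OF D(3)])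
    show "(y has_real_derivative 0) (at t)"
      by (rule has_field_derivative_transform_within_open[OF DERIV_const[of 0] _ t]) (use vy in auto)
  qed
  have phi: "\<phi> t = 0" if t: "t \<in> {..<s}" for t
  proof -
    have "\<phi> u = \<phi> t" if u: "u \<le> t" for u
    proof -
      have v0: "v w = 0" if "w \<le> t" for w using vy(1)[of w] that t by simp
      have "\<phi> u \<le> \<phi> t" by (rule deriv_nonneg_imp_le[OF u D(1)]) (simp add: v0)
      moreover have "- \<phi> u \<le> - \<phi> t"
        by (rule deriv_nonneg_imp_le[OF u DERIV_minus[OF D(1)]]) (simp add: v0)
      ultimately show ?thesis by simp
    qed
    then have "eventually (\<lambda>u. \<phi> u = \<phi> t) at_bot"
      by (rule eventually_mono[OF eventually_le_at_bot[of t]])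
    then have "(\<phi> \<longlongrightarrow> \<phi> t) at_bot" by (rule tendsto_eventually)
    then show ?thesis using tendsto_unique[OF _ lim] by auto
  qed
  \<comment> \<open>Uniqueness is applied forward in time, so the resting time has to precede
    \<open>s1\<close> as well.\<close>
  define t where "t = min (s - 1) s1"
  have t: "t \<in> {..<s}" "t \<le> s1" by (auto simp: t_def)
  have "\<phi> s1 = 0"
    by (rule solution_zero_unique[OF solution_on_subset[OF sol subset_UNIV] t(2) phi[OF t(1)] vy(1)[OF t(1)] vy(2)[OF t(1)] z[OF t(1)]])
  then show False using nz by simp
qed

lemma entire_solution_heteroclinic:
  assumes sol: "solution_on UNIV \<phi> v y z" and lim: "(\<phi> \<longlongrightarrow> 0) at_bot" and nz: "\<phi> s1 \<noteq> 0"
  shows "(\<phi> \<longlongrightarrow> pi / 2) at_top \<or> (\<phi> \<longlongrightarrow> - pi / 2) at_top"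
proof -
  let ?e = "\<lambda>t. energy (\<phi> t) (v t) (y t) (z t)"
  have sols: "solution_on {a..} \<phi> v y z" for a using sol by (rule solution_on_subset) simp
  note lims = solution_limits_at_top[OF sols[of 0]]
  obtain k :: int where k: "(\<phi> \<longlongrightarrow> of_int k * pi / 2) at_top" using lims(4) by blast
  have gt: "- 6 < ?e s" for s by (rule nontrivial_energy_gt[OF sol lim nz])
  have "((\<lambda>t. kinetic (\<phi> t) (v t) (y t) (z t)) \<longlongrightarrow> kinetic (of_int k * pi / 2) 0 0 0) at_top"
    unfolding kinetic_def by (intro tendsto_intros lims k) auto
  then have kin: "((\<lambda>t. kinetic (\<phi> t) (v t) (y t) (z t)) \<longlongrightarrow> 0) at_top" by (simp add: kinetic_def)
  have "(?e \<longlongrightarrow> 0 - 6 * cos (2 * (of_int k * pi / 2))) at_top"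
    unfolding energy_def by (intro tendsto_intros kin k)
  then have e: "(?e \<longlongrightarrow> - 6 * cos (of_int k * pi)) at_top" by simp
  have "odd k"
  proof
    assume "even k"
    then have "cos (of_int k * pi) = 1"
      by (metis cos_int_times_real cos_npi_int mult.commute)
    then have "(?e \<longlongrightarrow> - 6) at_top" using e by simp
    moreover have "eventually (\<lambda>t. ?e 0 \<le> ?e t) at_top"
      using eventually_ge_at_top[of 0] by eventually_elim (use energy_mono[OF sol] in auto)
    ultimately have "?e 0 \<le> - 6" by (intro tendsto_lowerbound[of ?e]) auto
    then show False using gt[of 0] by simp
  qed
  have ne_pi: "\<phi> s \<noteq> pi" for s
  proof
    assume "\<phi> s = pi"
    then show False
      using no_crossing[OF solution_on_shift_pi[OF sols[of s]]] gt[of s] kin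
      by (simp add: energy_shift_pi kinetic_shift_pi) (metis energy_shift_pi diff_self)
  qed
  have ne_mpi: "\<phi> s \<noteq> - pi" for s
  proof
    assume "\<phi> s = - pi"
    then show False
      using no_crossing[OF solution_on_shift_pi[OF solution_on_minus[OF sols[of s]]]] gt[of s] kin
        energy_shift_pi[of "- \<phi> s" "- v s" "- y s" "- z s"] energy_minus[of "\<phi> s" "v s" "y s" "z s"]
      by (simp add: kinetic_shift_pi kinetic_minus)
  qed
  have lt: "\<bar>\<phi> s\<bar> < pi" for s
  proof (rule ccontr)
    assume "\<not> ?thesis"
    then have ge: "pi \<le> \<bar>\<phi> s\<bar>" by simp
    have "eventually (\<lambda>t. \<bar>\<phi> t\<bar> < pi \<and> t \<le> s) at_bot"
      using tendstoD[OF lim, of pi] eventually_le_at_bot[of s] by (auto simp: dist_real_def intro: eventually_conj)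
    then obtain t where t: "\<bar>\<phi> t\<bar> \<le> pi" "t \<le> s"
      using eventually_happens[of _ at_bot] by (metis (no_types, lifting) less_imp_le trivial_limit_at_bot_linorder)
    have "\<exists>u. t \<le> u \<and> u \<le> s \<and> \<bar>\<phi> u\<bar> = pi"
      by (rule IVT[OF t(1) ge t(2)]) (use solution_on_isCont(1)[OF sol] in \<open>auto intro!: continuous_intros\<close>)
    then obtain u where "\<bar>\<phi> u\<bar> = pi" by blast
    then show False using ne_pi[of u] ne_mpi[of u] by linarith
  qed
  have "\<bar>of_int k * pi / 2\<bar> \<le> pi"
    using tendsto_rabs[OF k] lt by (intro tendsto_upperbound[of "\<lambda>t. \<bar>\<phi> t\<bar>" _ at_top]) (auto intro!: always_eventually less_imp_le)
  then have "\<bar>of_int k :: real\<bar> \<le> 2" using pi_gt_zero by (simp add: abs_mult)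
  then have "\<bar>k\<bar> \<le> 2" by linarith
  then have "k = 1 \<or> k = - 1" using \<open>odd k\<close> by (cases "k = 2"; cases "k = -2"; cases "k = 0"; force)
  then show ?thesis using k by auto
qed

section \<open>The radial and the autonomous equation\<close>

lemma deriv_eqI: "(\<And>s. (f has_real_derivative g s) (at s)) \<Longrightarrow> deriv f = g"
  by (rule ext) (rule DERIV_imp_deriv)

lemma solution_on_UNIV_deriv:
  assumes "solution_on UNIV \<phi> v y z"
  shows "deriv \<phi> = v" "(deriv ^^ 2) \<phi> = y" "(deriv ^^ 3) \<phi> = z"
    "(deriv ^^ 4) \<phi> = (\<lambda>s. autonomous_rhs (\<phi> s) (v s) (y s) (z s))"
proof -
  note D = solution_onD[OF assms UNIV_I]
  show 1: "deriv \<phi> = v" by (rule deriv_eqI[OF D(1)])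
  have "deriv v = y" "deriv y = z" "deriv z = (\<lambda>s. autonomous_rhs (\<phi> s) (v s) (y s) (z s))"
    by (rule deriv_eqI, rule D)+
  then show "(deriv ^^ 2) \<phi> = y" "(deriv ^^ 3) \<phi> = z"
    "(deriv ^^ 4) \<phi> = (\<lambda>s. autonomous_rhs (\<phi> s) (v s) (y s) (z s))"
    by (simp_all add: eval_nat_numeral 1)
qed

lemma solution_on_UNIV_solves:
  assumes sol: "solution_on UNIV \<phi> v y z"
  shows "solves_autonomous_equation \<phi>"
    and "(phase_curve \<phi> has_vector_derivative autonomous_field (phase_curve \<phi> s)) (at s)"
proof -
  note D = solution_onD[OF sol UNIV_I]
  note d = solution_on_UNIV_deriv[OF sol]
  have "(deriv ^^ k) \<phi> differentiable (at s)" if "k < 4" for k s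
  proof -
    from that consider "k = 0" | "k = 1" | "k = 2" | "k = 3" by linarith
    then show ?thesis
      using D[of s] d(1-3) by cases (auto simp: real_differentiable_def)
  qed
  then show "solves_autonomous_equation \<phi>"
    unfolding solves_autonomous_equation_def using d by simp
  show "(phase_curve \<phi> has_vector_derivative autonomous_field (phase_curve \<phi> s)) (at s)"
    using D[of s] unfolding has_vector_derivative_vec_4
    by (simp add: phase_curve_def autonomous_field_def d)
qed

lemma tendsto_phase_curve:
  assumes sol: "solution_on UNIV \<phi> v y z"
    and "(\<phi> \<longlongrightarrow> p) F" "(v \<longlongrightarrow> 0) F" "(y \<longlongrightarrow> 0) F" "(z \<longlongrightarrow> 0) F"
  shows "(phase_curve \<phi> \<longlongrightarrow> vector [p, 0, 0, 0]) F"
proof (rule vec_tendstoI)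
  fix i :: 4
  show "((\<lambda>s. phase_curve \<phi> s $ i) \<longlongrightarrow> vector [p, 0, 0, 0] $ i) F"
    using exhaust_4[of i] assms(2-5) by (auto simp: phase_curve_def solution_on_UNIV_deriv[OF sol])
qed

lemma solution_on_UNIV_heteroclinic:
  assumes sol: "solution_on UNIV \<phi> v y z" and lim: "(\<phi> \<longlongrightarrow> 0) at_bot" and nz: "\<phi> s1 \<noteq> 0"
  shows "heteroclinic_orbit autonomous_field (phase_curve \<phi>) 0 (vector [- pi / 2, 0, 0, 0]) \<or>
         heteroclinic_orbit autonomous_field (phase_curve \<phi>) 0 (vector [pi / 2, 0, 0, 0])"
proof -
  have "vector [0, 0, 0, 0] = (0 :: real^4)" by (simp add: vec_eq_iff forall_4)
  then have bot: "(phase_curve \<phi> \<longlongrightarrow> 0) at_bot"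
    using tendsto_phase_curve[OF sol lim solution_limits_at_bot[OF sol lim]] by simp
  have "solution_on {0..} \<phi> v y z" using sol by (rule solution_on_subset) simp
  note top = tendsto_phase_curve[OF sol _ solution_limits_at_top(1-3)[OF this]]
  from entire_solution_heteroclinic[OF sol lim nz] show ?thesis
    using top bot solution_on_UNIV_solves(2)[OF sol] unfolding heteroclinic_orbit_def by blast
qed

lemma radial_solution_imp_solution_on:
  assumes "nontrivial_radial_solution \<psi>"
  shows "\<exists>v y z. solution_on UNIV (\<lambda>s. \<psi> (exp s)) v y z"
    and "((\<lambda>s. \<psi> (exp s)) \<longlongrightarrow> 0) at_bot" and "\<exists>s. \<psi> (exp s) \<noteq> 0"
proof -
  have cont: "continuous_on {0..} \<psi>" and smooth: "smooth_on {0<..} \<psi>" and zero: "\<psi> 0 = 0"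
    and nz: "\<exists>r\<ge>0. \<psi> r \<noteq> 0" and eq: "solves_radial_equation \<psi>"
    using assms by (auto simp: nontrivial_radial_solution_def)
  define p where "p k = (deriv ^^ k) \<psi>" for k
  have p: "(p k has_real_derivative p (Suc k) r) (at r)" if "0 < r" for k r
  proof -
    have "p k differentiable (at r)" using smooth that by (auto simp: smooth_on_def p_def)
    then show ?thesis
      unfolding p_def by (auto simp: real_differentiable_def dest: DERIV_imp_deriv)
  qed
  have p0: "p 0 = \<psi>" by (simp add: p_def)
  have pe: "((\<lambda>s. p k (exp s)) has_real_derivative p (Suc k) (exp s) * exp s) (at s)" for k s
    by (rule DERIV_chain2[OF p]) (auto intro!: derivative_eq_intros)
  define e where "e = (\<lambda>s::real. exp s)"
  have de: "(e has_real_derivative e s) (at s)" for s unfolding e_def by (auto intro!: derivative_eq_intros)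
  have epos: "0 < e s" for s by (simp add: e_def)
  have pe: "((\<lambda>s. p k (e s)) has_real_derivative p (Suc k) (e s) * e s) (at s)" for k s
    using pe by (simp add: e_def)
  \<comment> \<open>Powers of the Euler operator \<open>r d/dr\<close>: the coefficients 1; 1, 1; 1,
    3, 1 and, in the derivative of \<open>z\<close>, 1, 7, 6, 1 are Stirling numbers of the second
    kind.\<close>
  define v where "v s = e s * p 1 (e s)" for s
  define y where "y s = e s * p 1 (e s) + (e s)^2 * p 2 (e s)" for s
  define z where "z s = e s * p 1 (e s) + 3 * (e s)^2 * p 2 (e s) + (e s)^3 * p 3 (e s)" for s
  have "((\<lambda>s. \<psi> (exp s)) has_real_derivative v s) (at s)" for s
    using pe[of 0 s] by (simp add: p0 v_def e_def mult.commute)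
  moreover have "(v has_real_derivative y s) (at s)" for s
    unfolding v_def[abs_def] y_def
    by (auto intro!: derivative_eq_intros de pe simp: eval_nat_numeral algebra_simps)
  moreover have "(y has_real_derivative z s) (at s)" for s
    unfolding y_def[abs_def] z_def
    by (auto intro!: derivative_eq_intros de pe simp: eval_nat_numeral algebra_simps)
  moreover have "(z has_real_derivative autonomous_rhs (\<psi> (exp s)) (v s) (y s) (z s)) (at s)" for s
  proof -
    have z': "(z has_real_derivative e s * p 1 (e s) + 7 * (e s)^2 * p 2 (e s) + 6 * (e s)^3 * p 3 (e s) + (e s)^4 * p 4 (e s)) (at s)"
      unfolding z_def[abs_def]
      by (auto intro!: derivative_eq_intros de pe simp: eval_nat_numeral algebra_simps)
    have q: "p 4 r = 6 * (p 1 r)^2 * p 2 r + 8 / r * ((p 1 r)^3 - p 3 r)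
      - 4 / r^2 * ((1 - cos (2 * \<psi> r)) * p 2 r + sin (2 * \<psi> r) * (p 1 r)^2)
      + 8 / r^3 * (cos (2 * \<psi> r) + 2) * p 1 r - 12 / r^4 * sin (2 * \<psi> r)" if "0 < r" for r
      using eq that unfolding solves_radial_equation_def p_def by simp
    have "r * p 1 r + 7 * r^2 * p 2 r + 6 * r^3 * p 3 r + r^4 * p 4 r
       = autonomous_rhs (\<psi> r) (r * p 1 r) (r * p 1 r + r^2 * p 2 r) (r * p 1 r + 3 * r^2 * p 2 r + r^3 * p 3 r)"
      if r: "0 < r" for r
      unfolding q[OF r] autonomous_rhs_def using r by (simp add: field_simps) algebra
    from this[OF epos, of s] z' show ?thesis by (simp add: v_def y_def z_def e_def)
  qed
  ultimately show "\<exists>v y z. solution_on UNIV (\<lambda>s. \<psi> (exp s)) v y z"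
    unfolding solution_on_def by blast
  have "(\<psi> \<longlongrightarrow> 0) (at 0 within {0..})" using cont zero by (force simp: continuous_on_def)
  moreover have "filterlim exp (at 0 within {0..}) (at_bot :: real filter)"
    unfolding filterlim_at using exp_at_bot by (auto intro!: always_eventually)
  ultimately show "((\<lambda>s. \<psi> (exp s)) \<longlongrightarrow> 0) at_bot" by (rule filterlim_compose)
  obtain r where r: "0 \<le> r" "\<psi> r \<noteq> 0" using nz by blast
  then have "0 < r" using zero by (cases "r = 0") auto
  then show "\<exists>s. \<psi> (exp s) \<noteq> 0" using r by (intro exI[of _ "ln r"]) simp
qed

text \<open>The functions obtained from a solution in the variable \<open>ln r\<close> by algebraic operations are closed
  under differentiation on \<open>(0,\<infinity>)\<close>; this is the bootstrap to smoothness.\<close>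

inductive_set solution_algebra ::
    "(real \<Rightarrow> real) \<Rightarrow> (real \<Rightarrow> real) \<Rightarrow> (real \<Rightarrow> real) \<Rightarrow> (real \<Rightarrow> real) \<Rightarrow> (real \<Rightarrow> real) set"
  for \<phi> v y z where
  phi: "(\<lambda>r. \<phi> (ln r)) \<in> solution_algebra \<phi> v y z"
| v: "(\<lambda>r. v (ln r)) \<in> solution_algebra \<phi> v y z"
| y: "(\<lambda>r. y (ln r)) \<in> solution_algebra \<phi> v y z"
| z: "(\<lambda>r. z (ln r)) \<in> solution_algebra \<phi> v y z"
| sin: "(\<lambda>r. sin (2 * \<phi> (ln r))) \<in> solution_algebra \<phi> v y z"
| cos: "(\<lambda>r. cos (2 * \<phi> (ln r))) \<in> solution_algebra \<phi> v y z"
| inverse: "inverse \<in> solution_algebra \<phi> v y z"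
| const: "(\<lambda>r. c) \<in> solution_algebra \<phi> v y z"
| add: "f \<in> solution_algebra \<phi> v y z \<Longrightarrow> g \<in> solution_algebra \<phi> v y z \<Longrightarrow> (\<lambda>r. f r + g r) \<in> solution_algebra \<phi> v y z"
| mult: "f \<in> solution_algebra \<phi> v y z \<Longrightarrow> g \<in> solution_algebra \<phi> v y z \<Longrightarrow> (\<lambda>r. f r * g r) \<in> solution_algebra \<phi> v y z"
| cong: "f \<in> solution_algebra \<phi> v y z \<Longrightarrow> (\<And>r. 0 < r \<Longrightarrow> g r = f r) \<Longrightarrow> g \<in> solution_algebra \<phi> v y z"

lemma solution_algebra_diff:
  assumes "f \<in> solution_algebra \<phi> v y z" "g \<in> solution_algebra \<phi> v y z"
  shows "(\<lambda>r. f r - g r) \<in> solution_algebra \<phi> v y z"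
  by (rule solution_algebra.cong[OF solution_algebra.add[OF assms(1)
        solution_algebra.mult[OF solution_algebra.const[of "- 1"] assms(2)]]]) simp

lemma solution_algebra_power:
  "f \<in> solution_algebra \<phi> v y z \<Longrightarrow> (\<lambda>r. f r ^ n) \<in> solution_algebra \<phi> v y z"
  by (induction n) (auto intro: solution_algebra.const solution_algebra.mult)

lemma solution_algebra_rhs:
  "(\<lambda>r. autonomous_rhs (\<phi> (ln r)) (v (ln r)) (y (ln r)) (z (ln r))) \<in> solution_algebra \<phi> v y z"
  unfolding autonomous_rhs_def
  by (intro solution_algebra.add solution_algebra_diff solution_algebra.mult solution_algebra_power
      solution_algebra.v solution_algebra.y solution_algebra.z solution_algebra.sin solution_algebra.cos
      solution_algebra.const)

lemma has_real_derivative_compose_ln: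
  assumes "\<And>s. (g has_real_derivative g' s) (at s)" "0 < r"
  shows "((\<lambda>r. g (ln r)) has_real_derivative g' (ln r) * inverse r) (at r)"
  by (rule DERIV_chain2[OF assms(1) DERIV_ln[OF assms(2)]])

lemma solution_algebra_derivative:
  assumes sol: "solution_on UNIV \<phi> v y z" and f: "f \<in> solution_algebra \<phi> v y z"
  shows "\<exists>f'\<in>solution_algebra \<phi> v y z. \<forall>r>0. (f has_real_derivative f' r) (at r)"
proof -
  let ?A = "solution_algebra \<phi> v y z"
  note D = solution_onD[OF sol UNIV_I]
  note chain = has_real_derivative_compose_ln and I = solution_algebra.intros(1-10)
  show ?thesis using f
  proof (induction rule: solution_algebra.induct)
    case phi
    show ?case by (rule bexI[OF _ solution_algebra.mult[OF I(2) I(7)]]) (use chain[OF D(1)] in auto)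
  next
    case v
    show ?case by (rule bexI[OF _ solution_algebra.mult[OF I(3) I(7)]]) (use chain[OF D(2)] in auto)
  next
    case y
    show ?case by (rule bexI[OF _ solution_algebra.mult[OF I(4) I(7)]]) (use chain[OF D(3)] in auto)
  next
    case z
    show ?case by (rule bexI[OF _ solution_algebra.mult[OF solution_algebra_rhs I(7)]]) (use chain[OF D(4)] in auto)
  next
    case sin
    show ?case
      by (rule bexI[OF _ solution_algebra.mult[OF I(6) solution_algebra.mult[OF I(8)[of 2] solution_algebra.mult[OF I(2) I(7)]]]])
         (use chain[OF D(1)] in \<open>auto intro!: derivative_eq_intros\<close>)
  next
    case cos
    show ?case
      by (rule bexI[OF _ solution_algebra.mult[OF I(5) solution_algebra.mult[OF I(8)[of "- 2"] solution_algebra.mult[OF I(2) I(7)]]]])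
         (use chain[OF D(1)] in \<open>auto intro!: derivative_eq_intros\<close>)
  next
    case inverse
    show ?case
      by (rule bexI[OF _ solution_algebra.mult[OF I(8)[of "- 1"] solution_algebra.mult[OF I(7) I(7)]]])
         (auto intro!: derivative_eq_intros)
  next
    case (const c)
    show ?case by (rule bexI[OF _ I(8)[of 0]]) auto
  next
    case (add f g)
    then obtain f' g' where fg: "f' \<in> ?A" "g' \<in> ?A"
      "\<forall>r>0. (f has_real_derivative f' r) (at r)" "\<forall>r>0. (g has_real_derivative g' r) (at r)" by blast
    show ?case by (rule bexI[OF _ I(9)[OF fg(1,2)]]) (use fg(3,4) in \<open>auto intro!: derivative_eq_intros\<close>)
  next
    case (mult f g)
    then obtain f' g' where fg: "f' \<in> ?A" "g' \<in> ?A"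
      "\<forall>r>0. (f has_real_derivative f' r) (at r)" "\<forall>r>0. (g has_real_derivative g' r) (at r)" by blast
    show ?case
      by (rule bexI[OF _ I(9)[OF I(10)[OF fg(1) mult.hyps(2)] I(10)[OF fg(2) mult.hyps(1)]]])
         (use fg(3,4) in \<open>auto intro!: derivative_eq_intros\<close>)
  next
    case (cong f g)
    then obtain f' where f': "f' \<in> ?A" "\<forall>r>0. (f has_real_derivative f' r) (at r)" by blast
    show ?case
    proof (rule bexI[OF _ f'(1)], intro allI impI)
      fix r :: real assume r: "0 < r"
      have "(f has_real_derivative f' r) (at r)" using f'(2) r by blast
      then show "(g has_real_derivative f' r) (at r)"
        by (rule has_field_derivative_transform_within_open[of _ _ _ "{0<..}"]) (use r cong.hyps(2) in auto)
    qed
  qed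
qed

text \<open>The derivative found in the algebra agrees with \<open>deriv\<close> only for
  \<open>r > 0\<close>; the rule \<open>cong\<close> makes this enough for the induction.\<close>

lemma solution_algebra_smooth:
  assumes sol: "solution_on UNIV \<phi> v y z" and f: "f \<in> solution_algebra \<phi> v y z"
  shows "smooth_on {0<..} f"
proof -
  have "(deriv ^^ k) f \<in> solution_algebra \<phi> v y z" for k
  proof (induction k)
    case (Suc k)
    obtain f' where f': "f' \<in> solution_algebra \<phi> v y z"
      "\<forall>r>0. ((deriv ^^ k) f has_real_derivative f' r) (at r)"
      using solution_algebra_derivative[OF sol Suc] by blast
    show ?case by (rule solution_algebra.cong[OF f'(1)]) (use f'(2) DERIV_imp_deriv in force)
  qed (simp add: f)
  then show ?thesis
    using solution_algebra_derivative[OF sol] unfolding smooth_on_def by (auto simp: real_differentiable_def) blast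
qed

lemma deriv_transform_pos:
  fixes f g :: "real \<Rightarrow> real"
  assumes "\<And>r. 0 < r \<Longrightarrow> f r = g r" "\<And>r. 0 < r \<Longrightarrow> (g has_real_derivative g' r) (at r)" "0 < r"
  shows "deriv f r = g' r"
proof (rule DERIV_imp_deriv)
  show "(f has_real_derivative g' r) (at r)"
    by (rule has_field_derivative_transform_within_open[OF assms(2)[OF assms(3)], of "{0<..}"]) (use assms in auto)
qed

lemma solution_on_imp_radial_solution:
  assumes sol: "solution_on UNIV \<phi> v y z" and lim: "(\<phi> \<longlongrightarrow> 0) at_bot" and nz: "\<phi> 0 \<noteq> 0"
  shows "nontrivial_radial_solution (\<lambda>r. if 0 < r then \<phi> (ln r) else 0)"
proof -
  define \<psi> where "\<psi> r = (if 0 < r then \<phi> (ln r) else 0)" for r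
  note D = solution_onD[OF sol UNIV_I]
  note C = D[THEN has_real_derivative_compose_ln]
  have d1: "deriv \<psi> r = v (ln r) / r" if r: "0 < r" for r
    using deriv_transform_pos[OF _ C(1) r, of \<psi>] by (simp add: \<psi>_def divide_inverse)
  \<comment> \<open>The inverse change of variables: with \<open>D = d/ds\<close>, the numerators in
    \<open>d2\<close>, \<open>d3\<close>, \<open>d4\<close> are \<open>D (D - 1)\<close>,
    \<open>D (D - 1) (D - 2)\<close> and \<open>D (D - 1) (D - 2) (D - 3)\<close> applied to
    \<phi>.\<close>
  have d2: "(deriv ^^ 2) \<psi> r = (y (ln r) - v (ln r)) / r^2" if r: "0 < r" for r
    unfolding numeral_2_eq_2 funpow.simps o_def id_def
    by (rule deriv_transform_pos[OF d1 _ r])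
       (auto intro!: derivative_eq_intros C simp: field_simps power2_eq_square)
  have d3: "(deriv ^^ 3) \<psi> r = (z (ln r) - 3 * y (ln r) + 2 * v (ln r)) / r^3" if r: "0 < r" for r
  proof -
    have "(deriv ^^ 3) \<psi> r = deriv ((deriv ^^ 2) \<psi>) r" by (simp add: eval_nat_numeral)
    also have "\<dots> = (z (ln r) - 3 * y (ln r) + 2 * v (ln r)) / r^3"
      by (rule deriv_transform_pos[OF d2 _ r])
         (auto intro!: derivative_eq_intros C simp: field_simps eval_nat_numeral)
    finally show ?thesis .
  qed
  have d4: "(deriv ^^ 4) \<psi> r = (autonomous_rhs (\<phi> (ln r)) (v (ln r)) (y (ln r)) (z (ln r))
      - 6 * z (ln r) + 11 * y (ln r) - 6 * v (ln r)) / r^4" if r: "0 < r" for r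
  proof -
    have "(deriv ^^ 4) \<psi> r = deriv ((deriv ^^ 3) \<psi>) r" by (simp add: eval_nat_numeral)
    also have "\<dots> = (autonomous_rhs (\<phi> (ln r)) (v (ln r)) (y (ln r)) (z (ln r))
      - 6 * z (ln r) + 11 * y (ln r) - 6 * v (ln r)) / r^4"
      by (rule deriv_transform_pos[OF d3 _ r])
         (auto intro!: derivative_eq_intros C simp: field_simps eval_nat_numeral)
    finally show ?thesis .
  qed
  have "continuous_on {0..} \<psi>"
    unfolding continuous_on_def
  proof
    fix r :: real assume "r \<in> {0..}"
    then consider "r = 0" | "0 < r" by force
    then show "(\<psi> \<longlongrightarrow> \<psi> r) (at r within {0..})"
    proof cases
      case 1
      have "((\<lambda>r. \<phi> (ln r)) \<longlongrightarrow> 0) (at_right 0)" by (rule filterlim_compose[OF lim ln_at_0])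
      moreover have "eventually (\<lambda>r. \<phi> (ln r) = \<psi> r) (at_right 0)"
        using eventually_at_right_less[of 0] by eventually_elim (simp add: \<psi>_def)
      ultimately have "(\<psi> \<longlongrightarrow> 0) (at_right 0)" by (rule Lim_transform_eventually)
      moreover have "at 0 within {0..} = at_right (0::real)" 
      proof -
        have "{0..} - {0} = {0<..} - {0::real}" by auto
        then show ?thesis by (simp only: at_within_def)
      qed
      ultimately show ?thesis using 1 by (simp add: \<psi>_def)
    next
      case 2
      have "isCont (\<lambda>r. \<phi> (ln r)) r" using C(1)[OF 2] by (rule DERIV_isCont)
      then have "(\<psi> \<longlongrightarrow> \<phi> (ln r)) (at r)"
        unfolding isCont_def
        by (rule Lim_transform_within_open[of _ _ _ _ "{0<..}"]) (use 2 in \<open>auto simp: \<psi>_def\<close>)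
      then show ?thesis using 2 by (auto simp: \<psi>_def intro: tendsto_within_subset)
    qed
  qed
  moreover have "smooth_on {0<..} \<psi>"
    by (rule solution_algebra_smooth[OF sol solution_algebra.cong[OF solution_algebra.phi]]) (simp add: \<psi>_def)
  moreover have "\<psi> 1 \<noteq> 0" using nz by (simp add: \<psi>_def)
  moreover have "solves_radial_equation \<psi>"
    unfolding solves_radial_equation_def
  proof (intro allI impI, goal_cases)
    case (1 r)
    then have r: "0 < r" by simp
    have "\<psi> r = \<phi> (ln r)" using r by (simp add: \<psi>_def)
    then show ?case
      unfolding d1[OF r] d2[OF r] d3[OF r] d4[OF r] autonomous_rhs_def using r
      by (simp add: field_simps eval_nat_numeral)
  qed
  ultimately show ?thesis
    unfolding nontrivial_radial_solution_def \<psi>_def[symmetric, abs_def] by (auto simp: \<psi>_def intro: exI[of _ 1])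
qed

section \<open>Existence by shooting\<close>

abbreviation vec_energy :: "real^4 \<Rightarrow> real" where
  "vec_energy x \<equiv> energy (x $ 1) (x $ 2) (x $ 3) (x $ 4)"

text \<open>To second order at the origin the energy is
  \<open>- 6 + 12 \<phi>^2 + v z - y^2 / 2 + 2 v y - 13/2 v^2\<close>. With \<open>y = 0\<close> and
  \<open>z = 10 v\<close> the quadratic part becomes \<open>12 \<phi>^2 + 7/2 v^2\<close>; a factor
  above \<open>13/2\<close> makes it positive definite.\<close>

definition shooting_data :: "real \<Rightarrow> real \<Rightarrow> real^4" where
  "shooting_data \<delta> \<theta> = vector [\<delta> * cos \<theta>, \<delta> * sin \<theta>, 0, 10 * \<delta> * sin \<theta>]"

lemma continuous_on_vec_energy: "continuous_on S vec_energy"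
  unfolding energy_def kinetic_def by (intro continuous_intros) auto

lemma tendsto_vec_energy: "(x \<longlongrightarrow> p) F \<Longrightarrow> ((\<lambda>n. vec_energy (x n)) \<longlongrightarrow> vec_energy p) F"
  using continuous_on_vec_energy[of UNIV] by (rule continuous_on_tendsto_compose) auto

lemma isCont_shooting_data: "isCont (shooting_data \<delta>) \<theta>"
  unfolding isCont_def
proof (rule vec_tendstoI)
  fix i :: 4
  show "((\<lambda>\<theta>. shooting_data \<delta> \<theta> $ i) \<longlongrightarrow> shooting_data \<delta> \<theta> $ i) (at \<theta>)"
    using exhaust_4[of i] by (elim disjE) (simp_all add: shooting_data_def, (intro tendsto_intros)+)
qed

lemma shooting_data_bounds:
  assumes "0 < \<delta>" "\<delta> \<le> 1/2"
  shows "\<bar>shooting_data \<delta> \<theta> $ 1\<bar> \<le> \<delta>" "\<bar>shooting_data \<delta> \<theta> $ 2\<bar> \<le> \<delta>"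
    "\<bar>shooting_data \<delta> \<theta> $ 4\<bar> \<le> 10 * \<delta>"
  using assms mult_left_mono[OF abs_cos_le_one[of \<theta>], of \<delta>] mult_left_mono[OF abs_sin_le_one[of \<theta>], of \<delta>]
  by (auto simp: shooting_data_def abs_mult)

lemma norm_shooting_data:
  assumes "0 < \<delta>" "\<delta> \<le> 1/2"
  shows "norm (shooting_data \<delta> \<theta>) \<le> 12 * \<delta>"
proof -
  have "norm (shooting_data \<delta> \<theta>) \<le> (\<Sum>i\<in>UNIV. \<bar>shooting_data \<delta> \<theta> $ i\<bar>)" by (rule norm_le_l1_cart)
  also have "\<dots> = \<bar>shooting_data \<delta> \<theta> $ 1\<bar> + \<bar>shooting_data \<delta> \<theta> $ 2\<bar> + \<bar>shooting_data \<delta> \<theta> $ 4\<bar>"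
    unfolding sum_4 by (simp add: shooting_data_def)
  finally show ?thesis using shooting_data_bounds[OF assms, of \<theta>] by linarith
qed

lemma shooting_data_energy:
  assumes d: "0 < \<delta>" "\<delta> \<le> 1/2"
  shows "- 6 < vec_energy (shooting_data \<delta> \<theta>)" "vec_energy (shooting_data \<delta> \<theta>) \<le> 6"
proof -
  define p s C where "p = \<delta> * cos \<theta>" and "s = \<delta> * sin \<theta>" and "C = cos (2 * p)"
  have ps: "\<bar>p\<bar> \<le> \<delta>" "\<bar>s\<bar> \<le> \<delta>" using shooting_data_bounds[OF d, of \<theta>] by (auto simp: shooting_data_def p_def s_def)
  have "\<bar>s\<bar>^2 \<le> (1/2)^2" using ps d by (intro power_mono) auto
  then have s2: "s^2 \<le> 1/4" by (simp add: power2_eq_square)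
  have "s^4 = s^2 * s^2" by simp
  also have "\<dots> \<le> 1/4 * s^2" using s2 by (intro mult_right_mono) auto
  finally have s4: "s^4 \<le> 1/4 * s^2" .
  have C: "0 \<le> C" "C \<le> 1" unfolding C_def using ps d pi_gt3 by (auto intro!: cos_ge_zero)
  have sd: "shooting_data \<delta> \<theta> = vector [p, s, 0, 10 * s]"
    by (simp add: shooting_data_def p_def s_def mult.assoc)
  have e: "vec_energy (shooting_data \<delta> \<theta>) = (11/2 - 2 * C) * s^2 - 3/2 * s^4 - 6 * C"
    unfolding sd by (simp add: energy_def kinetic_def C_def power2_eq_square algebra_simps)
  have m: "7/2 * s^2 \<le> (11/2 - 2 * C) * s^2" "(11/2 - 2 * C) * s^2 \<le> 11/2 * s^2"
    using C by (intro mult_right_mono; simp)+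
  have nn: "0 \<le> s^2" "0 \<le> s^4" by simp_all
  show "vec_energy (shooting_data \<delta> \<theta>) \<le> 6" using e m s2 C nn by linarith
  show "- 6 < vec_energy (shooting_data \<delta> \<theta>)"
  \<comment> \<open>For \<open>s \<noteq> 0\<close> the kinetic part is positive; for
    \<open>s = 0\<close> it vanishes and the gain comes from \<open>cos (2 p) < 1\<close>, since
    then \<open>|p| = \<delta>\<close>.\<close>
  proof (cases "s = 0")
    case False
    then have "0 < s^2" by simp
    then show ?thesis using e m s4 C by linarith
  next
    case True
    then have "sin \<theta> = 0" using d by (simp add: s_def)
    then have "\<bar>cos \<theta>\<bar> = 1" using sin_cos_squared_add[of \<theta>] by (simp add: abs_square_eq_1)
    then have p: "\<bar>p\<bar> = \<delta>" using d by (simp add: p_def abs_mult)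
    have "sin \<bar>p\<bar> > 0" unfolding p using d pi_gt3 by (intro sin_gt_zero) auto
    then have "sin p \<noteq> 0" by (auto simp: abs_if split: if_splits)
    then have "0 < (sin p)^2" by simp
    then have "C < 1" unfolding C_def cos_double_sin by linarith
    then show ?thesis using e True by simp
  qed
qed

lemma shooting_data_admissible:
  assumes "0 < \<delta>" "\<delta> \<le> 1/2"
  shows "\<bar>shooting_data \<delta> \<theta> $ 1\<bar> \<le> 1" "\<bar>shooting_data \<delta> \<theta> $ 2\<bar> \<le> 1" "shooting_data \<delta> \<theta> $ 3 = 0"
    "\<bar>shooting_data \<delta> \<theta> $ 4\<bar> \<le> 10" "- 6 \<le> vec_energy (shooting_data \<delta> \<theta>)"
  using shooting_data_bounds[OF assms, of \<theta>] shooting_data_energy(1)[OF assms, of \<theta>] assms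
  by (auto simp: shooting_data_def)

text \<open>A crude Gronwall bound that serves as truncation radius. \<open>y^2 + z^2 + 1\<close> is
  at most 102 initially, grows with relative rate at most 212 and dominates both \<open>|y|\<close>
  and \<open>|z|\<close>, whence \<open>204\<close>; the rest covers
  \<open>|\<phi>| <= 1 + 3 T\<close> and \<open>|v| <= 3\<close>. The bounds of
  \<open>solution_yz_bound\<close> do not serve here, because they look one unit of time
  ahead.\<close>

definition horizon_bound :: "real \<Rightarrow> real" where
  "horizon_bound T = 10 + 3 * T + 204 * exp (212 * T)"

text \<open>Energy between -6 and 7 gives \<open>v^2 <= 1 + 13/2 < 9\<close>. The level 7 leaves
  room to follow a solution slightly beyond energy 6.\<close>

lemma solution_horizon_bound:
  assumes sol: "solution_curve_on {0..b} x" and b: "0 \<le> b" "b \<le> T"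
    and init: "\<bar>x 0 $ 1\<bar> \<le> 1" "\<bar>x 0 $ 2\<bar> \<le> 1" "x 0 $ 3 = 0" "\<bar>x 0 $ 4\<bar> \<le> 10" "- 6 \<le> vec_energy (x 0)"
    and e: "\<And>t. t \<in> {0..b} \<Longrightarrow> vec_energy (x t) \<le> 7"
  shows "\<And>t. t \<in> {0..b} \<Longrightarrow> \<bar>x t $ 2\<bar> \<le> 3" and "norm (x b) < horizon_bound T"
proof -
  note D = solution_onD[OF sol]
  show v: "\<bar>x t $ 2\<bar> \<le> 3" if t: "t \<in> {0..b}" for t
  proof -
    have "(x t $ 2)^2 \<le> (x 0 $ 2)^2 + (vec_energy (x t) - vec_energy (x 0)) / 2"
      by (rule solution_v_bound[of 0 t "\<lambda>s. x s $ 1" "\<lambda>s. x s $ 2" "\<lambda>s. x s $ 3" "\<lambda>s. x s $ 4"])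
         (use t in \<open>auto intro: solution_on_subset[OF sol]\<close>)
    moreover have "(x 0 $ 2)^2 \<le> 1" using init(2) by (simp add: abs_square_le_1)
    moreover have "(vec_energy (x t) - vec_energy (x 0)) / 2 \<le> 13/2" using e[OF t] init(5) by simp
    ultimately have "(x t $ 2)^2 \<le> 9" by linarith
    then have "(x t $ 2)^2 \<le> 3^2" by simp
    then show ?thesis by (simp add: abs_le_square_iff[of _ 3, simplified, symmetric])
  qed
  define P where "P t = (x t $ 3)^2 + (x t $ 4)^2 + 1" for t
  define y where "y t = x t $ 3" for t
  define z where "z t = x t $ 4" for t
  define f where "f t = force (x t $ 1) (x t $ 2) (x t $ 3)" for t
  have "- (exp (- (212 * 0)) * P 0) \<le> - (exp (- (212 * b)) * P b)"
  proof (rule deriv_nonneg_imp_le[OF b(1), of "\<lambda>t. - (exp (- (212 * t)) * P t)"])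
    fix t assume "0 \<le> t" "t \<le> b"
    then have t: "t \<in> {0..b}" by simp
    show "((\<lambda>t. - (exp (- (212 * t)) * P t)) has_real_derivative
        exp (- (212 * t)) * (212 * P t - (2 * y t * z t + 2 * z t * (f t - 2 * z t)))) (at t)"
      unfolding P_def[abs_def]
      by (auto intro!: derivative_eq_intros D[OF t] simp: autonomous_rhs_force y_def z_def f_def algebra_simps)
    have "\<bar>f t\<bar> \<le> (13 + 6 * 3^2) * \<bar>y t\<bar> + 12 + 4 * 3^2 + 14 * 3 + 2 * 3^3"
      unfolding f_def y_def by (rule abs_force_le[OF v[OF t] order_refl])
    then have ft: "\<bar>f t\<bar> \<le> 67 * \<bar>y t\<bar> + 144" by simp
    have "2 * z t * f t \<le> 2 * (\<bar>z t\<bar> * \<bar>f t\<bar>)" by (simp add: abs_mult[symmetric])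
    also have "\<bar>z t\<bar> * \<bar>f t\<bar> \<le> \<bar>z t\<bar> * (67 * \<bar>y t\<bar> + 144)" using ft by (intro mult_left_mono) auto
    finally have 1: "2 * z t * f t \<le> 134 * (\<bar>z t\<bar> * \<bar>y t\<bar>) + 288 * \<bar>z t\<bar>" by (simp add: algebra_simps)
    have 2: "2 * (\<bar>z t\<bar> * \<bar>y t\<bar>) \<le> (y t)^2 + (z t)^2"
      using zero_le_power2[of "\<bar>z t\<bar> - \<bar>y t\<bar>"] unfolding power2_diff by simp
    have 3: "2 * \<bar>z t\<bar> \<le> (z t)^2 + 1"
      using zero_le_power2[of "\<bar>z t\<bar> - 1"] unfolding power2_diff by simp
    have 4: "2 * y t * z t \<le> (y t)^2 + (z t)^2"
      using zero_le_power2[of "y t - z t"] unfolding power2_diff by simp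
    have P: "P t = (y t)^2 + (z t)^2 + 1" by (simp add: P_def y_def z_def)
    have 5: "2 * z t * (f t - 2 * z t) = 2 * z t * f t - 4 * (z t)^2" by (simp add: algebra_simps power2_eq_square)
    have "0 \<le> 212 * P t - (2 * y t * z t + 2 * z t * (f t - 2 * z t))"
      unfolding 5 P distrib_left using 1 2 3 4 zero_le_power2[of "y t"] zero_le_power2[of "z t"] by linarith
    then show "0 \<le> exp (- (212 * t)) * (212 * P t - (2 * y t * z t + 2 * z t * (f t - 2 * z t)))" by simp
  qed
  then have "exp (212 * b) * (exp (- (212 * b)) * P b) \<le> exp (212 * b) * P 0" by simp
  then have "P b \<le> exp (212 * b) * P 0" by (simp add: mult.assoc[symmetric] exp_add[symmetric])
  also have "\<dots> \<le> exp (212 * T) * 102"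
  proof (rule mult_mono)
    have "(x 0 $ 4)^2 \<le> 10^2" using power_mono[of "\<bar>x 0 $ 4\<bar>" 10 2] init(4) by simp
    then show "P 0 \<le> 102" using init(3) by (simp add: P_def)
  qed (use b in \<open>auto simp: P_def\<close>)
  finally have Pb: "P b \<le> 102 * exp (212 * T)" by simp
  have "2 * \<bar>x b $ 3\<bar> \<le> (x b $ 3)^2 + 1" "2 * \<bar>x b $ 4\<bar> \<le> (x b $ 4)^2 + 1"
    using zero_le_power2[of "\<bar>x b $ 3\<bar> - 1"] zero_le_power2[of "\<bar>x b $ 4\<bar> - 1"] unfolding power2_diff by simp_all
  then have yz: "\<bar>x b $ 3\<bar> \<le> P b" "\<bar>x b $ 4\<bar> \<le> P b"
    using zero_le_power2[of "x b $ 3"] zero_le_power2[of "x b $ 4"] unfolding P_def by linarith+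
  have "norm (x b $ 1 - x 0 $ 1) \<le> 3 * norm (b - 0)"
    by (rule field_differentiable_bound[of "{0..b}" "\<lambda>s. x s $ 1" "\<lambda>s. x s $ 2"])
       (use D(1) v b in \<open>auto intro: has_field_derivative_at_within\<close>)
  then have "\<bar>x b $ 1 - x 0 $ 1\<bar> \<le> 3 * b" using b by simp
  then have phi: "\<bar>x b $ 1\<bar> \<le> 1 + 3 * T" using init(1) b by linarith
  have "norm (x b) \<le> (\<Sum>i\<in>UNIV. \<bar>x b $ i\<bar>)" by (rule norm_le_l1_cart)
  also have "\<dots> = \<bar>x b $ 1\<bar> + \<bar>x b $ 2\<bar> + \<bar>x b $ 3\<bar> + \<bar>x b $ 4\<bar>" by (simp add: sum_4)
  also have "\<dots> < horizon_bound T"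
    using phi v[of b] yz Pb b unfolding horizon_bound_def by simp
  finally show "norm (x b) < horizon_bound T" .
qed

text \<open>Shooting: if every initial angle in \<open>[0,\<pi>]\<close> led to energy above 6, then \<open>[0,\<pi>]\<close> would split into
  the two open sets of angles for which this happens with \<open>v > 0\<close> and with \<open>v < 0\<close>. The odd symmetry
  exchanges them and maps the angle 0 to \<open>\<pi>\<close>, so neither is empty, against connectedness.\<close>

lemma finite_horizon_solution:
  assumes d: "0 < \<delta>" "\<delta> \<le> 1/2" and T: "0 \<le> T"
  shows "\<exists>\<theta>\<in>{0..pi}. \<exists>x. solution_curve_on {0..T} x \<and> x 0 = shooting_data \<delta> \<theta> \<and>
     (\<forall>t\<in>{0..T}. vec_energy (x t) \<le> 6)"
proof (rule ccontr)
  assume none: "\<not> ?thesis"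
  define R where "R = horizon_bound T"
  have R0: "10 \<le> R" using T by (simp add: R_def horizon_bound_def)
  define F where "F = truncated_field R"
  obtain L where L: "0 < L" "L-lipschitz_on UNIV F"
    using truncated_field_lipschitz[of R] R0 unfolding F_def by auto
  define q where "q = shooting_data \<delta>"
  define X where "X \<theta> t = flow F (q \<theta>) t" for \<theta> t
  have X0: "X \<theta> 0 = q \<theta>" for \<theta> unfolding X_def by (rule flow_props(1)[OF L(2,1)])
  have dX: "(X \<theta> has_vector_derivative F (X \<theta> t)) (at t)" for \<theta> t
    unfolding X_def[abs_def] by (rule flow_props(2)[OF L(2,1)])
  have contX: "isCont (X \<theta>) t" for \<theta> t using dX by (rule has_vector_derivative_continuous)
  have contXon: "continuous_on S (X \<theta>)" for S \<theta>
    by (intro continuous_at_imp_continuous_on ballI contX)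
  note init = shooting_data_admissible[OF d, folded q_def]
  have sol: "solution_curve_on {0..t} (X \<theta>)" if "\<And>s. s \<in> {0..t} \<Longrightarrow> norm (X \<theta> s) \<le> R" for \<theta> t
    unfolding solution_curve_on_iff
  proof
    fix s assume s: "s \<in> {0..t}"
    have "\<bar>X \<theta> s $ i\<bar> \<le> R" for i using component_le_norm_cart[of "X \<theta> s" i] that[OF s] by simp
    then have "F (X \<theta> s) = autonomous_field (X \<theta> s)" unfolding F_def by (intro truncated_field_eq)
    then show "(X \<theta> has_vector_derivative autonomous_field (X \<theta> s)) (at s)" using dX[of \<theta> s] by simp
  qed
  have box: "norm (X \<theta> s) < R"
    if c: "c \<in> {0..T}" and e: "\<And>s. s \<in> {0..c} \<Longrightarrow> vec_energy (X \<theta> s) \<le> 7" and s: "s \<in> {0..c}" for \<theta> c s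
  proof -
    \<comment> \<open>Bootstrap: while the norm is at most \<open>R\<close> the truncation is
      inactive, and then the horizon bound is strict, so the value \<open>R\<close> is never
      reached.\<close>
    have small: "norm (X \<theta> u) < R" if u: "u \<in> {0..c}" "\<And>s. s \<in> {0..u} \<Longrightarrow> norm (X \<theta> s) \<le> R" for u
      unfolding R_def
      by (rule solution_horizon_bound(2)[OF sol[OF u(2)]]) (use u c e init X0 in auto)
    have q0: "norm (X \<theta> 0) \<le> R" using norm_shooting_data[OF d, of \<theta>] d R0 by (simp add: X0 q_def)
    have "continuous_on {0..c} (\<lambda>s. norm (X \<theta> s))" by (intro continuous_intros contXon)
    from first_hit[OF this q0]
    consider "\<forall>t\<in>{0..c}. norm (X \<theta> t) \<le> R"
      | u where "u \<in> {0..c}" "norm (X \<theta> u) = R" "\<forall>t\<in>{0..u}. norm (X \<theta> t) \<le> R" by blast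
    then show ?thesis
    proof cases
      case 1
      then show ?thesis using small[OF s] s by auto
    next
      case (2 u)
      then show ?thesis using small[OF 2(1)] by auto
    qed
  qed
  \<comment> \<open>The norm condition ensures that up to \<open>t\<close> the truncated curve
    solves the original equation, so that its energy is monotone; strict inequalities make the set
    open.\<close>
  define A where "A \<sigma> = {\<theta>. \<exists>t\<in>{0..T}. 6 < vec_energy (X \<theta> t) \<and> 0 < \<sigma> * X \<theta> t $ 2 \<and>
      (\<forall>s\<in>{0..t}. norm (X \<theta> s) < R)}" for \<sigma> :: real
  have openA: "open (A \<sigma>)" for \<sigma>
    unfolding open_dist
  proof
    fix \<theta> assume "\<theta> \<in> A \<sigma>"
    then obtain t where t: "t \<in> {0..T}" "6 < vec_energy (X \<theta> t)" "0 < \<sigma> * X \<theta> t $ 2"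
      "\<And>s. s \<in> {0..t} \<Longrightarrow> norm (X \<theta> s) < R" by (auto simp: A_def)
    have "open {p. 6 < vec_energy p \<and> 0 < \<sigma> * p $ 2}"
      by (intro open_Collect_conj open_Collect_less continuous_on_vec_energy continuous_intros)
    then obtain r where r: "0 < r" "\<And>p. dist p (X \<theta> t) < r \<Longrightarrow> 6 < vec_energy p \<and> 0 < \<sigma> * p $ 2"
      using t(2,3) unfolding open_dist by blast
    have "continuous_on {0..t} (\<lambda>s. norm (X \<theta> s))" by (intro continuous_intros contXon)
    then obtain m where m: "m \<in> {0..t}" "\<And>s. s \<in> {0..t} \<Longrightarrow> norm (X \<theta> s) \<le> norm (X \<theta> m)"
      using continuous_attains_sup[of "{0..t}" "\<lambda>s. norm (X \<theta> s)"] t(1) by auto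
    define k where "k = min r (R - norm (X \<theta> m))"
    have k: "0 < k" using r(1) t(4)[OF m(1)] by (simp add: k_def)
    have "isCont q \<theta>" unfolding q_def by (rule isCont_shooting_data)
    then obtain e where e: "0 < e" "\<And>\<theta>'. dist \<theta>' \<theta> < e \<Longrightarrow> dist (q \<theta>') (q \<theta>) < k / exp (L * T)"
      using k unfolding continuous_at_eps_delta by (metis divide_pos_pos exp_gt_zero)
    have near: "dist (X \<theta>' s) (X \<theta> s) < k" if "dist \<theta>' \<theta> < e" "s \<in> {0..t}" for \<theta>' s
    proof -
      have "dist (X \<theta>' s) (X \<theta> s) \<le> exp (L * \<bar>s\<bar>) * norm (q \<theta>' - q \<theta>)"
        unfolding X_def dist_norm by (rule flow_lipschitz[OF L(2,1)])
      also have "\<dots> \<le> exp (L * T) * norm (q \<theta>' - q \<theta>)"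
        using that(2) t(1) L by (intro mult_right_mono) auto
      also have "\<dots> < exp (L * T) * (k / exp (L * T))"
        using e(2)[OF that(1)] by (intro mult_strict_left_mono) (auto simp: dist_norm)
      finally show ?thesis by simp
    qed
    show "\<exists>e>0. \<forall>\<theta>'. dist \<theta>' \<theta> < e \<longrightarrow> \<theta>' \<in> A \<sigma>"
    proof (intro exI[of _ e] conjI allI impI e(1))
      fix \<theta>' assume \<theta>': "dist \<theta>' \<theta> < e"
      have tt: "t \<in> {0..t}" using t(1) by simp
      have "dist (X \<theta>' t) (X \<theta> t) < r" using near[OF \<theta>' tt] by (simp add: k_def)
      from r(2)[OF this] have "6 < vec_energy (X \<theta>' t)" "0 < \<sigma> * X \<theta>' t $ 2" by auto
      moreover have "norm (X \<theta>' s) < R" if s: "s \<in> {0..t}" for s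
      proof -
        have "norm (X \<theta>' s) \<le> norm (X \<theta> s) + dist (X \<theta>' s) (X \<theta> s)" by norm
        then show ?thesis using near[OF \<theta>' s] m(2)[OF s] by (simp add: k_def)
      qed
      ultimately show "\<theta>' \<in> A \<sigma>" using t(1) by (auto simp: A_def)
    qed
  qed
  have cover: "{0..pi} \<subseteq> A 1 \<union> A (- 1)"
  proof
    fix \<theta> assume \<theta>: "\<theta> \<in> {0..pi}"
    have "\<exists>t\<in>{0..T}. 6 < vec_energy (X \<theta> t)"
    proof (rule ccontr)
      assume "\<not> ?thesis"
      then have e6: "vec_energy (X \<theta> t) \<le> 6" if "t \<in> {0..T}" for t using that by (meson not_le)
      have "norm (X \<theta> s) \<le> R" if "s \<in> {0..T}" for s
        by (rule less_imp_le, rule box[of T]) (use that T e6 in force)+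
      then have "solution_curve_on {0..T} (X \<theta>)" by (rule sol)
      then show False using none e6 \<theta> X0[of \<theta>] unfolding q_def by blast
    qed
    then obtain t where t: "t \<in> {0..T}" "6 < vec_energy (X \<theta> t)" by blast
    \<comment> \<open>A level above 6 and below the energy attained, capped at 7 so that
      \<open>box\<close> applies until it is first reached.\<close>
    define l where "l = min 7 ((6 + vec_energy (X \<theta> t)) / 2)"
    have l: "6 < l" "l \<le> 7" using t(2) by (auto simp: l_def)
    have "l \<le> (6 + vec_energy (X \<theta> t)) / 2" unfolding l_def by (rule min.cobounded2)
    also have "\<dots> < vec_energy (X \<theta> t)" using t(2) by simp
    finally have l3: "l < vec_energy (X \<theta> t)" .
    have c1: "continuous_on {0..t} (\<lambda>s. vec_energy (X \<theta> s))"
      by (rule continuous_on_compose2[OF continuous_on_vec_energy[of UNIV] contXon]) simp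
    have c2: "vec_energy (X \<theta> 0) \<le> l"
      using shooting_data_energy(2)[OF d, of \<theta>] l(1) by (simp add: X0 q_def)
    obtain c where c: "c \<in> {0..t}" "vec_energy (X \<theta> c) = l" "\<forall>s\<in>{0..c}. vec_energy (X \<theta> s) \<le> l"
      using first_hit[OF c1 c2] t(1) l3 by force
    have cT: "c \<in> {0..T}" using c(1) t(1) by auto
    have "norm (X \<theta> s) < R" if "s \<in> {0..c}" for s
      by (rule box[OF cT _ that]) (use c(3) l(2) in force)
    moreover have "X \<theta> c $ 2 \<noteq> 0" using energy_at_rest_le[of "X \<theta> c $ 1" "X \<theta> c $ 3" "X \<theta> c $ 4"] c(2) l(1) by auto
    then have "0 < X \<theta> c $ 2 \<or> 0 < - X \<theta> c $ 2" by linarith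
    ultimately show "\<theta> \<in> A 1 \<union> A (- 1)" using cT c(2) l(1) by (auto simp: A_def)
  qed
  have disj: "A 1 \<inter> A (- 1) \<inter> {0..pi} = {}"
  proof (rule ccontr)
    assume "A 1 \<inter> A (- 1) \<inter> {0..pi} \<noteq> {}"
    then obtain \<theta> where "\<theta> \<in> A 1" "\<theta> \<in> A (- 1)" by blast
    then obtain t1 t2 where t1: "t1 \<in> {0..T}" "6 < vec_energy (X \<theta> t1)" "0 < X \<theta> t1 $ 2" "\<forall>s\<in>{0..t1}. norm (X \<theta> s) < R"
      and t2: "t2 \<in> {0..T}" "6 < vec_energy (X \<theta> t2)" "0 < - X \<theta> t2 $ 2" "\<forall>s\<in>{0..t2}. norm (X \<theta> s) < R"
      by (auto simp: A_def)
    \<comment> \<open>Above energy 6 \<open>v\<close> cannot vanish, so its sign at the earlier of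
      the two times persists until the later one.\<close>
    have keep: "v b \<noteq> 0 \<and> (0 < \<sigma> * v a \<longrightarrow> 0 < \<sigma> * v b)"
      if "0 \<le> a" "a \<le> b" "6 < vec_energy (X \<theta> a)" "\<forall>s\<in>{0..b}. norm (X \<theta> s) < R" "v = (\<lambda>t. X \<theta> t $ 2)" for a b \<sigma> v
    proof -
      have s: "solution_curve_on {0..b} (X \<theta>)" by (rule sol) (use that(4) in force)
      have nz: "X \<theta> u $ 2 \<noteq> 0" if u: "u \<in> {a..b}" for u
      proof
        assume "X \<theta> u $ 2 = 0"
        moreover have "vec_energy (X \<theta> a) \<le> vec_energy (X \<theta> u)"
          by (rule energy_mono[OF s]) (use u \<open>0 \<le> a\<close> in auto)
        ultimately show False
          using energy_at_rest_le[of "X \<theta> u $ 1" "X \<theta> u $ 3" "X \<theta> u $ 4"] \<open>6 < vec_energy (X \<theta> a)\<close> by simp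
      qed
      have "0 < \<sigma> * X \<theta> b $ 2" if pos: "0 < \<sigma> * X \<theta> a $ 2"
      proof (rule isCont_nonzero_same_sign[of a b "\<lambda>t. \<sigma> * X \<theta> t $ 2", OF _ _ \<open>a \<le> b\<close> pos])
        show "isCont (\<lambda>t. \<sigma> * X \<theta> t $ 2) t" for t by (intro continuous_intros contX)
        show "\<sigma> * X \<theta> t $ 2 \<noteq> 0" if "t \<in> {a..b}" for t using nz[OF that] pos by auto
      qed
      then show ?thesis using nz[of b] that(2,5) by auto
    qed
    show False
    proof (cases "t1 \<le> t2")
      case True
      then show False using keep[of t1 t2 "\<lambda>t. X \<theta> t $ 2" 1] t1 t2 by auto
    next
      case False
      then show False using keep[of t2 t1 "\<lambda>t. X \<theta> t $ 2" "- 1"] t1 t2 by auto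
    qed
  qed
  have qpi: "q pi = - q 0" by (simp add: q_def shooting_data_def vec_eq_iff forall_4)
  have Xpi: "X pi t = - X 0 t" for t
    unfolding X_def qpi by (rule flow_minus[OF L(2,1)]) (use R0 in \<open>simp add: F_def truncated_field_minus\<close>)
  have swap: "0 \<in> A \<sigma> \<longleftrightarrow> pi \<in> A (- \<sigma>)" for \<sigma>
    unfolding A_def by (simp add: Xpi energy_minus)
  have "A 1 \<inter> {0..pi} = {} \<or> A (- 1) \<inter> {0..pi} = {}"
    by (rule connectedD[OF connected_Icc openA openA disj cover])
  moreover have "0 \<in> {0..pi}" "pi \<in> {0..pi}" by simp_all
  moreover have "0 \<in> A 1 \<longleftrightarrow> pi \<in> A (- 1)" "0 \<in> A (- 1) \<longleftrightarrow> pi \<in> A 1"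
    using swap[of 1] swap[of "- 1"] by simp_all
  ultimately show False using cover by blast
qed

text \<open>Angles that work up to time \<open>n + 1\<close> accumulate at one that works for all
  times. The bounds on \<open>[0,n]\<close> do not depend on \<open>n\<close>:
  \<open>|v| <= 3\<close>, \<open>|y| <= 6\<close> and \<open>|z| <= 10 + 546/2 = 283\<close>,
  whence the radius 300. One unit of time is lost to \<open>solution_yz_bound\<close>.\<close>

lemma forward_solution:
  assumes d: "0 < \<delta>" "\<delta> \<le> 1/2" and L: "0 < L" "L-lipschitz_on UNIV (truncated_field 300)"
  shows "\<exists>\<theta>. solution_curve_on {0..} (flow (truncated_field 300) (shooting_data \<delta> \<theta>)) \<and>
     (\<forall>t\<ge>0. \<forall>i. i \<noteq> 1 \<longrightarrow> \<bar>flow (truncated_field 300) (shooting_data \<delta> \<theta>) t $ i\<bar> \<le> 300)"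
proof -
  define F where "F = truncated_field 300"
  note L = L[folded F_def]
  define q where "q = shooting_data \<delta>"
  have "\<forall>n::nat. \<exists>\<theta> x. \<theta> \<in> {0..pi} \<and> solution_curve_on {0..real n + 1} x \<and> x 0 = q \<theta> \<and>
     (\<forall>t\<in>{0..real n + 1}. vec_energy (x t) \<le> 6)"
    using finite_horizon_solution[OF d, of "real _ + 1"] unfolding q_def by fastforce
  then obtain \<theta> x where \<theta>: "\<And>n. \<theta> n \<in> {0..pi}" and sol: "\<And>n. solution_curve_on {0..real n + 1} (x n)"
    and x0: "\<And>n. x n 0 = q (\<theta> n)" and e6: "\<And>n t. t \<in> {0..real n + 1} \<Longrightarrow> vec_energy (x n t) \<le> 6"
    by metis
  note init = shooting_data_admissible[OF d, folded q_def]
  have bd: "\<bar>x n t $ i\<bar> \<le> 300" if t: "t \<in> {0..real n}" and i: "i \<noteq> 1" for n t i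
  proof -
    have e7: "vec_energy (x n t) \<le> 7" if "t \<in> {0..real n + 1}" for t using e6[OF that] by simp
    have v: "\<bar>x n t $ 2\<bar> \<le> 3" if "t \<in> {0..real n + 1}" for t
      by (rule solution_horizon_bound(1)[OF sol _ order_refl init[of "\<theta> n", folded x0[of n]] e7 that]) simp
    have y0: "\<bar>x n 0 $ 3\<bar> \<le> 6" by (simp add: x0 init)
    have t': "0 \<le> t" "t \<le> real n + 1 - 1" using t by auto
    have "\<bar>x n t $ 3\<bar> \<le> 6" "\<bar>x n t $ 4\<bar> \<le> \<bar>x n 0 $ 4\<bar> + ((13 + 6 * 3^2) * 6 + 12 + 4 * 3^2 + 14 * 3 + 2 * 3^3) / 2"
      by (rule solution_yz_bound[OF sol v y0 _ _ t']; simp)+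
    moreover have "\<bar>x n t $ 2\<bar> \<le> 3" using v t by simp
    ultimately show ?thesis using init(4)[of "\<theta> n"] exhaust_4[of i] i by (auto simp: x0)
  qed
  have eq: "x n t = flow F (q (\<theta> n)) t" if t: "t \<in> {0..real n}" for n t
  proof -
    have "x n (0 + t) = flow F (x n 0) t"
      unfolding F_def
      by (rule solution_curve_eq_flow[OF L(2,1)[unfolded F_def]])
         (use t bd in \<open>auto intro: solution_on_subset[OF sol]\<close>)
    then show ?thesis by (simp add: x0)
  qed
  obtain l r where l: "strict_mono (r :: nat \<Rightarrow> nat)" "(\<theta> \<circ> r) \<longlonglongrightarrow> l"
    using compact_imp_seq_compact[OF compact_Icc[of 0 pi]] \<theta> unfolding seq_compact_def by metis
  have "isCont q l" unfolding q_def by (rule isCont_shooting_data)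
  then have q: "(\<lambda>n. q (\<theta> (r n))) \<longlonglongrightarrow> q l"
    using l(2) by (auto intro: isCont_tendsto_compose simp: o_def)
  have b: "\<bar>flow F (q l) t $ i\<bar> \<le> 300" if t: "0 \<le> t" and i: "i \<noteq> 1" for t i
  proof (rule tendsto_upperbound)
    show "(\<lambda>n. \<bar>flow F (q (\<theta> (r n))) t $ i\<bar>) \<longlonglongrightarrow> \<bar>flow F (q l) t $ i\<bar>"
      by (intro tendsto_intros tendsto_flow[OF L(2,1) q])
    show "eventually (\<lambda>n. \<bar>flow F (q (\<theta> (r n))) t $ i\<bar> \<le> 300) sequentially"
      using eventually_ge_at_top[of "nat \<lceil>t\<rceil>"]
    proof eventually_elim
      case (elim n)
      have "t \<le> real n" using elim by linarith
      also have "\<dots> \<le> real (r n)" using seq_suble[OF l(1), of n] by simp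
      finally have "t \<in> {0..real (r n)}" using t by simp
      then show ?case using bd[OF _ i] eq by metis
    qed
  qed simp
  have "solution_curve_on {0..} (flow F (q l))"
    unfolding solution_curve_on_iff
  proof
    fix t :: real assume "t \<in> {0..}"
    then have "F (flow F (q l) t) = autonomous_field (flow F (q l) t)"
      using b[of t 2] b[of t 3] b[of t 4] unfolding F_def by (intro truncated_field_eq) auto
    then show "(flow F (q l) has_vector_derivative autonomous_field (flow F (q l) t)) (at t)"
      using flow_props(2)[OF L(2,1), of "q l" t] by simp
  qed
  then show ?thesis using b unfolding F_def q_def by blast
qed

lemma entire_solution_exists:
  "\<exists>\<phi> v y z. solution_on UNIV \<phi> v y z \<and> (\<phi> \<longlongrightarrow> 0) at_bot \<and> \<phi> 0 \<noteq> 0"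
proof -
  define F where "F = truncated_field 300"
  obtain L where L: "0 < L" "L-lipschitz_on UNIV F"
    using truncated_field_lipschitz[of 300] unfolding F_def by auto
  define \<delta> where "\<delta> n = 1 / (real n + 2)" for n
  have d: "0 < \<delta> n" "\<delta> n \<le> 1/2" for n by (auto simp: \<delta>_def field_simps)
  have "\<exists>p. norm p \<le> 12 * \<delta> n \<and> \<bar>p $ 1\<bar> \<le> 1/2 \<and> - 6 < vec_energy p \<and> solution_curve_on {0..} (flow F p) \<and>
      (\<forall>t\<ge>0. \<forall>i. i \<noteq> 1 \<longrightarrow> \<bar>flow F p t $ i\<bar> \<le> 300)" for n
  proof -
    obtain \<theta> where "solution_curve_on {0..} (flow F (shooting_data (\<delta> n) \<theta>))"
      "\<forall>t\<ge>0. \<forall>i. i \<noteq> 1 \<longrightarrow> \<bar>flow F (shooting_data (\<delta> n) \<theta>) t $ i\<bar> \<le> 300"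
      using forward_solution[OF d L[unfolded F_def]] unfolding F_def by blast
    moreover have "\<bar>shooting_data (\<delta> n) \<theta> $ 1\<bar> \<le> 1/2"
      using shooting_data_bounds(1)[OF d, of n \<theta>] d(2)[of n] by linarith
    ultimately show ?thesis
      using norm_shooting_data[OF d] shooting_data_energy(1)[OF d] by blast
  qed
  then obtain p where pn: "\<And>n. norm (p n) \<le> 12 * \<delta> n" and p1: "\<And>n. \<bar>p n $ 1\<bar> \<le> 1/2"
    and pe: "\<And>n. - 6 < vec_energy (p n)" and sol: "\<And>n. solution_curve_on {0..} (flow F (p n))"
    and bd: "\<And>n t i. 0 \<le> t \<Longrightarrow> i \<noteq> 1 \<Longrightarrow> \<bar>flow F (p n) t $ i\<bar> \<le> 300"
    by metis
  note f0 = flow_props(1)[OF L(2,1)]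
  have e_ge: "vec_energy (p n) \<le> vec_energy (flow F (p n) t)" if "0 \<le> t" for n t
    using energy_mono[OF sol, of 0 t n] that by (auto simp: f0)
  have e_le: "vec_energy (flow F (p n) t) \<le> 6" if "0 \<le> t" for n t
    using energy_le_6[OF sol that] by simp
  have "\<exists>c\<ge>0. \<bar>flow F (p n) c $ 1\<bar> = pi / 4 \<and> (\<forall>t\<in>{0..c}. \<bar>flow F (p n) t $ 1\<bar> \<le> pi / 4)" for n
  proof -
    let ?x = "flow F (p n)"
    \<comment> \<open>Within the strip the only possible limit is the origin, whose energy -6 lies
      below the starting energy.\<close>
    have "\<exists>t\<ge>0. pi / 4 < \<bar>?x t $ 1\<bar>"
    proof (rule ccontr)
      assume "\<not> ?thesis"
      then have le: "\<bar>?x t $ 1\<bar> \<le> pi / 4" if "0 \<le> t" for t using that not_le by blast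
      note lims = solution_limits_at_top[OF sol, of n]
      obtain k :: int where k: "((\<lambda>s. ?x s $ 1) \<longlongrightarrow> of_int k * pi / 2) at_top" using lims(4) by blast
      have "\<bar>of_int k * pi / 2\<bar> \<le> pi / 4"
      proof (rule tendsto_upperbound[OF tendsto_rabs[OF k]])
        show "eventually (\<lambda>t. \<bar>?x t $ 1\<bar> \<le> pi / 4) at_top"
          using eventually_ge_at_top[of 0] by eventually_elim (rule le)
      qed simp
      then have "\<bar>of_int k :: real\<bar> \<le> 1/2" using pi_gt_zero by (simp add: abs_mult)
      then have "k = 0" by linarith
      then have phi: "((\<lambda>s. ?x s $ 1) \<longlongrightarrow> 0) at_top" using k by simp
      have "((\<lambda>s. vec_energy (?x s)) \<longlongrightarrow> energy 0 0 0 0) at_top"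
        unfolding energy_def kinetic_def by (intro tendsto_intros phi lims) simp
      then have "energy 0 0 0 0 \<ge> vec_energy (p n)"
      proof (rule tendsto_lowerbound)
        show "eventually (\<lambda>t. vec_energy (p n) \<le> vec_energy (?x t)) at_top"
          using eventually_ge_at_top[of 0] by eventually_elim (rule e_ge)
      qed simp
      then show False using pe[of n] by (simp add: energy_def kinetic_def)
    qed
    then obtain t where t: "0 \<le> t" "pi / 4 < \<bar>?x t $ 1\<bar>" by blast
    have c1: "continuous_on {0..t} (\<lambda>s. \<bar>?x s $ 1\<bar>)"
      by (intro continuous_at_imp_continuous_on ballI continuous_intros isCont_flow[OF L(2,1)])
    have c2: "\<bar>?x 0 $ 1\<bar> \<le> pi / 4" using p1[of n] pi_gt3 by (simp add: f0)
    from first_hit[OF c1 c2] obtain c where c: "c \<in> {0..t}" "\<bar>?x c $ 1\<bar> = pi / 4" "\<forall>s\<in>{0..c}. \<bar>?x s $ 1\<bar> \<le> pi / 4"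
      using t by force
    then show ?thesis by (intro exI[of _ c]) auto
  qed
  then obtain c where c0: "\<And>n. 0 \<le> c n" and c1: "\<And>n. \<bar>flow F (p n) (c n) $ 1\<bar> = pi / 4"
    and c2: "\<And>n t. t \<in> {0..c n} \<Longrightarrow> \<bar>flow F (p n) t $ 1\<bar> \<le> pi / 4" by metis
  define w where "w n = flow F (p n) (c n)" for n
  have zero: "flow F 0 t = 0" for t
    using flow_minus[OF L(2,1), of 0 t] truncated_field_minus[of 300] by (simp add: F_def vec_eq_iff)
  \<comment> \<open>The origin is fixed and the flow is Lipschitz in its data, so reaching
    \<open>pi / 4\<close> from data of size \<open>12 \<delta> n\<close> takes ever longer. Every
    negative time of the limit curve is thus eventually covered by the shifted forward
    solutions.\<close>
  have c_large: "eventually (\<lambda>n. S \<le> c n) sequentially" for S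
  proof -
    have "(\<lambda>n. 1 / (real n + 2)) \<longlonglongrightarrow> 0"
      by (rule tendsto_divide_0[OF tendsto_const filterlim_at_top_imp_at_infinity])
         (rule filterlim_compose[OF filterlim_add_const_at_top filterlim_real_sequentially])
    then have "(\<lambda>n. exp (L * \<bar>S\<bar>) * (12 * (1 / (real n + 2)))) \<longlonglongrightarrow> exp (L * \<bar>S\<bar>) * (12 * 0)"
      by (intro tendsto_intros)
    then have "eventually (\<lambda>n. exp (L * \<bar>S\<bar>) * (12 * \<delta> n) < pi / 4) sequentially"
      unfolding \<delta>_def by (rule order_tendstoD(2)) simp
    then show ?thesis
    proof eventually_elim
      case (elim n)
      show ?case
      proof (rule ccontr)
        assume "\<not> ?case"
        then have S: "c n \<le> \<bar>S\<bar>" by linarith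
        have "pi / 4 \<le> norm (w n)" using component_le_norm_cart[of "w n" 1] c1[of n] by (simp add: w_def)
        also have "\<dots> \<le> exp (L * \<bar>c n\<bar>) * norm (p n)"
          using flow_lipschitz[OF L(2,1), of "p n" "c n" 0] by (simp add: zero w_def)
        also have "\<dots> \<le> exp (L * \<bar>S\<bar>) * (12 * \<delta> n)"
          using S c0[of n] L pn[of n] by (intro mult_mono) auto
        finally show False using elim by simp
      qed
    qed
  qed
  \<comment> \<open>One component of modulus \<open>pi / 4 <= 1\<close> and three of modulus at most
    300.\<close>
  have "norm (w n) \<le> 901" for n
  proof -
    have "norm (w n) \<le> (\<Sum>i\<in>UNIV. \<bar>w n $ i\<bar>)" by (rule norm_le_l1_cart)
    also have "\<dots> = \<bar>w n $ 1\<bar> + \<bar>w n $ 2\<bar> + \<bar>w n $ 3\<bar> + \<bar>w n $ 4\<bar>" by (simp add: sum_4)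
    also have "\<dots> \<le> 901"
      using c1[of n] bd[OF c0[of n], of 2 n] bd[OF c0[of n], of 3 n] bd[OF c0[of n], of 4 n] pi_less_4
      by (simp add: w_def)
    finally show ?thesis .
  qed
  then have "\<forall>n. w n \<in> cball 0 901" by simp
  then obtain u r where u: "strict_mono (r :: nat \<Rightarrow> nat)" "(w \<circ> r) \<longlonglongrightarrow> u"
    using compact_imp_seq_compact[OF compact_cball] unfolding seq_compact_def by metis
  define X where "X = flow F u"
  have lim: "(\<lambda>n. flow F (p (r n)) (c (r n) + s)) \<longlonglongrightarrow> X s" for s
    using tendsto_flow[OF L(2,1), of "\<lambda>n. w (r n)" u sequentially s] u(2)
    by (simp add: o_def w_def X_def flow_add[OF L(2,1)])
  have large: "eventually (\<lambda>n. 0 \<le> c (r n) + s) sequentially" for s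
  proof -
    have "eventually (\<lambda>n. - s \<le> c (r n)) sequentially"
      using c_large[of "- s"] filterlim_subseq[OF u(1)] by (rule eventually_compose_filterlim)
    then show ?thesis by eventually_elim simp
  qed
  have b: "\<bar>X s $ i\<bar> \<le> 300" if "i \<noteq> 1" for s i
  proof (rule tendsto_upperbound)
    show "(\<lambda>n. \<bar>flow F (p (r n)) (c (r n) + s) $ i\<bar>) \<longlonglongrightarrow> \<bar>X s $ i\<bar>" by (intro tendsto_intros lim)
    show "eventually (\<lambda>n. \<bar>flow F (p (r n)) (c (r n) + s) $ i\<bar> \<le> 300) sequentially"
      using large[of s] by eventually_elim (rule bd[OF _ that])
  qed simp
  have le4: "\<bar>X s $ 1\<bar> \<le> pi / 4" if s: "s \<le> 0" for s
  proof (rule tendsto_upperbound)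
    show "(\<lambda>n. \<bar>flow F (p (r n)) (c (r n) + s) $ 1\<bar>) \<longlonglongrightarrow> \<bar>X s $ 1\<bar>" by (intro tendsto_intros lim)
    show "eventually (\<lambda>n. \<bar>flow F (p (r n)) (c (r n) + s) $ 1\<bar> \<le> pi / 4) sequentially"
      using large[of s]
    proof eventually_elim
      case (elim n)
      show ?case by (rule c2) (use elim s in auto)
    qed
  qed simp
  have ge6: "- 6 \<le> vec_energy (X s)" for s
  proof (rule tendsto_lowerbound[OF tendsto_vec_energy[OF lim]])
    show "eventually (\<lambda>n. - 6 \<le> vec_energy (flow F (p (r n)) (c (r n) + s))) sequentially"
      using large[of s]
    proof eventually_elim
      case (elim n)
      then show ?case using e_ge[OF elim, of "r n"] pe[of "r n"] by linarith
    qed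
  qed simp
  have X0: "\<bar>X 0 $ 1\<bar> = pi / 4"
  proof (rule LIMSEQ_unique)
    show "(\<lambda>n. \<bar>flow F (p (r n)) (c (r n) + 0) $ 1\<bar>) \<longlonglongrightarrow> \<bar>X 0 $ 1\<bar>" by (intro tendsto_intros lim)
    show "(\<lambda>n. \<bar>flow F (p (r n)) (c (r n) + 0) $ 1\<bar>) \<longlonglongrightarrow> pi / 4" by (simp add: c1)
  qed
  have solX: "solution_curve_on UNIV X"
    unfolding solution_curve_on_iff
  proof
    fix t
    have "F (X t) = autonomous_field (X t)"
      using b[of 2 t] b[of 3 t] b[of 4 t] unfolding F_def by (intro truncated_field_eq) auto
    then show "(X has_vector_derivative autonomous_field (X t)) (at t)"
      using flow_props(2)[OF L(2,1), of u t] by (simp add: X_def)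
  qed
  obtain e where e: "((\<lambda>s. vec_energy (X s)) \<longlongrightarrow> e) at_bot"
    using mono_tendsto_at_bot[of "\<lambda>s. vec_energy (X s)" "- 6"] ge6 energy_mono[OF solX] by auto
  \<comment> \<open>Before time 0 the limit curve stays in the closed strip, where
    \<open>arcsin\<close> inverts the sine of \<open>2 \<phi>\<close>; so convergence of the sine
    already gives convergence of \<phi>.\<close>
  have sin: "((\<lambda>s. sin (2 * X s $ 1)) \<longlongrightarrow> 0) at_bot"
    by (rule solution_limits(4)[OF solX filterlim_add_const_at_bot _ _ e, of 300]) (simp_all add: b)
  have "((\<lambda>s. arcsin (sin (2 * X s $ 1)) / 2) \<longlongrightarrow> arcsin 0 / 2) at_bot"
    by (intro tendsto_intros isCont_tendsto_compose[OF _ sin] isCont_arcsin) auto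
  moreover have "eventually (\<lambda>s. arcsin (sin (2 * X s $ 1)) / 2 = X s $ 1) at_bot"
    using eventually_le_at_bot[of 0]
  proof eventually_elim
    case (elim s)
    have "arcsin (sin (2 * X s $ 1)) = 2 * X s $ 1" using le4[OF elim] by (intro arcsin_sin) linarith+
    then show ?case by simp
  qed
  ultimately have "((\<lambda>s. X s $ 1) \<longlongrightarrow> 0) at_bot"
    using Lim_transform_eventually by force
  moreover have "X 0 $ 1 \<noteq> 0" using X0 pi_gt_zero by auto
  ultimately show ?thesis using solX by blast
qed

theorem theorem2:
  shows "(\<forall>\<psi>. nontrivial_radial_solution \<psi> \<longrightarrow>
            (let \<phi> = (\<lambda>s. \<psi> (exp s)) in
              solves_autonomous_equation \<phi> \<and>
              (heteroclinic_orbit autonomous_field (phase_curve \<phi>) 0 (vector [- pi / 2, 0, 0, 0]) \<or>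
               heteroclinic_orbit autonomous_field (phase_curve \<phi>) 0 (vector [pi / 2, 0, 0, 0]))))
       \<and> (\<exists>\<psi>. nontrivial_radial_solution \<psi>)"
proof (intro conjI allI impI)
  fix \<psi> assume "nontrivial_radial_solution \<psi>"
  note r = radial_solution_imp_solution_on[OF this]
  obtain v y z where sol: "solution_on UNIV (\<lambda>s. \<psi> (exp s)) v y z" using r(1) by blast
  obtain s where s: "\<psi> (exp s) \<noteq> 0" using r(3) by blast
  show "let \<phi> = (\<lambda>s. \<psi> (exp s)) in
      solves_autonomous_equation \<phi> \<and>
      (heteroclinic_orbit autonomous_field (phase_curve \<phi>) 0 (vector [- pi / 2, 0, 0, 0]) \<or>
       heteroclinic_orbit autonomous_field (phase_curve \<phi>) 0 (vector [pi / 2, 0, 0, 0]))"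
    unfolding Let_def
    using solution_on_UNIV_solves(1)[OF sol] solution_on_UNIV_heteroclinic[OF sol r(2) s] by (rule conjI)
next
  show "\<exists>\<psi>. nontrivial_radial_solution \<psi>"
    using entire_solution_exists solution_on_imp_radial_solution by blast
qed

end
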